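(* Let $X$ and $Y$ be simplicial sets and let $X\times Y$ be their product. The Eilenberg-Zilber vector field $V_{X\times Y}$ is an admissible discrete vector field on $C_*^{\mathrm{ND}}(X\times Y)$ and induces the Eilenberg-Zilber W-reduction $$EZ:\ C_*^{\mathrm{ND}}(X\times Y)\ \Longrightarrow\ C_*^{\mathrm{ND}}(X)\otimes C_*^{\mathrm{ND}}(Y),$$ that is, the critical complex of the W-reduction determined by $V_{X\times Y}$ is the usual tensor product of chain complexes $C_*^{\mathrm{ND}}(X)\otimes C_*^{\mathrm{ND}}(Y)$.
   Context: $C_*^{\mathrm{ND}}$ denotes the normalized chain complex of a simplicial set over $\mathbb Z$, with distinguished basis the non-degenerate simplices. The tensor product has differential $d(\sigma\otimes\tau)=d\sigma\otimes\tau+(-1)^{|\sigma|}\sigma\otimes d\tau$. Discrete vector fields. Let $C=(C_p,d_p,\beta_p)_p$ be a chain complex of free $\mathbb Z$-modules with distinguished (possibly infinite) bases $\beta_p$ of "cells". A $(p-1)$-cell $\sigma$ is a face (resp. regular face) of a $p$-cell $\tau$ if its coefficient in $d\tau$ is nonzero (resp. $\pm1$). A discrete vector field is a set $V$ of pairs $(\sigma,\tau)$, with $\sigma$ (the source) a regular face of $\tau$ (the target), every cell appearing at most once in $V$; cells not appearing are critical. A $V$-path of length $m$ is a sequence $((\sigma_k,\tau_k))_{0\le k<m}$ in $V$ with all $\tau_k$ of the same degree and, for $0<k<m$, $\sigma_k$ a face of $\tau_{k-1}$ different from $\sigma_{k-1}$. $V$ is admissible if for every cell $\sigma$ the lengths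 of the $V$-paths starting from $\sigma$ are bounded by some integer $\lambda(\sigma)$. W-reduction. A reduction $(f,g,h)$ from $\widehat C_*$ to $C_*$ consists of chain maps $f:\widehat C_*\to C_*$, $g:C_*\to\widehat C_*$ and a degree $+1$ map $h$ on $\widehat C_*$ with $fg=\mathrm{id}$, $gf+dh+hd=\mathrm{id}$, $fh=0$, $hg=0$, $hh=0$. If $V$ is admissible, write $C_p=C_p^t\oplus C_p^s\oplus C_p^c$ (spans of the target, source and critical cells), and let $d_{p,i,j}$ be the component of $d_p$ from the $j$-th to the $i$-th summand; then $d_{p,2,1}:C^t_p\to C^s_{p-1}$ is invertible and the W-reduction determined by $V$ is the reduction of $C$ to the critical complex $(C^c_*,d')$ with $d'_p=d_{p,3,3}-d_{p,3,1}d_{p,2,1}^{-1}d_{p,2,3}$, $f_p=[\,0\ \ -d_{p,3,1}d_{p,2,1}^{-1}\ \ 1\,]$, $g_p={}^t[\,-d_{p,2,1}^{-1}d_{p,2,3}\ \ 0\ \ 1\,]$, and $h_{p-1}$ equal to $d_{p,2,1}^{-1}$ on $C^s_{p-1}$ and $0$ on $C^t_{p-1}\oplus C^c_{p-1}$. Paths. Let $\underline p=\{0,\ldots,p\}$. Every simplex of a simplicial set is uniquely $\alpha^*\sigma$ with $\sigma$ non-degenerate and $\alpha$ an order-preserving surjection. Let $\rho=(\alpha^*\sigma,\beta^*\tau)$ be a non-degenerate $n$-simplex of $X\times Y$, with $\sigma\in X_p$, $\tau\in Y_q$ non-degenerate and $\alpha:\underline n\to\underline p$, $\beta:\underline n\to\underline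 q$ order-preserving surjections. Its path is $\pi(\rho)=((\alpha(i),\beta(i)))_{0\le i\le n}$ in the lattice $\underline p\times\underline q$ (first coordinate horizontal, second vertical). It goes from $(0,0)$ to $(p,q)$ and each step is $(1,0)$ (horizontal), $(0,1)$ (vertical) or $(1,1)$ (diagonal). For fixed $\sigma,\tau$ all paths with such steps from $(0,0)$ to $(p,q)$ occur, each exactly once. Classification. Run $\pi(\rho)$ backward from $(p,q)$ to $(0,0)$ and look for the first event, an event being either a diagonal step, or a bend at a point which (in the forward direction) is reached by a vertical step and left by a horizontal step. If the first event is a diagonal step, $\rho$ is a source simplex; if it is such a bend, $\rho$ is a target simplex; if there is no event, $\rho$ is critical, and then $\pi(\rho)=((0,0),(1,0),\ldots,(p,0),(p,1),\ldots,(p,q))$. Eilenberg-Zilber vector field $V_{X\times Y}$: the set of pairs $(\rho_1,\rho_2)$, with $\rho_2$ a target simplex and $\rho_1$ the source simplex with the same $\sigma,\tau$ whose path is obtained from $\pi(\rho_2)$ by removing the bend point which is its first event. (Equivalently, in $\pi(\rho_1)$ the first-event diagonal step from $(a,b)$ to $(a+1,b+1)$ is replaced by $(a,b),(a,b+1),(a+1,b+1)$ to get $\pi(\rho_2)$.) The critical simplex associated with $\sigma\in X^{\mathrm{ND}}_p$ and $\tau\in Y^{\mathrm{ND}}_q$ is identified with the generator $\sigma\otimes\tau$. *)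

theory Defs
  imports Main "HOL-Library.FuncSet" "HOL-Library.Poly_Mapping"
begin

section \<open>Simplicial sets\<close>

text \<open>The morphisms from \<open>{0..m}\<close> to \<open>{0..n}\<close> in the simplex category. They are extensional functions,
  so that equality of morphisms is equality of HOL functions.\<close>

definition ord_maps :: "nat \<Rightarrow> nat \<Rightarrow> (nat \<Rightarrow> nat) set" where
  "ord_maps m n = {\<alpha> \<in> {0..m} \<rightarrow>\<^sub>E {0..n}. mono_on {0..m} \<alpha>}"

definition ord_surjs :: "nat \<Rightarrow> nat \<Rightarrow> (nat \<Rightarrow> nat) set" where
  "ord_surjs m n = {\<alpha> \<in> ord_maps m n. \<alpha> ` {0..m} = {0..n}}"

text \<open>\<open>act X m n \<alpha>\<close> is the structure map from \<open>simps X n\<close> to \<open>simps X m\<close> induced by a morphism \<open>\<alpha>\<close> from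
  \<open>{0..m}\<close> to \<open>{0..n}\<close>. The sets \<open>simps X n\<close> need not be disjoint for different \<open>n\<close>; the
  dimension is always carried separately.\<close>

record 'a sset =
  simps :: "nat \<Rightarrow> 'a set"
  act :: "nat \<Rightarrow> nat \<Rightarrow> (nat \<Rightarrow> nat) \<Rightarrow> 'a \<Rightarrow> 'a"

locale simplicial_set =
  fixes X :: "'a sset"
  assumes act_closed:
      "\<lbrakk>\<alpha> \<in> ord_maps m n; x \<in> simps X n\<rbrakk> \<Longrightarrow> act X m n \<alpha> x \<in> simps X m"
    and act_id:
      "x \<in> simps X n \<Longrightarrow> act X n n (\<lambda>i\<in>{0..n}. i) x = x"
    and act_compose:
      "\<lbrakk>\<alpha> \<in> ord_maps l m; \<beta> \<in> ord_maps m n; x \<in> simps X n\<rbrakk>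
        \<Longrightarrow> act X l n (compose {0..l} \<beta> \<alpha>) x = act X l m \<alpha> (act X m n \<beta> x)"

definition sset_prod :: "'a sset \<Rightarrow> 'b sset \<Rightarrow> ('a \<times> 'b) sset" where
  "sset_prod X Y =
    \<lparr>simps = (\<lambda>n. simps X n \<times> simps Y n),
     act = (\<lambda>m n \<alpha>. map_prod (act X m n \<alpha>) (act Y m n \<alpha>))\<rparr>"

definition nondeg :: "'a sset \<Rightarrow> nat \<Rightarrow> 'a set" where
  "nondeg X n = {x \<in> simps X n. \<not> (\<exists>m<n. \<exists>\<alpha>\<in>ord_surjs n m. \<exists>y\<in>simps X m. x = act X n m \<alpha> y)}"

text \<open>The \<open>i\<close>-th coface map from \<open>{0..n}\<close> to \<open>{0..Suc n}\<close>, which misses the value \<open>i\<close>.\<close>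

definition coface :: "nat \<Rightarrow> nat \<Rightarrow> nat \<Rightarrow> nat" where
  "coface n i = (\<lambda>j\<in>{0..n}. if j < i then j else Suc j)"

section \<open>Chain complexes with distinguished bases\<close>

text \<open>The module in degree \<open>p\<close> is the free abelian group on \<open>cells C p\<close>, realised as the integer-valued
  finitely supported functions with support in \<open>cells C p\<close>. Complexes are concentrated in
  nonnegative degrees; \<open>bdry C p\<close> goes from degree \<open>p\<close> to degree \<open>p - 1\<close>. Subtraction on
  \<^typ>\<open>nat\<close> is truncated, but \<open>bdry C 0\<close> is zero.\<close>

definition free_span :: "'b set \<Rightarrow> ('b \<Rightarrow>\<^sub>0 int) set" where
  "free_span S = {c. Poly_Mapping.keys c \<subseteq> S}"

record 'b based_complex =
  cells :: "nat \<Rightarrow> 'b set"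
  bdry :: "nat \<Rightarrow> ('b \<Rightarrow>\<^sub>0 int) \<Rightarrow> ('b \<Rightarrow>\<^sub>0 int)"

abbreviation chain_group :: "'b based_complex \<Rightarrow> nat \<Rightarrow> ('b \<Rightarrow>\<^sub>0 int) set" where
  "chain_group C p \<equiv> free_span (cells C p)"

definition additive_map ::
    "('a \<Rightarrow>\<^sub>0 int) set \<Rightarrow> ('b \<Rightarrow>\<^sub>0 int) set \<Rightarrow> (('a \<Rightarrow>\<^sub>0 int) \<Rightarrow> ('b \<Rightarrow>\<^sub>0 int)) \<Rightarrow> bool" where
  "additive_map M N \<phi> \<longleftrightarrow> \<phi> \<in> M \<rightarrow> N \<and> (\<forall>a\<in>M. \<forall>b\<in>M. \<phi> (a + b) = \<phi> a + \<phi> b)"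

definition chain_complex :: "'b based_complex \<Rightarrow> bool" where
  "chain_complex C \<longleftrightarrow>
    (\<forall>p. additive_map (chain_group C p) (chain_group C (p - 1)) (bdry C p)) \<and>
    (\<forall>c\<in>chain_group C 0. bdry C 0 c = 0) \<and>
    (\<forall>p. \<forall>c\<in>chain_group C (Suc p). bdry C p (bdry C (Suc p) c) = 0)"

definition chain_map ::
    "'a based_complex \<Rightarrow> 'b based_complex \<Rightarrow> (nat \<Rightarrow> ('a \<Rightarrow>\<^sub>0 int) \<Rightarrow> ('b \<Rightarrow>\<^sub>0 int)) \<Rightarrow> bool" where
  "chain_map C D f \<longleftrightarrow>
    (\<forall>p. additive_map (chain_group C p) (chain_group D p) (f p)) \<and>
    (\<forall>p. \<forall>c\<in>chain_group C (Suc p). bdry D (Suc p) (f (Suc p) c) = f p (bdry C (Suc p) c))"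

text \<open>For \<open>p = 0\<close> the summand \<open>h (p - 1) (bdry C p c)\<close> below is \<open>h 0 0 = 0\<close>.\<close>

definition reduction ::
    "'a based_complex \<Rightarrow> 'b based_complex \<Rightarrow>
     (nat \<Rightarrow> ('a \<Rightarrow>\<^sub>0 int) \<Rightarrow> ('b \<Rightarrow>\<^sub>0 int)) \<Rightarrow> (nat \<Rightarrow> ('b \<Rightarrow>\<^sub>0 int) \<Rightarrow> ('a \<Rightarrow>\<^sub>0 int)) \<Rightarrow>
     (nat \<Rightarrow> ('a \<Rightarrow>\<^sub>0 int) \<Rightarrow> ('a \<Rightarrow>\<^sub>0 int)) \<Rightarrow> bool" where
  "reduction C D f g h \<longleftrightarrow>
    chain_complex C \<and> chain_complex D \<and> chain_map C D f \<and> chain_map D C g \<and>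
    (\<forall>p. additive_map (chain_group C p) (chain_group C (Suc p)) (h p)) \<and>
    (\<forall>p. \<forall>c\<in>chain_group D p. f p (g p c) = c) \<and>
    (\<forall>p. \<forall>c\<in>chain_group C p. g p (f p c) + bdry C (Suc p) (h p c) + h (p - 1) (bdry C p c) = c) \<and>
    (\<forall>p. \<forall>c\<in>chain_group C p. f (Suc p) (h p c) = 0) \<and>
    (\<forall>p. \<forall>c\<in>chain_group D p. h p (g p c) = 0) \<and>
    (\<forall>p. \<forall>c\<in>chain_group C p. h (Suc p) (h p c) = 0)"

text \<open>Faces that are degenerate are zero in the normalized complex.\<close>

definition normalized_complex :: "'a sset \<Rightarrow> 'a based_complex" where
  "normalized_complex X =
    \<lparr>cells = nondeg X,
     bdry = (\<lambda>n. case n of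
         0 \<Rightarrow> (\<lambda>c. 0)
       | Suc m \<Rightarrow> frag_extend (\<lambda>x. \<Sum>i\<le>n.
           let y = act X m n (coface m i) x
           in if y \<in> nondeg X m then frag_cmul ((-1) ^ i) (frag_of y) else 0))\<rparr>"

text \<open>The generator \<open>\<sigma> \<otimes> \<tau>\<close> with \<open>\<sigma>\<close> of degree \<open>p\<close> and \<open>\<tau>\<close> of degree \<open>q\<close> is \<open>((p, \<sigma>), (q, \<tau>))\<close>.
  The function \<open>tensor_chain p q\<close> is the bilinear extension of this to chains.\<close>

definition tensor_chain ::
    "nat \<Rightarrow> nat \<Rightarrow> ('a \<Rightarrow>\<^sub>0 int) \<Rightarrow> ('b \<Rightarrow>\<^sub>0 int) \<Rightarrow> (((nat \<times> 'a) \<times> (nat \<times> 'b)) \<Rightarrow>\<^sub>0 int)" where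
  "tensor_chain p q a b =
    frag_extend (\<lambda>\<sigma>. frag_extend (\<lambda>\<tau>. frag_of ((p, \<sigma>), (q, \<tau>))) b) a"

definition tensor_complex ::
    "'a based_complex \<Rightarrow> 'b based_complex \<Rightarrow> ((nat \<times> 'a) \<times> (nat \<times> 'b)) based_complex" where
  "tensor_complex C D =
    \<lparr>cells = (\<lambda>n. {((p, \<sigma>), (q, \<tau>)) | p \<sigma> q \<tau>. p + q = n \<and> \<sigma> \<in> cells C p \<and> \<tau> \<in> cells D q}),
     bdry = (\<lambda>n. frag_extend (\<lambda>((p, \<sigma>), (q, \<tau>)).
        tensor_chain (p - 1) q (bdry C p (frag_of \<sigma>)) (frag_of \<tau>) +
        frag_cmul ((-1) ^ p) (tensor_chain p (q - 1) (frag_of \<sigma>) (bdry D q (frag_of \<tau>)))))\<rparr>"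

section \<open>Discrete vector fields\<close>

text \<open>\<open>face C p \<sigma> \<tau>\<close>: the \<open>p\<close>-cell \<open>\<sigma>\<close> is a face of the \<open>(p + 1)\<close>-cell \<open>\<tau>\<close>.\<close>

definition face :: "'b based_complex \<Rightarrow> nat \<Rightarrow> 'b \<Rightarrow> 'b \<Rightarrow> bool" where
  "face C p \<sigma> \<tau> \<longleftrightarrow> \<sigma> \<in> cells C p \<and> \<tau> \<in> cells C (Suc p) \<and>
    Poly_Mapping.lookup (bdry C (Suc p) (frag_of \<tau>)) \<sigma> \<noteq> 0"

definition regular_face :: "'b based_complex \<Rightarrow> nat \<Rightarrow> 'b \<Rightarrow> 'b \<Rightarrow> bool" where
  "regular_face C p \<sigma> \<tau> \<longleftrightarrow> \<sigma> \<in> cells C p \<and> \<tau> \<in> cells C (Suc p) \<and>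
    Poly_Mapping.lookup (bdry C (Suc p) (frag_of \<tau>)) \<sigma> \<in> {1, -1}"

text \<open>A vector field is a family \<open>V\<close> where \<open>V p\<close> holds the pairs whose source has degree \<open>p\<close>
  (and whose target has degree \<open>p + 1\<close>). The last three conditions say that a cell occurs at most
  once: not as the source of two pairs, not as the target of two pairs, and not both as a source and
  as a target.\<close>

definition discrete_vector_field :: "'b based_complex \<Rightarrow> (nat \<Rightarrow> ('b \<times> 'b) set) \<Rightarrow> bool" where
  "discrete_vector_field C V \<longleftrightarrow>
    (\<forall>p. \<forall>(\<sigma>, \<tau>)\<in>V p. regular_face C p \<sigma> \<tau>) \<and>
    (\<forall>p \<sigma> \<tau> \<tau>'. (\<sigma>, \<tau>) \<in> V p \<and> (\<sigma>, \<tau>') \<in> V p \<longrightarrow> \<tau> = \<tau>') \<and>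
    (\<forall>p \<sigma> \<sigma>' \<tau>. (\<sigma>, \<tau>) \<in> V p \<and> (\<sigma>', \<tau>) \<in> V p \<longrightarrow> \<sigma> = \<sigma>') \<and>
    (\<forall>p \<sigma> x \<tau>. \<not> ((\<sigma>, x) \<in> V p \<and> (x, \<tau>) \<in> V (Suc p)))"

definition vf_path :: "'b based_complex \<Rightarrow> (nat \<Rightarrow> ('b \<times> 'b) set) \<Rightarrow> nat \<Rightarrow> ('b \<times> 'b) list \<Rightarrow> bool" where
  "vf_path C V p ps \<longleftrightarrow> set ps \<subseteq> V p \<and>
    (\<forall>k. 0 < k \<and> k < length ps \<longrightarrow>
      face C p (fst (ps ! k)) (snd (ps ! (k - 1))) \<and> fst (ps ! k) \<noteq> fst (ps ! (k - 1)))"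

definition admissible_vector_field :: "'b based_complex \<Rightarrow> (nat \<Rightarrow> ('b \<times> 'b) set) \<Rightarrow> bool" where
  "admissible_vector_field C V \<longleftrightarrow> discrete_vector_field C V \<and>
    (\<forall>p. \<forall>\<sigma>\<in>cells C p. \<exists>N. \<forall>ps.
      vf_path C V p ps \<and> ps \<noteq> [] \<and> fst (hd ps) = \<sigma> \<longrightarrow> length ps \<le> N)"

definition source_cells :: "(nat \<Rightarrow> ('b \<times> 'b) set) \<Rightarrow> nat \<Rightarrow> 'b set" where
  "source_cells V p = fst ` V p"

definition target_cells :: "(nat \<Rightarrow> ('b \<times> 'b) set) \<Rightarrow> nat \<Rightarrow> 'b set" where
  "target_cells V p = (case p of 0 \<Rightarrow> {} | Suc q \<Rightarrow> snd ` V q)"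

definition critical_cells :: "'b based_complex \<Rightarrow> (nat \<Rightarrow> ('b \<times> 'b) set) \<Rightarrow> nat \<Rightarrow> 'b set" where
  "critical_cells C V p = cells C p - source_cells V p - target_cells V p"

section \<open>The W-reduction of a vector field\<close>

text \<open>Projection onto the summand spanned by \<open>S\<close>.\<close>

definition chain_proj :: "'b set \<Rightarrow> ('b \<Rightarrow>\<^sub>0 int) \<Rightarrow> ('b \<Rightarrow>\<^sub>0 int)" where
  "chain_proj S c = frag_extend (\<lambda>x. if x \<in> S then frag_of x else 0) c"

text \<open>\<open>dcomp C p A B\<close> is the component of the boundary in degree \<open>p\<close> from the summand spanned by
  \<open>A p\<close> to the one spanned by \<open>B (p - 1)\<close>. In \<open>dij\<close> below, the indices \<open>1\<close>, \<open>2\<close>, \<open>3\<close> stand for the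
  target, source and critical summands, \<open>j\<close> is the domain and \<open>i\<close> the codomain.\<close>

definition dcomp ::
    "'b based_complex \<Rightarrow> nat \<Rightarrow> (nat \<Rightarrow> 'b set) \<Rightarrow> (nat \<Rightarrow> 'b set) \<Rightarrow> ('b \<Rightarrow>\<^sub>0 int) \<Rightarrow> ('b \<Rightarrow>\<^sub>0 int)" where
  "dcomp C p A B c = chain_proj (B (p - 1)) (bdry C p (chain_proj (A p) c))"

definition d21 :: "'b based_complex \<Rightarrow> (nat \<Rightarrow> ('b \<times> 'b) set) \<Rightarrow> nat \<Rightarrow> ('b \<Rightarrow>\<^sub>0 int) \<Rightarrow> ('b \<Rightarrow>\<^sub>0 int)" where
  "d21 C V p = dcomp C p (target_cells V) (source_cells V)"

definition d23 :: "'b based_complex \<Rightarrow> (nat \<Rightarrow> ('b \<times> 'b) set) \<Rightarrow> nat \<Rightarrow> ('b \<Rightarrow>\<^sub>0 int) \<Rightarrow> ('b \<Rightarrow>\<^sub>0 int)" where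
  "d23 C V p = dcomp C p (critical_cells C V) (source_cells V)"

definition d31 :: "'b based_complex \<Rightarrow> (nat \<Rightarrow> ('b \<times> 'b) set) \<Rightarrow> nat \<Rightarrow> ('b \<Rightarrow>\<^sub>0 int) \<Rightarrow> ('b \<Rightarrow>\<^sub>0 int)" where
  "d31 C V p = dcomp C p (target_cells V) (critical_cells C V)"

definition d33 :: "'b based_complex \<Rightarrow> (nat \<Rightarrow> ('b \<times> 'b) set) \<Rightarrow> nat \<Rightarrow> ('b \<Rightarrow>\<^sub>0 int) \<Rightarrow> ('b \<Rightarrow>\<^sub>0 int)" where
  "d33 C V p = dcomp C p (critical_cells C V) (critical_cells C V)"

definition d21_invertible :: "'b based_complex \<Rightarrow> (nat \<Rightarrow> ('b \<times> 'b) set) \<Rightarrow> bool" where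
  "d21_invertible C V \<longleftrightarrow> (\<forall>p. bij_betw (d21 C V (Suc p))
    (free_span (target_cells V (Suc p))) (free_span (source_cells V p)))"

definition d21_inv :: "'b based_complex \<Rightarrow> (nat \<Rightarrow> ('b \<times> 'b) set) \<Rightarrow> nat \<Rightarrow> ('b \<Rightarrow>\<^sub>0 int) \<Rightarrow> ('b \<Rightarrow>\<^sub>0 int)" where
  "d21_inv C V p = inv_into (free_span (target_cells V p)) (d21 C V p)"

definition critical_complex :: "'b based_complex \<Rightarrow> (nat \<Rightarrow> ('b \<times> 'b) set) \<Rightarrow> 'b based_complex" where
  "critical_complex C V =
    \<lparr>cells = critical_cells C V,
     bdry = (\<lambda>p c. d33 C V p c - d31 C V p (d21_inv C V p (d23 C V p c)))\<rparr>"

text \<open>On the source summand of degree \<open>p\<close>, the inverse involved is that of the boundary component from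
  degree \<open>p + 1\<close> to degree \<open>p\<close>. The argument of \<open>wred_g\<close> is a chain of critical cells.\<close>

definition wred_f :: "'b based_complex \<Rightarrow> (nat \<Rightarrow> ('b \<times> 'b) set) \<Rightarrow> nat \<Rightarrow> ('b \<Rightarrow>\<^sub>0 int) \<Rightarrow> ('b \<Rightarrow>\<^sub>0 int)" where
  "wred_f C V p c = chain_proj (critical_cells C V p) c
    - d31 C V (Suc p) (d21_inv C V (Suc p) (chain_proj (source_cells V p) c))"

definition wred_g :: "'b based_complex \<Rightarrow> (nat \<Rightarrow> ('b \<times> 'b) set) \<Rightarrow> nat \<Rightarrow> ('b \<Rightarrow>\<^sub>0 int) \<Rightarrow> ('b \<Rightarrow>\<^sub>0 int)" where
  "wred_g C V p c = c - d21_inv C V p (d23 C V p c)"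

definition wred_h :: "'b based_complex \<Rightarrow> (nat \<Rightarrow> ('b \<times> 'b) set) \<Rightarrow> nat \<Rightarrow> ('b \<Rightarrow>\<^sub>0 int) \<Rightarrow> ('b \<Rightarrow>\<^sub>0 int)" where
  "wred_h C V p c = d21_inv C V (Suc p) (chain_proj (source_cells V p) c)"

section \<open>The Eilenberg-Zilber vector field\<close>

text \<open>A path is the list of its lattice points. An event is indexed by the position of its starting
  point (diagonal step) or of its bend point. No bend shares a step with a diagonal step, so the
  first event met when running backward is the one of greatest index.\<close>

definition diag_step :: "(nat \<times> nat) list \<Rightarrow> nat \<Rightarrow> bool" where
  "diag_step \<pi> k \<longleftrightarrow> Suc k < length \<pi> \<and>
    \<pi> ! Suc k = (Suc (fst (\<pi> ! k)), Suc (snd (\<pi> ! k)))"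

definition bend :: "(nat \<times> nat) list \<Rightarrow> nat \<Rightarrow> bool" where
  "bend \<pi> k \<longleftrightarrow> 0 < k \<and> Suc k < length \<pi> \<and>
    \<pi> ! k = (fst (\<pi> ! (k - 1)), Suc (snd (\<pi> ! (k - 1)))) \<and>
    \<pi> ! Suc k = (Suc (fst (\<pi> ! k)), snd (\<pi> ! k))"

definition first_event :: "(nat \<times> nat) list \<Rightarrow> nat \<Rightarrow> bool" where
  "first_event \<pi> k \<longleftrightarrow> (diag_step \<pi> k \<or> bend \<pi> k) \<and>
    (\<forall>j>k. \<not> diag_step \<pi> j \<and> \<not> bend \<pi> j)"

text \<open>\<open>has_path X Y n \<rho> p \<sigma> q \<tau> \<pi>\<close>: the non-degenerate \<open>n\<close>-simplex \<open>\<rho>\<close> of the product is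
  \<open>(\<alpha>\<^sup>*\<sigma>, \<beta>\<^sup>*\<tau>)\<close> with \<open>\<sigma>\<close>, \<open>\<tau>\<close> non-degenerate of dimensions \<open>p\<close>, \<open>q\<close>, and \<open>\<pi>\<close> is its path. All of
  \<open>p\<close>, \<open>\<sigma>\<close>, \<open>q\<close>, \<open>\<tau>\<close>, \<open>\<pi>\<close> are determined by \<open>\<rho>\<close>.\<close>

definition has_path ::
    "'a sset \<Rightarrow> 'b sset \<Rightarrow> nat \<Rightarrow> 'a \<times> 'b \<Rightarrow> nat \<Rightarrow> 'a \<Rightarrow> nat \<Rightarrow> 'b \<Rightarrow> (nat \<times> nat) list \<Rightarrow> bool" where
  "has_path X Y n \<rho> p \<sigma> q \<tau> \<pi> \<longleftrightarrow>
    \<rho> \<in> nondeg (sset_prod X Y) n \<and> \<sigma> \<in> nondeg X p \<and> \<tau> \<in> nondeg Y q \<and>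
    (\<exists>\<alpha>\<in>ord_surjs n p. \<exists>\<beta>\<in>ord_surjs n q.
      \<rho> = (act X n p \<alpha> \<sigma>, act Y n q \<beta> \<tau>) \<and> \<pi> = map (\<lambda>i. (\<alpha> i, \<beta> i)) [0..<Suc n])"

definition EZ_field :: "'a sset \<Rightarrow> 'b sset \<Rightarrow> nat \<Rightarrow> (('a \<times> 'b) \<times> ('a \<times> 'b)) set" where
  "EZ_field X Y n = {(\<rho>\<^sub>1, \<rho>\<^sub>2). \<exists>p \<sigma> q \<tau> \<pi>\<^sub>1 \<pi>\<^sub>2 k.
    has_path X Y (Suc n) \<rho>\<^sub>2 p \<sigma> q \<tau> \<pi>\<^sub>2 \<and> first_event \<pi>\<^sub>2 k \<and> bend \<pi>\<^sub>2 k \<and>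
    has_path X Y n \<rho>\<^sub>1 p \<sigma> q \<tau> \<pi>\<^sub>1 \<and> (\<exists>j. first_event \<pi>\<^sub>1 j \<and> diag_step \<pi>\<^sub>1 j) \<and>
    \<pi>\<^sub>1 = take k \<pi>\<^sub>2 @ drop (Suc k) \<pi>\<^sub>2}"

text \<open>The product simplex identified with \<open>\<sigma> \<otimes> \<tau>\<close>. Its path is
  \<open>(0,0), \<dots>, (p,0), (p,1), \<dots>, (p,q)\<close> (the truncation in \<open>i - p\<close> is intended).\<close>

fun EZ_critical :: "'a sset \<Rightarrow> 'b sset \<Rightarrow> (nat \<times> 'a) \<times> (nat \<times> 'b) \<Rightarrow> 'a \<times> 'b" where
  "EZ_critical X Y ((p, \<sigma>), (q, \<tau>)) =
    (act X (p + q) p (\<lambda>i\<in>{0..p + q}. min i p) \<sigma>, act Y (p + q) q (\<lambda>i\<in>{0..p + q}. i - p) \<tau>)"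

definition EZ_identify ::
    "'a sset \<Rightarrow> 'b sset \<Rightarrow> (((nat \<times> 'a) \<times> (nat \<times> 'b)) \<Rightarrow>\<^sub>0 int) \<Rightarrow> (('a \<times> 'b) \<Rightarrow>\<^sub>0 int)" where
  "EZ_identify X Y = frag_extend (\<lambda>x. frag_of (EZ_critical X Y x))"

definition EZ_unidentify ::
    "'a sset \<Rightarrow> 'b sset \<Rightarrow> nat \<Rightarrow> (('a \<times> 'b) \<Rightarrow>\<^sub>0 int) \<Rightarrow> (((nat \<times> 'a) \<times> (nat \<times> 'b)) \<Rightarrow>\<^sub>0 int)" where
  "EZ_unidentify X Y n = frag_extend (\<lambda>\<rho>. frag_of (inv_into
    (cells (tensor_complex (normalized_complex X) (normalized_complex Y)) n) (EZ_critical X Y) \<rho>))"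

end

theory Submission
  imports Defs
begin

text \<open>
  A natural-valued measure on the sources that decreases along vector field paths gives both
  admissibility and, by triangularity, the invertibility of the component from targets to sources;
  the W-reduction is then linear algebra. For the Eilenberg-Zilber field the measure is
  lexicographic: a face of a target simplex lies over a pair of smaller total dimension, or it
  deletes a lattice point of the same path, which changes the sum of the weights \<open>x + (q - y)\<close> of
  the points.

  The critical differential is not computed from paths of the field. The Alexander-Whitney map is a
  chain map to the tensor product which kills every simplex whose path has a bend, hence every
  target, and sends the critical simplex of \<open>\<sigma>\<close> and \<open>\<tau>\<close> to \<open>\<sigma> \<otimes> \<tau>\<close>. Since the inclusion
  \<open>g\<close> of the W-reduction changes a critical chain only by targets, the Alexander-Whitney map is a left
  inverse of \<open>g\<close>, and this forces the critical differential to be that of the tensor product.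
\<close>

section \<open>The W-reduction of an invertible vector field\<close>

text \<open>Two faces of one target over the same pair of simplices arise by deleting one point each
  from the same path, so comparing their weights means comparing the two deleted points. The weight
  is smaller at the bend than at any other point whose deletion leaves a path of source type; other
  deletions cannot continue a vector field path. Over different pairs the weights are unrelated,
  hence the lexicographic order. Packed into one natural number it bounds path lengths and serves as
  the induction order for inverting the target-to-source component, although the bases may be
  infinite.

  Normalization is the main nuisance: faces of non-degenerate simplices may be degenerate. The
  formulas for the boundary and for the Alexander-Whitney map are therefore shown to hold verbatim
  on degenerate simplices, read as zero, so that double sums can be handled as in the unnormalized
  complex. That the differential of the tensor product squares to zero is not computed; it is
  inherited from the critical complex.\<close>

lemma free_spanI: "(\<And>x. x \<in> Poly_Mapping.keys c \<Longrightarrow> x \<in> S) \<Longrightarrow> c \<in> free_span S"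
  by (auto simp: free_span_def)

lemma free_span_0 [simp]: "0 \<in> free_span S"
  by (simp add: free_span_def)

lemma frag_of_in_free_span [simp]: "frag_of x \<in> free_span S \<longleftrightarrow> x \<in> S"
  by (simp add: free_span_def)

lemma free_span_add: "a \<in> free_span S \<Longrightarrow> b \<in> free_span S \<Longrightarrow> a + b \<in> free_span S"
  using keys_add[of a b] by (auto simp: free_span_def)

lemma free_span_diff: "a \<in> free_span S \<Longrightarrow> b \<in> free_span S \<Longrightarrow> a - b \<in> free_span S"
  using keys_diff[of a b] by (auto simp: free_span_def)

lemma free_span_cmul: "a \<in> free_span S \<Longrightarrow> frag_cmul k a \<in> free_span S"
  by (auto simp: free_span_def)

lemma free_span_sum: "(\<And>i. i \<in> I \<Longrightarrow> f i \<in> free_span S) \<Longrightarrow> sum f I \<in> free_span S"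
  by (induction I rule: infinite_finite_induct) (auto intro: free_span_add)

lemma free_span_mono: "S \<subseteq> S' \<Longrightarrow> free_span S \<subseteq> free_span S'"
  by (auto simp: free_span_def)

lemma free_span_extend:
  assumes "c \<in> free_span S" "\<And>x. x \<in> S \<Longrightarrow> f x \<in> free_span S'"
  shows "frag_extend f c \<in> free_span S'"
  unfolding frag_extend_def using assms
  by (intro free_span_sum free_span_cmul) (auto simp: free_span_def)

lemma free_span_empty [simp]: "free_span {} = {0}"
  by (auto simp: free_span_def)

text \<open>Membership of both operands is carried along because \<open>additive_map\<close> grants
  additivity only inside the span.\<close>

lemma free_span_induct [consumes 1, case_names zero one diff]:
  assumes "c \<in> free_span S" "P 0" "\<And>x. x \<in> S \<Longrightarrow> P (frag_of x)"
    "\<And>a b. a \<in> free_span S \<Longrightarrow> b \<in> free_span S \<Longrightarrow> P a \<Longrightarrow> P b \<Longrightarrow> P (a - b)"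
  shows "P c"
proof -
  have "c \<in> free_span S \<and> P c"
  proof (rule frag_induction[of c S])
    show "Poly_Mapping.keys c \<subseteq> S" using assms(1) by (simp add: free_span_def)
  qed (use assms(2-) in \<open>auto intro: free_span_diff\<close>)
  then show ?thesis by simp
qed

lemma additive_mapI:
  "(\<And>a. a \<in> M \<Longrightarrow> \<phi> a \<in> N) \<Longrightarrow> (\<And>a b. a \<in> M \<Longrightarrow> b \<in> M \<Longrightarrow> \<phi> (a + b) = \<phi> a + \<phi> b)
    \<Longrightarrow> additive_map M N \<phi>"
  by (auto simp: additive_map_def)

lemma additive_map_in: "additive_map M N \<phi> \<Longrightarrow> a \<in> M \<Longrightarrow> \<phi> a \<in> N"
  by (auto simp: additive_map_def)

lemma additive_map_add:
  "additive_map M N \<phi> \<Longrightarrow> a \<in> M \<Longrightarrow> b \<in> M \<Longrightarrow> \<phi> (a + b) = \<phi> a + \<phi> b"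
  by (auto simp: additive_map_def)

lemma additive_map_diff:
  assumes "additive_map (free_span S) N \<phi>" "a \<in> free_span S" "b \<in> free_span S"
  shows "\<phi> (a - b) = \<phi> a - \<phi> b"
  using additive_map_add[OF assms(1), of "a - b" b] assms free_span_diff by fastforce

lemma additive_map_0:
  assumes "additive_map (free_span S) N \<phi>"
  shows "\<phi> 0 = 0"
  using additive_map_add[OF assms, of 0 0] by simp

lemma additive_map_compose:
  "additive_map M N \<phi> \<Longrightarrow> additive_map N P \<psi> \<Longrightarrow> additive_map M P (\<lambda>c. \<psi> (\<phi> c))"
  by (auto simp: additive_map_def Pi_iff)

lemma additive_map_extend:
  "(\<And>x. x \<in> S \<Longrightarrow> f x \<in> free_span S') \<Longrightarrow> additive_map (free_span S) (free_span S') (frag_extend f)"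
  by (auto intro!: additive_mapI free_span_extend simp: frag_extend_add)

lemma lookup_chain_proj:
  "Poly_Mapping.lookup (chain_proj S c) x = (if x \<in> S then Poly_Mapping.lookup c x else 0)"
proof -
  have "c \<in> free_span UNIV" by (simp add: free_span_def)
  then show ?thesis
    by (induction rule: free_span_induct)
      (auto simp: chain_proj_def frag_extend_diff lookup_minus)
qed

lemma chain_proj_in [simp]: "chain_proj S c \<in> free_span S"
  by (auto simp: free_span_def in_keys_iff lookup_chain_proj split: if_splits)

lemma chain_proj_id: "c \<in> free_span S \<Longrightarrow> chain_proj S c = c"
  by (intro poly_mapping_eqI) (auto simp: lookup_chain_proj free_span_def in_keys_iff)

lemma chain_proj_disjoint: "c \<in> free_span S' \<Longrightarrow> S \<inter> S' = {} \<Longrightarrow> chain_proj S c = 0"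
  by (intro poly_mapping_eqI) (auto simp: lookup_chain_proj free_span_def in_keys_iff)

lemma chain_proj_add: "chain_proj S (a + b) = chain_proj S a + chain_proj S b"
  by (simp add: chain_proj_def frag_extend_add)

lemma chain_proj_diff: "chain_proj S (a - b) = chain_proj S a - chain_proj S b"
  by (simp add: chain_proj_def frag_extend_diff)

lemma chain_proj_0 [simp]: "chain_proj S 0 = 0"
  by (simp add: chain_proj_def)

lemma chain_complex_additive:
  "chain_complex C \<Longrightarrow> additive_map (chain_group C p) (chain_group C (p - 1)) (bdry C p)"
  by (auto simp: chain_complex_def)

text \<open>The algebra of the W-reduction starts from invertibility; the measure argument that
  supplies it belongs to \<open>measured_field\<close>.\<close>

locale invertible_field =
  fixes C :: "'b based_complex" and V :: "nat \<Rightarrow> ('b \<times> 'b) set"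
  assumes complex: "chain_complex C"
    and field: "discrete_vector_field C V"
    and invertible: "d21_invertible C V"
begin

abbreviation "src \<equiv> source_cells V"
abbreviation "tgt \<equiv> target_cells V"
abbreviation "crit \<equiv> critical_cells C V"
abbreviation "d \<equiv> bdry C"
abbreviation "h \<equiv> wred_h C V"
abbreviation "K \<equiv> critical_complex C V"

lemma src_cells: "src p \<subseteq> cells C p"
  using field by (fastforce simp: source_cells_def discrete_vector_field_def regular_face_def)

lemma tgt_cells: "tgt p \<subseteq> cells C p"
  using field
  by (fastforce simp: target_cells_def discrete_vector_field_def regular_face_def split: nat.splits)

lemma crit_cells: "crit p \<subseteq> cells C p"
  by (auto simp: critical_cells_def)

lemma src_tgt_disjoint: "src p \<inter> tgt p = {}"
proof (cases p)
  case (Suc q)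
  have "\<not> ((\<sigma>, x) \<in> V q \<and> (x, \<tau>) \<in> V (Suc q))" for \<sigma> x \<tau>
    using field by (auto simp: discrete_vector_field_def)
  then show ?thesis using Suc by (force simp: source_cells_def target_cells_def)
qed (simp add: target_cells_def)

lemma span_subs:
  "c \<in> free_span (src p) \<Longrightarrow> c \<in> chain_group C p"
  "c \<in> free_span (tgt p) \<Longrightarrow> c \<in> chain_group C p"
  "c \<in> free_span (crit p) \<Longrightarrow> c \<in> chain_group C p"
  using src_cells[of p] tgt_cells[of p] crit_cells[of p] by (auto simp: free_span_def)

lemma proj_split:
  assumes "c \<in> chain_group C p"
  shows "c = chain_proj (tgt p) c + chain_proj (src p) c + chain_proj (crit p) c"
  using assms src_tgt_disjoint[of p]
  by (intro poly_mapping_eqI)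
    (auto simp: lookup_chain_proj lookup_add critical_cells_def free_span_def in_keys_iff)

lemma d_additive: "additive_map (chain_group C p) (chain_group C (p - 1)) (d p)"
  using complex by (rule chain_complex_additive)

lemma d_in: "c \<in> chain_group C p \<Longrightarrow> d p c \<in> chain_group C (p - 1)"
  using additive_map_in[OF d_additive] .

lemma d_Suc_in: "c \<in> chain_group C (Suc p) \<Longrightarrow> d (Suc p) c \<in> chain_group C p"
  using d_in[of c "Suc p"] by simp

lemmas d_add = additive_map_add[OF d_additive]
lemmas d_diff = additive_map_diff[OF d_additive]
lemmas d_0 = additive_map_0[OF d_additive]

lemma d_d: "c \<in> chain_group C (Suc p) \<Longrightarrow> d p (d (Suc p) c) = 0"
  using complex by (auto simp: chain_complex_def)

lemma d_deg0: "c \<in> chain_group C 0 \<Longrightarrow> d 0 c = 0"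
  using complex by (auto simp: chain_complex_def)

lemma d21_eq:
  "c \<in> free_span (tgt (Suc p)) \<Longrightarrow> d21 C V (Suc p) c = chain_proj (src p) (d (Suc p) c)"
  by (simp add: d21_def dcomp_def chain_proj_id)

lemma d21_bij: "bij_betw (d21 C V (Suc p)) (free_span (tgt (Suc p))) (free_span (src p))"
  using invertible by (simp add: d21_invertible_def)

lemma d21_add:
  "a \<in> free_span (tgt (Suc p)) \<Longrightarrow> b \<in> free_span (tgt (Suc p))
    \<Longrightarrow> d21 C V (Suc p) (a + b) = d21 C V (Suc p) a + d21 C V (Suc p) b"
  by (simp add: d21_eq free_span_add chain_proj_add d_add span_subs)

lemma d21_inv_in:
  "s \<in> free_span (src p) \<Longrightarrow> d21_inv C V (Suc p) s \<in> free_span (tgt (Suc p))"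
  unfolding d21_inv_def using d21_bij[of p] by (metis bij_betw_imp_surj_on inv_into_into)

lemma d21_d21_inv:
  "s \<in> free_span (src p) \<Longrightarrow> d21 C V (Suc p) (d21_inv C V (Suc p) s) = s"
  unfolding d21_inv_def using d21_bij[of p] by (meson bij_betw_inv_into_right)

lemma d21_inv_d21:
  "t \<in> free_span (tgt (Suc p)) \<Longrightarrow> d21_inv C V (Suc p) (d21 C V (Suc p) t) = t"
  unfolding d21_inv_def using d21_bij[of p] by (meson bij_betw_inv_into_left)

lemma h_tgt: "h p c \<in> free_span (tgt (Suc p))"
  by (simp add: wred_h_def d21_inv_in)

lemma h_in: "h p c \<in> chain_group C (Suc p)"
  using h_tgt span_subs by blast

text \<open>\<open>d21_inv\<close> is a set-theoretic inverse, so its additivity is extracted from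
  that of \<open>d21\<close>: the sum of the two values is rewritten as the inverse of its own
  image. The projection inside \<open>h\<close> makes this work for arbitrary chains.\<close>

lemma h_add: "h p (a + b) = h p a + h p b"
proof -
  let ?s = "chain_proj (src p)"
  have "h p a + h p b = d21_inv C V (Suc p) (d21 C V (Suc p) (h p a + h p b))"
    by (simp add: d21_inv_d21 free_span_add h_tgt)
  also have "\<dots> = d21_inv C V (Suc p) (?s a + ?s b)"
    by (simp add: d21_add h_tgt) (simp add: wred_h_def d21_d21_inv)
  finally show ?thesis by (simp add: wred_h_def chain_proj_add)
qed

lemma h_additive: "additive_map (chain_group C p) (chain_group C (Suc p)) (h p)"
  by (auto intro!: additive_mapI h_in h_add)

lemma h_0 [simp]: "h p 0 = 0"
  using h_add[of p 0 0] by simp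

lemma h_diff: "h p (a - b) = h p a - h p b"
  using h_add[of p "a - b" b] by simp

lemma h_proj_eq_0: "chain_proj (src p) c = 0 \<Longrightarrow> h p c = 0"
  using h_0[of p] by (simp add: wred_h_def)

lemma h_on_tgt: "c \<in> free_span (tgt p) \<Longrightarrow> h p c = 0"
  using src_tgt_disjoint by (intro h_proj_eq_0 chain_proj_disjoint) auto

lemma h_on_crit: "c \<in> free_span (crit p) \<Longrightarrow> h p c = 0"
  by (intro h_proj_eq_0 chain_proj_disjoint) (auto simp: critical_cells_def)

lemma h_h: "h (Suc p) (h p c) = 0"
  by (simp add: h_on_tgt h_tgt)

text \<open>The reduction identities rest on this equation and on \<open>h_d_tgt\<close>: together
  they express that \<open>h\<close> inverts the target-to-source component, without splitting
  chains into blocks.\<close>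

lemma proj_d_h: "chain_proj (src p) (d (Suc p) (h p c)) = chain_proj (src p) c"
  using h_tgt[of p c] by (simp add: d21_eq[symmetric]) (simp add: wred_h_def d21_d21_inv)

lemma h_d_tgt:
  assumes "t \<in> free_span (tgt p)"
  shows "h (p - 1) (d p t) = t"
proof (cases p)
  case 0
  with assms show ?thesis by (simp add: target_cells_def d_0)
next
  case (Suc q)
  then show ?thesis using d21_inv_d21[of t q] assms by (simp add: wred_h_def d21_eq)
qed

lemma d23_inv_eq:
  assumes "k \<in> free_span (crit p)"
  shows "d21_inv C V p (d23 C V p k) = h (p - 1) (d p k)"
proof (cases p)
  case 0
  have "d p k = 0" using assms 0 by (auto intro: d_deg0 span_subs)
  \<comment> \<open>There are no targets in degree 0, so \<open>d21_inv\<close> is an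
    \<open>inv_into\<close> on the zero group, evaluated at a value that is attained.\<close>
  moreover have "inv_into {0} (d21 C V 0) 0 = 0"
    using d_0[of 0] by (intro inv_into_f_eq) (auto simp: d21_def dcomp_def)
  ultimately show ?thesis
    using 0 assms by (simp add: d23_def dcomp_def chain_proj_id d21_inv_def target_cells_def)
qed (use assms in \<open>simp add: wred_h_def d23_def dcomp_def chain_proj_id\<close>)

lemma wred_g_eq:
  "k \<in> free_span (crit p) \<Longrightarrow> wred_g C V p k = k - h (p - 1) (d p k)"
  by (simp add: wred_g_def d23_inv_eq)

lemma h_pred_tgt: "h (p - 1) (d p k) \<in> free_span (tgt p)" if "k \<in> chain_group C p"
  using that h_tgt[of "p - 1" "d p k"] by (cases p) (auto simp: d_deg0)

lemma wred_f_eq: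
  "c \<in> chain_group C p \<Longrightarrow> wred_f C V p c = chain_proj (crit p) (c - d (Suc p) (h p c))"
  using h_tgt[of p c]
  by (simp add: wred_f_def d31_def dcomp_def wred_h_def[symmetric] chain_proj_id chain_proj_diff)

text \<open>Since \<open>g k\<close> is \<open>k - h d k\<close> with \<open>h d k\<close> a target
  chain, the two terms \<open>d33\<close> and \<open>d31 d21_inv d23\<close> are the critical parts
  of the boundaries of the two terms of \<open>g k\<close>.\<close>

lemma bdry_K_eq:
  assumes "k \<in> free_span (crit p)"
  shows "bdry K p k = chain_proj (crit (p - 1)) (d p (wred_g C V p k))"
proof -
  have "h (p - 1) (d p k) \<in> free_span (tgt p)" using h_pred_tgt assms span_subs by blast
  then show ?thesis
    using assms
    by (simp add: wred_g_eq critical_complex_def d33_def d31_def dcomp_def d23_inv_eq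
        chain_proj_id chain_proj_diff[symmetric] d_diff span_subs)
qed

lemma cells_K [simp]: "cells K = crit"
  by (simp add: critical_complex_def)

lemma g_in: "k \<in> free_span (crit p) \<Longrightarrow> wred_g C V p k \<in> chain_group C p"
  by (simp add: wred_g_eq free_span_diff span_subs h_pred_tgt del: One_nat_def)

lemma g_add:
  "a \<in> free_span (crit p) \<Longrightarrow> b \<in> free_span (crit p)
    \<Longrightarrow> wred_g C V p (a + b) = wred_g C V p a + wred_g C V p b"
  by (simp add: wred_g_eq free_span_add d_add span_subs h_add)

lemma f_add:
  "a \<in> chain_group C p \<Longrightarrow> b \<in> chain_group C p
    \<Longrightarrow> wred_f C V p (a + b) = wred_f C V p a + wred_f C V p b"
  by (simp add: wred_f_eq free_span_add d_add h_in h_add chain_proj_add chain_proj_diff)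

text \<open>On critical chains \<open>g\<close> is \<open>1 - hd\<close>, which kills target chains.\<close>

lemma g_proj_crit:
  assumes "v \<in> chain_group C p" "chain_proj (src p) v = 0"
  shows "wred_g C V p (chain_proj (crit p) v) = v - h (p - 1) (d p v)"
proof -
  let ?t = "chain_proj (tgt p) v" and ?k = "chain_proj (crit p) v"
  have v: "v = ?t + ?k" using proj_split[OF assms(1)] assms(2) by simp
  have "d p v = d p ?t + d p ?k"
    by (subst v, rule d_add) (auto intro: span_subs)
  then have "h (p - 1) (d p v) = ?t + h (p - 1) (d p ?k)"
    by (simp add: h_add h_d_tgt del: One_nat_def)
  moreover have "v - ?t = ?k" using v by (metis add_diff_cancel_left')
  ultimately show ?thesis by (simp add: wred_g_eq diff_diff_eq[symmetric])
qed

text \<open>The chain \<open>u = c - d h c\<close> has no source part by \<open>proj_d_h\<close>, so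
  \<open>g f c = u - h d u\<close> by \<open>g_proj_crit\<close>; and \<open>d u = d c\<close>
  because \<open>d d = 0\<close>.\<close>

lemma g_f:
  assumes "c \<in> chain_group C p"
  shows "wred_g C V p (wred_f C V p c) + d (Suc p) (h p c) + h (p - 1) (d p c) = c"
proof -
  let ?u = "c - d (Suc p) (h p c)"
  have u: "?u \<in> chain_group C p" by (intro free_span_diff assms d_Suc_in h_in)
  have "wred_g C V p (wred_f C V p c) = ?u - h (p - 1) (d p ?u)"
    unfolding wred_f_eq[OF assms] by (rule g_proj_crit[OF u]) (simp add: chain_proj_diff proj_d_h)
  also have "d p ?u = d p c"
    using assms by (simp add: d_diff d_Suc_in h_in d_d)
  finally show ?thesis by simp
qed

text \<open>The source part of \<open>d g k\<close> cancels by \<open>proj_d_h\<close>. Hence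
  \<open>g_proj_crit\<close> recovers \<open>d g k\<close> from its critical part, and the
  correction \<open>h d d g k\<close> vanishes.\<close>

lemma bdry_g:
  assumes "k \<in> free_span (crit (Suc p))"
  shows "d (Suc p) (wred_g C V (Suc p) k) = wred_g C V p (bdry K (Suc p) k)"
proof -
  let ?v = "d (Suc p) (wred_g C V (Suc p) k)"
  have g: "wred_g C V (Suc p) k \<in> chain_group C (Suc p)" using g_in assms .
  have "chain_proj (src p) ?v = 0"
    using assms by (simp add: wred_g_eq d_diff span_subs h_in chain_proj_diff proj_d_h)
  then have "wred_g C V p (chain_proj (crit p) ?v) = ?v - h (p - 1) (d p ?v)"
    by (intro g_proj_crit d_Suc_in g)
  then show ?thesis using assms by (simp add: bdry_K_eq d_d g)
qed

lemma f_g: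
  assumes "k \<in> free_span (crit p)"
  shows "wred_f C V p (wred_g C V p k) = k"
proof -
  have ht: "h (p - 1) (d p k) \<in> free_span (tgt p)" using h_pred_tgt assms span_subs by blast
  have "h p (wred_g C V p k) = 0"
    using assms ht by (simp add: wred_g_eq h_diff h_on_crit h_on_tgt)
  moreover have "chain_proj (crit p) (h (p - 1) (d p k)) = 0"
    by (rule chain_proj_disjoint[OF ht]) (auto simp: critical_cells_def)
  ultimately show ?thesis
    using assms g_in[OF assms]
    by (simp add: wred_f_eq d_0) (simp add: wred_g_eq chain_proj_diff chain_proj_id)
qed

text \<open>The homotopy formula \<open>g_f\<close> gives \<open>g f c = c - d h c - h d c\<close>.
  Its boundary is \<open>d c - d h d c\<close>, whose critical part is \<open>f d c\<close>.\<close>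

lemma bdry_f:
  assumes "c \<in> chain_group C (Suc p)"
  shows "bdry K (Suc p) (wred_f C V (Suc p) c) = wred_f C V p (d (Suc p) c)"
proof -
  let ?h = "h p (d (Suc p) c)" and ?h' = "d (Suc (Suc p)) (h (Suc p) c)"
  have in1: "?h' \<in> chain_group C (Suc p)" by (intro d_Suc_in h_in)
  have "wred_g C V (Suc p) (wred_f C V (Suc p) c) = c - ?h' - ?h"
    using g_f[OF assms] by (simp add: algebra_simps)
  moreover have "d (Suc p) (c - ?h' - ?h) = d (Suc p) c - d (Suc p) ?h"
    using assms in1 by (simp add: d_diff free_span_diff h_in d_d)
  moreover have "wred_f C V (Suc p) c \<in> free_span (crit (Suc p))"
    using assms by (simp add: wred_f_eq)
  ultimately show ?thesis
    using assms by (simp add: bdry_K_eq wred_f_eq d_Suc_in)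
qed

lemma f_in: "c \<in> chain_group C p \<Longrightarrow> wred_f C V p c \<in> free_span (crit p)"
  by (simp add: wred_f_eq)

lemma chain_complex_K: "chain_complex K"
proof -
  have "additive_map (chain_group K p) (chain_group K (p - 1)) (bdry K p)" for p
    by (rule additive_mapI) (simp_all add: bdry_K_eq free_span_add g_add d_add g_in chain_proj_add)
  moreover have "bdry K 0 k = 0" if "k \<in> chain_group K 0" for k
    using that g_in[of k 0] by (simp add: bdry_K_eq d_deg0)
  moreover have "bdry K p (bdry K (Suc p) k) = 0" if "k \<in> chain_group K (Suc p)" for p k
  proof -
    have k: "k \<in> free_span (crit (Suc p))" using that by simp
    then have "bdry K (Suc p) k \<in> free_span (crit p)" by (simp add: bdry_K_eq)
    then show ?thesis by (simp add: bdry_K_eq[of _ p] bdry_g[OF k, symmetric] d_d g_in[OF k])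
  qed
  ultimately show ?thesis by (simp add: chain_complex_def)
qed

theorem W_reduction: "reduction C K (wred_f C V) (wred_g C V) h"
proof -
  have "chain_map C K (wred_f C V)"
    unfolding chain_map_def by (auto intro!: additive_mapI f_in f_add bdry_f)
  moreover have "chain_map K C (wred_g C V)"
    unfolding chain_map_def by (auto intro!: additive_mapI g_in g_add bdry_g)
  moreover have "wred_f C V (Suc p) (h p c) = 0" for p c
    using h_tgt[of p c] h_in[of p c]
    by (subst wred_f_eq, simp)
      (auto simp: h_h d_0 critical_cells_def intro!: chain_proj_disjoint)
  moreover have "h p (wred_g C V p k) = 0" if "k \<in> free_span (crit p)" for p k
    using that h_pred_tgt[of k p] by (simp add: wred_g_eq h_diff h_on_crit h_on_tgt span_subs)
  ultimately show ?thesis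
    by (simp add: reduction_def complex chain_complex_K h_additive f_g g_f h_h del: One_nat_def)
qed

end

section \<open>Vector fields with a decreasing measure\<close>

lemma additive_map_expand:
  assumes "additive_map (free_span S) N \<phi>" "c \<in> free_span S"
  shows "\<phi> c = frag_extend (\<lambda>x. \<phi> (frag_of x)) c"
  using assms(2)
  by (induction rule: free_span_induct)
    (auto simp: additive_map_0[OF assms(1)] additive_map_diff[OF assms(1)] frag_extend_diff)

lemma lookup_frag_extend:
  "Poly_Mapping.lookup (frag_extend f c) y
    = (\<Sum>x\<in>Poly_Mapping.keys c. Poly_Mapping.lookup c x * Poly_Mapping.lookup (f x) y)"
  by (simp add: frag_extend_def lookup_sum)

text \<open>Only faces that are themselves sources are compared: these alone continue a vector field
  path, and these alone survive the projection in \<open>d21\<close>.\<close>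

locale measured_field =
  fixes C :: "'b based_complex" and V :: "nat \<Rightarrow> ('b \<times> 'b) set" and m :: "nat \<Rightarrow> 'b \<Rightarrow> nat"
  assumes complex: "chain_complex C"
    and field: "discrete_vector_field C V"
    and decrease: "\<lbrakk>(\<sigma>, \<tau>) \<in> V p; (\<sigma>', \<tau>') \<in> V p; face C p \<sigma>' \<tau>; \<sigma>' \<noteq> \<sigma>\<rbrakk> \<Longrightarrow> m p \<sigma>' < m p \<sigma>"
begin

lemma vf_path_bound:
  assumes "vf_path C V p ps" "k < length ps"
  shows "m p (fst (ps ! k)) + k \<le> m p (fst (ps ! 0))"
  using assms(2)
proof (induction k)
  case (Suc k)
  have "ps ! k \<in> V p" "ps ! Suc k \<in> V p"
    using assms(1) Suc.prems by (auto simp: vf_path_def)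
  moreover have "face C p (fst (ps ! Suc k)) (snd (ps ! k))" "fst (ps ! Suc k) \<noteq> fst (ps ! k)"
    using assms(1) Suc.prems unfolding vf_path_def
    by (metis diff_Suc_1 zero_less_Suc)+
  ultimately have "m p (fst (ps ! Suc k)) < m p (fst (ps ! k))"
    using decrease[of "fst (ps ! k)" "snd (ps ! k)" p "fst (ps ! Suc k)" "snd (ps ! Suc k)"] by simp
  with Suc show ?case by simp
qed simp

lemma admissible: "admissible_vector_field C V"
proof -
  have "length ps \<le> Suc (m p \<sigma>)"
    if "vf_path C V p ps" "ps \<noteq> []" "fst (hd ps) = \<sigma>" for p \<sigma> ps
    using vf_path_bound[OF that(1), of "length ps - 1"] that(2,3) by (simp add: hd_conv_nth)
  then show ?thesis using field unfolding admissible_vector_field_def by blast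
qed

lemma tgt_Suc: "target_cells V (Suc p) = snd ` V p"
  by (simp add: target_cells_def)

lemma V_cells:
  assumes "(\<sigma>, \<tau>) \<in> V p"
  shows "\<sigma> \<in> cells C p" "\<tau> \<in> cells C (Suc p)"
    "Poly_Mapping.lookup (bdry C (Suc p) (frag_of \<tau>)) \<sigma> \<in> {1, -1}"
  using field assms by (fastforce simp: discrete_vector_field_def regular_face_def)+

lemma V_unique: "(\<sigma>, \<tau>) \<in> V p \<Longrightarrow> (\<sigma>, \<tau>') \<in> V p \<Longrightarrow> \<tau> = \<tau>'"
  using field by (auto simp: discrete_vector_field_def)

lemma tgt_span:
  "c \<in> free_span (snd ` V p) \<Longrightarrow> c \<in> chain_group C (Suc p)"
  using V_cells(2) by (fastforce simp: free_span_def)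

lemma d21_eq:
  "c \<in> free_span (snd ` V p) \<Longrightarrow> d21 C V (Suc p) c = chain_proj (fst ` V p) (bdry C (Suc p) c)"
  by (simp add: d21_def dcomp_def chain_proj_id tgt_Suc source_cells_def)

lemma d21_diff:
  "a \<in> free_span (snd ` V p) \<Longrightarrow> b \<in> free_span (snd ` V p)
    \<Longrightarrow> d21 C V (Suc p) (a - b) = d21 C V (Suc p) a - d21 C V (Suc p) b"
  using chain_complex_additive[OF complex, of "Suc p"]
  by (simp add: d21_eq free_span_diff additive_map_diff tgt_span chain_proj_diff)

text \<open>Among the finitely many targets in the support of \<open>c\<close>, choose
  \<open>t\<close> with source of maximal measure. By \<open>decrease\<close> that source is a face
  of no other target in the support, so its coefficient in the boundary is plus or minus the
  coefficient of \<open>t\<close>.\<close>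

lemma d21_kernel:
  assumes c: "c \<in> free_span (snd ` V p)" and 0: "d21 C V (Suc p) c = 0"
  shows "c = 0"
proof (rule ccontr)
  let ?k = "Poly_Mapping.keys c" and ?d = "\<lambda>\<tau>. Poly_Mapping.lookup (bdry C (Suc p) (frag_of \<tau>))"
  assume "c \<noteq> 0"
  then have ne: "?k \<noteq> {}" by simp
  have "\<forall>\<tau>\<in>?k. \<exists>\<sigma>. (\<sigma>, \<tau>) \<in> V p" using c by (force simp: free_span_def)
  then obtain s where s: "\<And>\<tau>. \<tau> \<in> ?k \<Longrightarrow> (s \<tau>, \<tau>) \<in> V p" by metis
  have fin: "finite ((\<lambda>\<tau>. m p (s \<tau>)) ` ?k)" by simp
  then have "Max ((\<lambda>\<tau>. m p (s \<tau>)) ` ?k) \<in> (\<lambda>\<tau>. m p (s \<tau>)) ` ?k" using ne by (intro Max_in) auto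
  then obtain t where t: "t \<in> ?k" "m p (s t) = Max ((\<lambda>\<tau>. m p (s \<tau>)) ` ?k)"
    by (metis (mono_tags, lifting) imageE)
  have max: "m p (s \<tau>) \<le> m p (s t)" if "\<tau> \<in> ?k" for \<tau>
    using Max_ge[OF fin] that t(2) by simp
  have zero: "?d \<tau> (s t) = 0" if \<tau>: "\<tau> \<in> ?k" "\<tau> \<noteq> t" for \<tau>
  proof (rule ccontr)
    assume "?d \<tau> (s t) \<noteq> 0"
    then have "face C p (s t) \<tau>" using V_cells(1)[OF s[OF t(1)]] V_cells(2)[OF s[OF \<tau>(1)]] by (auto simp: face_def)
    moreover have "s t \<noteq> s \<tau>"
      using s[OF t(1)] s[OF \<tau>(1)] \<tau>(2) V_unique by metis
    ultimately show False using decrease s t(1) \<tau>(1) max by (meson not_le)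
  qed
  have "Poly_Mapping.lookup (bdry C (Suc p) c) (s t) = (\<Sum>\<tau>\<in>?k. Poly_Mapping.lookup c \<tau> * ?d \<tau> (s t))"
    by (subst additive_map_expand[OF chain_complex_additive[OF complex]])
      (simp_all add: tgt_span c lookup_frag_extend)
  also have "\<dots> = (\<Sum>\<tau>\<in>{t}. Poly_Mapping.lookup c \<tau> * ?d \<tau> (s t))"
    using t(1) zero by (intro sum.mono_neutral_right) auto
  also have "\<dots> \<noteq> 0" using V_cells(3)[OF s[OF t(1)]] t(1) by (auto simp: in_keys_iff)
  finally have "Poly_Mapping.lookup (d21 C V (Suc p) c) (s t) \<noteq> 0"
    using image_eqI[of "s t" fst "(s t, t)" "V p"] s[OF t(1)] c
    by (simp add: d21_eq lookup_chain_proj)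
  then show False using 0 by simp
qed

text \<open>The source part of the boundary of \<tau> is plus or minus \<sigma>, plus a remainder
  \<open>r\<close> on sources of smaller measure, which lie in the image by induction.\<close>

lemma d21_surj:
  assumes "(\<sigma>, \<tau>) \<in> V p"
  shows "frag_of \<sigma> \<in> d21 C V (Suc p) ` free_span (snd ` V p)"
  using assms
proof (induction "m p \<sigma>" arbitrary: \<sigma> \<tau> rule: less_induct)
  case less
  let ?T = "free_span (snd ` V p)" and ?D = "d21 C V (Suc p)"
  define e where "e = Poly_Mapping.lookup (bdry C (Suc p) (frag_of \<tau>)) \<sigma>"
  have R_diff: "a - b \<in> ?D ` ?T" if "a \<in> ?D ` ?T" "b \<in> ?D ` ?T" for a b
    using that d21_diff[symmetric] free_span_diff by fastforce
  have R_0: "0 \<in> ?D ` ?T"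
    using d21_diff[of 0 p 0] by (intro image_eqI[of _ _ 0]) auto
  have \<tau>: "frag_of \<tau> \<in> ?T" using less.prems by force
  define r where "r = ?D (frag_of \<tau>) - frag_cmul e (frag_of \<sigma>)"
  have "r \<in> free_span {\<sigma>'. frag_of \<sigma>' \<in> ?D ` ?T}"
  proof (rule free_spanI)
    fix \<sigma>' assume "\<sigma>' \<in> Poly_Mapping.keys r"
    then have r: "Poly_Mapping.lookup r \<sigma>' \<noteq> 0" by (simp add: in_keys_iff)
    have ne: "\<sigma>' \<noteq> \<sigma>"
    proof
      assume "\<sigma>' = \<sigma>"
      then show False
        using r image_eqI[of \<sigma> fst "(\<sigma>, \<tau>)" "V p"] less.prems \<tau>
        by (simp add: r_def lookup_minus d21_eq lookup_chain_proj e_def)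
    qed
    then have *: "\<sigma>' \<in> fst ` V p" "Poly_Mapping.lookup (bdry C (Suc p) (frag_of \<tau>)) \<sigma>' \<noteq> 0"
      using r \<tau> by (auto simp: r_def lookup_minus d21_eq lookup_chain_proj split: if_splits)
    then obtain \<tau>' where \<tau>': "(\<sigma>', \<tau>') \<in> V p" by auto
    have "face C p \<sigma>' \<tau>" using *(2) V_cells \<tau>' less.prems by (auto simp: face_def)
    then show "\<sigma>' \<in> {\<sigma>'. frag_of \<sigma>' \<in> ?D ` ?T}"
      using less.hyps \<tau>' decrease less.prems ne by blast
  qed
  then have "r \<in> ?D ` ?T"
    by (induction rule: free_span_induct) (auto intro: R_diff R_0)
  then have er: "frag_cmul e (frag_of \<sigma>) \<in> ?D ` ?T"
    using R_diff[of "?D (frag_of \<tau>)" r] \<tau> by (simp add: r_def)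
  \<comment> \<open>Regularity of the pair is what allows division by \<open>e\<close> over the
    integers.\<close>
  have "e \<in> {1, -1}" unfolding e_def by (rule V_cells[OF less.prems])
  then show ?case using er R_diff[OF R_0 er] by auto
qed

lemma d21_invertible: "d21_invertible C V"
  unfolding d21_invertible_def tgt_Suc source_cells_def
proof
  fix p
  let ?T = "free_span (snd ` V p)" and ?D = "d21 C V (Suc p)"
  have "inj_on ?D ?T"
  proof (rule inj_onI)
    fix a b assume ab: "a \<in> ?T" "b \<in> ?T" "?D a = ?D b"
    have "a - b = 0"
      by (rule d21_kernel[of _ p]) (use ab in \<open>simp_all add: free_span_diff d21_diff\<close>)
    then show "a = b" by simp
  qed
  moreover have "c \<in> ?D ` ?T" if "c \<in> free_span (fst ` V p)" for c
    using that
  proof (induction rule: free_span_induct)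
    case zero
    show ?case using d21_diff[of 0 p 0] by (intro image_eqI[of _ _ 0]) auto
  next
    case (one x)
    then show ?case using d21_surj by fastforce
  next
    case (diff a b)
    then show ?case using d21_diff[symmetric] free_span_diff by fastforce
  qed
  moreover have "?D ` ?T \<subseteq> free_span (fst ` V p)" by (auto simp: d21_eq)
  ultimately show "bij_betw ?D ?T (free_span (fst ` V p))" unfolding bij_betw_def by blast
qed

end

text \<open>That \<open>T\<close> is a chain complex is a conclusion: \<open>d d = 0\<close> is
  pulled back from \<open>K\<close> along the injective map \<theta>. The forward map carries no
  degree and the backward map does, matching \<open>EZ_identify\<close> and
  \<open>EZ_unidentify\<close>.\<close>

lemma reduction_transport:
  assumes red: "reduction C K f g h"
    and \<theta>: "\<And>n. additive_map (chain_group T n) (chain_group K n) \<theta>"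
    and \<theta>': "\<And>n. additive_map (chain_group K n) (chain_group T n) (\<theta>' n)"
    and inv1: "\<And>n c. c \<in> chain_group T n \<Longrightarrow> \<theta>' n (\<theta> c) = c"
    and inv2: "\<And>n c. c \<in> chain_group K n \<Longrightarrow> \<theta> (\<theta>' n c) = c"
    and T: "\<And>n. additive_map (chain_group T n) (chain_group T (n - 1)) (bdry T n)"
    and comm: "\<And>n c. c \<in> chain_group T n \<Longrightarrow> bdry K n (\<theta> c) = \<theta> (bdry T n c)"
  shows "reduction C T (\<lambda>n c. \<theta>' n (f n c)) (\<lambda>n c. g n (\<theta> c)) h"
proof -
  have C: "chain_complex C" and K: "chain_complex K"
    and f: "\<And>p. additive_map (chain_group C p) (chain_group K p) (f p)"
      "\<And>p c. c \<in> chain_group C (Suc p) \<Longrightarrow> bdry K (Suc p) (f (Suc p) c) = f p (bdry C (Suc p) c)"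
    and g: "\<And>p. additive_map (chain_group K p) (chain_group C p) (g p)"
      "\<And>p c. c \<in> chain_group K (Suc p) \<Longrightarrow> bdry C (Suc p) (g (Suc p) c) = g p (bdry K (Suc p) c)"
    and fg: "\<And>p c. c \<in> chain_group K p \<Longrightarrow> f p (g p c) = c"
    and fh: "\<And>p c. c \<in> chain_group C p \<Longrightarrow> f (Suc p) (h p c) = 0"
    using red by (auto simp: reduction_def chain_map_def)
  have in_T: "bdry T (Suc n) c \<in> chain_group T n" if "c \<in> chain_group T (Suc n)" for n c
    using additive_map_in[OF T that] by simp
  have \<theta>_0: "\<theta> 0 = 0" using additive_map_0[OF \<theta>] .
  have "chain_complex T"
    unfolding chain_complex_def
  proof (intro conjI allI ballI)
    show "additive_map (chain_group T p) (chain_group T (p - 1)) (bdry T p)" for p by (rule T)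
    fix c assume c: "c \<in> chain_group T 0"
    have "\<theta> (bdry T 0 c) = 0"
      using comm[OF c] K additive_map_in[OF \<theta> c] by (simp add: chain_complex_def)
    then show "bdry T 0 c = 0" using inv1[of "bdry T 0 c" 0] additive_map_in[OF T c]
      by (simp add: additive_map_0[OF \<theta>'])
  next
    fix p c assume c: "c \<in> chain_group T (Suc p)"
    let ?dd = "bdry T p (bdry T (Suc p) c)"
    have "\<theta> ?dd = bdry K p (bdry K (Suc p) (\<theta> c))" using c in_T by (simp add: comm)
    also have "\<dots> = 0" using K additive_map_in[OF \<theta> c] by (simp add: chain_complex_def)
    finally show "?dd = 0"
      using inv1[OF additive_map_in[OF T in_T[OF c]]] by (simp add: additive_map_0[OF \<theta>'])
  qed
  moreover have "chain_map C T (\<lambda>n c. \<theta>' n (f n c))"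
    unfolding chain_map_def
  proof (intro conjI allI ballI)
    show "additive_map (chain_group C p) (chain_group T p) (\<lambda>c. \<theta>' p (f p c))" for p
      by (rule additive_map_compose[OF f(1) \<theta>'])
    fix p c assume c: "c \<in> chain_group C (Suc p)"
    have t: "\<theta>' (Suc p) (f (Suc p) c) \<in> chain_group T (Suc p)"
      by (intro additive_map_in[OF \<theta>'] additive_map_in[OF f(1)] c)
    have "\<theta> (bdry T (Suc p) (\<theta>' (Suc p) (f (Suc p) c))) = f p (bdry C (Suc p) c)"
      using additive_map_in[OF f(1) c] by (simp add: comm[OF t, symmetric] inv2 f(2)[OF c])
    then show "bdry T (Suc p) (\<theta>' (Suc p) (f (Suc p) c)) = \<theta>' p (f p (bdry C (Suc p) c))"
      using inv1[OF in_T[OF t]] by simp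
  qed
  moreover have "chain_map T C (\<lambda>n c. g n (\<theta> c))"
    unfolding chain_map_def
    using additive_map_compose[OF \<theta> g(1)] additive_map_in[OF \<theta>] g(2) comm by auto
  ultimately show ?thesis
    using red additive_map_in[OF \<theta>] additive_map_in[OF f(1)]
    by (simp add: reduction_def inv1 inv2 additive_map_0[OF \<theta>'] del: One_nat_def)
qed

section \<open>Simplicial sets\<close>

definition mono_upto :: "nat \<Rightarrow> nat \<Rightarrow> (nat \<Rightarrow> nat) \<Rightarrow> bool" where
  "mono_upto m n f \<longleftrightarrow> (\<forall>i\<le>m. f i \<le> n) \<and> (\<forall>i j. i \<le> j \<longrightarrow> j \<le> m \<longrightarrow> f i \<le> f j)"

text \<open>Restricting inside \<open>pull\<close> allows morphisms to be arbitrary functions of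
  which only the values up to \<open>m\<close> matter, so composition is plain function composition
  and extensionality side conditions disappear.\<close>

definition pull :: "'a sset \<Rightarrow> nat \<Rightarrow> nat \<Rightarrow> (nat \<Rightarrow> nat) \<Rightarrow> 'a \<Rightarrow> 'a" where
  "pull X m n f x = act X m n (\<lambda>i\<in>{0..m}. f i) x"

definition skip :: "nat \<Rightarrow> nat \<Rightarrow> nat" where
  "skip i j = (if j < i then j else Suc j)"

text \<open>An \<open>n\<close>-simplex is degenerate iff for some \<open>i < n\<close> it is invariant under \<open>stutter i\<close>,
  the composition of the \<open>i\<close>-th codegeneracy with a coface.\<close>

definition stutter :: "nat \<Rightarrow> nat \<Rightarrow> nat" where
  "stutter i j = (if j = Suc i then i else j)"

lemma restrict_in_ord_maps [simp]: "(\<lambda>i\<in>{0..m}. f i) \<in> ord_maps m n \<longleftrightarrow> mono_upto m n f"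
  by (auto simp: ord_maps_def mono_upto_def monotone_on_def Pi_iff)

lemma ord_mapsE:
  assumes "\<alpha> \<in> ord_maps m n"
  shows "mono_upto m n \<alpha>" "(\<lambda>i\<in>{0..m}. \<alpha> i) = \<alpha>"
  using assms by (auto simp: ord_maps_def mono_upto_def monotone_on_def PiE_iff extensional_restrict)

lemma restrict_in_ord_surjs [simp]:
  "(\<lambda>i\<in>{0..m}. f i) \<in> ord_surjs m n \<longleftrightarrow> mono_upto m n f \<and> f ` {0..m} = {0..n}"
  by (simp add: ord_surjs_def image_restrict_eq)

lemma act_eq_pull: "\<alpha> \<in> ord_maps m n \<Longrightarrow> act X m n \<alpha> x = pull X m n \<alpha> x"
  by (simp add: pull_def ord_mapsE)

lemma mono_upto_compose: "mono_upto m n f \<Longrightarrow> mono_upto l m g \<Longrightarrow> mono_upto l n (\<lambda>i. f (g i))"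
  by (simp add: mono_upto_def)

lemma mono_upto_skip: "i \<le> Suc n \<Longrightarrow> mono_upto n (Suc n) (skip i)"
  by (auto simp: mono_upto_def skip_def)

lemma mono_upto_stutter: "mono_upto n n (stutter i)"
  by (auto simp: mono_upto_def stutter_def)

lemma pull_cong: "(\<And>i. i \<le> m \<Longrightarrow> f i = g i) \<Longrightarrow> pull X m n f x = pull X m n g x"
  unfolding pull_def by (metis atLeastAtMost_iff restrict_ext)

lemma coface_eq: "coface n i = (\<lambda>j\<in>{0..n}. skip i j)"
  by (simp add: coface_def skip_def)

lemma mono_upto_section:
  assumes "mono_upto n p f" "\<And>i. i \<le> p \<Longrightarrow> s i \<le> n \<and> f (s i) = i"
  shows "mono_upto p n s"
  unfolding mono_upto_def
proof (intro conjI allI impI)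
  show "s i \<le> n" if "i \<le> p" for i using assms(2) that by blast
  show "s i \<le> s j" if "i \<le> j" "j \<le> p" for i j
  proof (rule ccontr)
    assume "\<not> s i \<le> s j"
    then have "f (s j) \<le> f (s i)" using assms(1) assms(2)[of i] that unfolding mono_upto_def by (meson nat_le_linear order_trans)
    then have "i = j" using assms(2)[of i] assms(2)[of j] that by simp
    with \<open>\<not> s i \<le> s j\<close> show False by simp
  qed
qed

text \<open>The section can be made to pass through a prescribed point \<open>i\<close>; this is how
  \<open>pull_eq_nondeg\<close> compares two maps at an arbitrary argument, not only along one fixed
  section.\<close>

lemma section_exists:
  fixes f :: "nat \<Rightarrow> nat"
  assumes f: "f ` {0..n} = {0..p}" and i: "i \<le> n"
  obtains s where "\<And>k. k \<le> p \<Longrightarrow> s k \<le> n \<and> f (s k) = k" "s (f i) = i"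
proof
  let ?s = "\<lambda>k. if k = f i then i else SOME j. j \<le> n \<and> f j = k"
  show "?s k \<le> n \<and> f (?s k) = k" if "k \<le> p" for k
  proof (cases "k = f i")
    case False
    have "k \<in> f ` {0..n}" unfolding f using that by simp
    then have "\<exists>j. j \<le> n \<and> f j = k" by auto
    then show ?thesis using False someI_ex[of "\<lambda>j. j \<le> n \<and> f j = k"] by simp
  qed (use i in simp)
qed simp

lemma strictly_mono_upto_id:
  assumes "\<And>i. i < n \<Longrightarrow> f i < f (Suc i)" "i \<le> n" "f n \<le> n"
  shows "f i = (i::nat)"
proof -
  have up: "i \<le> f i" if "i \<le> n" for i
    using that
  proof (induction i)
    case (Suc i)
    then show ?case using assms(1)[of i] by simp
  qed simp
  have down: "n - k \<le> n \<and> f (n - k) \<le> n - k" if "k \<le> n" for k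
    using that
  proof (induction k)
    case (Suc k)
    have "n - k = Suc (n - Suc k)" using Suc.prems by simp
    with Suc assms(1)[of "n - Suc k"] show ?case by auto
  qed (use assms in simp)
  show ?thesis using up[OF assms(2)] down[of "n - i"] assms(2) by simp
qed

lemma mono_upto_lt_Suc: "mono_upto m n f \<Longrightarrow> (\<And>i. i < m \<Longrightarrow> f i \<noteq> f (Suc i)) \<Longrightarrow> i < m \<Longrightarrow> f i < f (Suc i)"
  unfolding mono_upto_def by (metis Suc_leI lessI less_imp_le_nat nat_less_le)

context simplicial_set
begin

lemma pull_in: "mono_upto m n f \<Longrightarrow> x \<in> simps X n \<Longrightarrow> pull X m n f x \<in> simps X m"
  by (simp add: pull_def act_closed)

lemma pull_id: "x \<in> simps X n \<Longrightarrow> (\<And>i. i \<le> n \<Longrightarrow> f i = i) \<Longrightarrow> pull X n n f x = x"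
  using act_id[of x n] pull_cong[of n f "\<lambda>i. i" X n x] by (simp add: pull_def)

lemma pull_pull:
  assumes "mono_upto l m g" "mono_upto m n f" "x \<in> simps X n"
  shows "pull X l m g (pull X m n f x) = pull X l n (\<lambda>i. f (g i)) x"
proof -
  have "compose {0..l} (\<lambda>i\<in>{0..m}. f i) (\<lambda>i\<in>{0..l}. g i) = (\<lambda>i\<in>{0..l}. f (g i))"
    using assms(1) by (intro ext) (auto simp: compose_def mono_upto_def)
  then show ?thesis
    using act_compose[of "\<lambda>i\<in>{0..l}. g i" l m "\<lambda>i\<in>{0..m}. f i" n x] assms by (simp add: pull_def)
qed

lemma nondegD: "x \<in> nondeg X n \<Longrightarrow> x \<in> simps X n"
  by (auto simp: nondeg_def)

text \<open>A map with \<open>f i = f (Suc i)\<close> factors through the \<open>i\<close>-th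
  codegeneracy, here \<open>?s\<close>, by way of its section \<open>skip (Suc i)\<close>.\<close>

lemma pull_not_nondeg:
  assumes "mono_upto m n f" "x \<in> simps X n" "i < m" "f i = f (Suc i)"
  shows "pull X m n f x \<notin> nondeg X m"
proof -
  obtain l where m: "m = Suc l" using assms(3) by (cases m) auto
  let ?s = "\<lambda>j. if j \<le> i then j else j - 1"
  have s: "mono_upto m l ?s" using assms(3) by (auto simp: mono_upto_def m)
  have "?s ` {0..m} = {0..l}"
  proof
    show "{0..l} \<subseteq> ?s ` {0..m}"
    proof
      fix j assume "j \<in> {0..l}"
      then have "j = ?s (skip (Suc i) j)" "skip (Suc i) j \<in> {0..m}" by (auto simp: skip_def m)
      then show "j \<in> ?s ` {0..m}" by blast
    qed
  qed (use assms(3) m in auto)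
  with s have surj: "(\<lambda>j\<in>{0..m}. ?s j) \<in> ord_surjs m l" by simp
  have sk: "mono_upto l m (skip (Suc i))" using assms(3) unfolding m by (intro mono_upto_skip) simp
  have "pull X m n f x = pull X m n (\<lambda>j. f (skip (Suc i) (?s j))) x"
  proof (rule pull_cong)
    show "f j = f (skip (Suc i) (?s j))" for j
      using assms(4) by (cases "j = Suc i") (auto simp: skip_def)
  qed
  also have "\<dots> = act X m l (\<lambda>j\<in>{0..m}. ?s j) (pull X l n (\<lambda>j. f (skip (Suc i) j)) x)"
    by (subst pull_def[symmetric], subst pull_pull[OF s])
      (use assms(1,2) sk mono_upto_compose in auto)
  finally have eq: "pull X m n f x = act X m l (\<lambda>j\<in>{0..m}. ?s j) (pull X l n (\<lambda>j. f (skip (Suc i) j)) x)" .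
  have "pull X l n (\<lambda>j. f (skip (Suc i) j)) x \<in> simps X l"
    by (rule pull_in[OF mono_upto_compose[OF assms(1) sk] assms(2)])
  moreover have "l < m" by (simp add: m)
  ultimately show ?thesis using surj eq unfolding nondeg_def by blast
qed

text \<open>This equational criterion suits products: a pair is fixed by \<open>stutter i\<close>
  exactly when both components are fixed for the same \<open>i\<close>. A surjection onto a smaller
  ordinal must repeat a value at some adjacent arguments, which gives the \<open>i\<close>.\<close>

lemma degenerate_iff_stutter:
  assumes x: "x \<in> simps X n"
  shows "x \<notin> nondeg X n \<longleftrightarrow> (\<exists>i<n. pull X n n (stutter i) x = x)"
proof
  assume "\<exists>i<n. pull X n n (stutter i) x = x"
  then show "x \<notin> nondeg X n"
    using pull_not_nondeg[OF mono_upto_stutter x] by (metis n_not_Suc_n stutter_def)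
next
  assume "x \<notin> nondeg X n"
  then obtain m \<alpha> y where m: "m < n" and \<alpha>: "\<alpha> \<in> ord_surjs n m" and y: "y \<in> simps X m"
    and x_eq: "x = act X n m \<alpha> y"
    using x by (auto simp: nondeg_def)
  have \<alpha>m: "\<alpha> \<in> ord_maps n m" using \<alpha> by (simp add: ord_surjs_def)
  note mono = ord_mapsE(1)[OF \<alpha>m]
  have "\<exists>i<n. \<alpha> i = \<alpha> (Suc i)"
  proof (rule ccontr)
    assume "\<not> ?thesis"
    then have lt: "\<alpha> i < \<alpha> (Suc i)" if "i < n" for i
      using mono_upto_lt_Suc[OF mono] that by blast
    have "\<alpha> n \<le> n" using mono m by (meson le_trans mono_upto_def order_refl less_imp_le)
    then have "\<alpha> n = n" using strictly_mono_upto_id[of n \<alpha>, OF lt] by blast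
    then show False using mono m by (metis mono_upto_def not_le order_refl)
  qed
  then obtain i where i: "i < n" "\<alpha> i = \<alpha> (Suc i)" by blast
  have "pull X n n (stutter i) x = pull X n m (\<lambda>j. \<alpha> (stutter i j)) y"
    unfolding x_eq act_eq_pull[OF \<alpha>m] by (rule pull_pull[OF mono_upto_stutter mono y])
  also have "\<dots> = x"
    unfolding x_eq act_eq_pull[OF \<alpha>m] using i by (intro pull_cong) (auto simp: stutter_def)
  finally show "\<exists>i<n. pull X n n (stutter i) x = x" using i(1) by blast
qed

text \<open>The existence half of the Eilenberg-Zilber lemma; uniqueness comes from
  \<open>pull_eq_nondeg\<close>.\<close>

lemma nondeg_decomposition:
  assumes "x \<in> simps X n"
  obtains p f \<sigma> where "\<sigma> \<in> nondeg X p" "mono_upto n p f" "f ` {0..n} = {0..p}" "x = pull X n p f \<sigma>"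
  using assms
proof (induction n arbitrary: x thesis rule: less_induct)
  case (less n)
  show ?case
  proof (cases "x \<in> nondeg X n")
    case True
    show ?thesis
      by (rule less.prems(1)[OF True, of "\<lambda>i. i"]) (auto simp: mono_upto_def pull_id less.prems(2))
  next
    case False
    then obtain m \<alpha> y where m: "m < n" and \<alpha>: "\<alpha> \<in> ord_surjs n m" and y: "y \<in> simps X m"
      and x: "x = act X n m \<alpha> y"
      using less.prems(2) by (auto simp: nondeg_def)
    have \<alpha>m: "\<alpha> \<in> ord_maps n m" using \<alpha> by (simp add: ord_surjs_def)
    obtain p f \<sigma> where *: "\<sigma> \<in> nondeg X p" "mono_upto m p f" "f ` {0..m} = {0..p}" "y = pull X m p f \<sigma>"
      using less.IH[OF m _ y] by blast
    show ?thesis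
    proof (rule less.prems(1)[OF *(1), of "\<lambda>i. f (\<alpha> i)"])
      show "mono_upto n p (\<lambda>i. f (\<alpha> i))" using *(2) ord_mapsE(1)[OF \<alpha>m] by (rule mono_upto_compose)
      show "(\<lambda>i. f (\<alpha> i)) ` {0..n} = {0..p}"
        using \<alpha> *(3) by (simp add: ord_surjs_def image_image[symmetric])
      show "x = pull X n p (\<lambda>i. f (\<alpha> i)) \<sigma>"
        unfolding x act_eq_pull[OF \<alpha>m] *(4)
        by (rule pull_pull) (use *(1,2) ord_mapsE(1)[OF \<alpha>m] nondegD in auto)
    qed
  qed
qed

text \<open>An asymmetric form of the uniqueness of the decomposition: \<open>f\<close> need not be surjective and
  \<open>\<sigma>\<close> may be degenerate.\<close>

lemma pull_eq_nondeg:
  assumes f: "mono_upto m p f" and \<sigma>: "\<sigma> \<in> simps X p"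
    and f': "mono_upto m p' f'" "f' ` {0..m} = {0..p'}" and \<sigma>': "\<sigma>' \<in> nondeg X p'"
    and eq: "pull X m p f \<sigma> = pull X m p' f' \<sigma>'"
  shows "p' \<le> p" and "p' = p \<Longrightarrow> \<sigma> = \<sigma>'" and "p' = p \<Longrightarrow> i \<le> m \<Longrightarrow> f i = f' i"
proof -
  \<comment> \<open>Pulling the equation back along a section \<open>s\<close> of \<open>f'\<close>
    writes \<sigma>' as a pullback of \<sigma> along \<open>f\<close> after \<open>s\<close>. As
    \<sigma>' is non-degenerate, this composite cannot repeat a value; being strictly increasing it
    is the identity when \<open>p' = p\<close>.\<close>
  have *: "\<sigma>' = pull X p' p (\<lambda>k. f (s k)) \<sigma>" "mono_upto p' p (\<lambda>k. f (s k))"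
    "\<And>k. k < p' \<Longrightarrow> f (s k) < f (s (Suc k))"
    if s: "\<And>k. k \<le> p' \<Longrightarrow> s k \<le> m \<and> f' (s k) = k" for s
  proof -
    have ms: "mono_upto p' m s" using mono_upto_section f'(1) s .
    have "pull X p' m s (pull X m p' f' \<sigma>') = pull X p' p' (\<lambda>k. f' (s k)) \<sigma>'"
      using ms f'(1) \<sigma>' nondegD by (intro pull_pull)
    also have "\<dots> = \<sigma>'" using s \<sigma>' nondegD by (intro pull_id) auto
    finally show \<sigma>'_eq: "\<sigma>' = pull X p' p (\<lambda>k. f (s k)) \<sigma>"
      unfolding eq[symmetric] pull_pull[OF ms f \<sigma>] by simp
    show mfs: "mono_upto p' p (\<lambda>k. f (s k))" using f ms by (rule mono_upto_compose)
    show "f (s k) < f (s (Suc k))" if "k < p'" for k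
      by (rule mono_upto_lt_Suc[OF mfs _ that]) (use pull_not_nondeg[OF mfs \<sigma>] \<sigma>' \<sigma>'_eq in auto)
  qed
  have ge: "k \<le> f (s k)" if "\<And>k. k \<le> p' \<Longrightarrow> s k \<le> m \<and> f' (s k) = k" "k \<le> p'" for s k
    using that(2)
  proof (induction k)
    case (Suc k)
    then show ?case using *(3)[OF that(1), of k] by simp
  qed simp
  obtain s where s: "\<And>k. k \<le> p' \<Longrightarrow> s k \<le> m \<and> f' (s k) = k"
    using section_exists[OF f'(2), of 0] by auto
  show "p' \<le> p" using ge[OF s order_refl] *(2)[OF s] unfolding mono_upto_def by (meson le_trans order_refl)
  have id: "f (s k) = k" if "\<And>k. k \<le> p' \<Longrightarrow> s k \<le> m \<and> f' (s k) = k" "k \<le> p'" "p' = p" for s k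
    using strictly_mono_upto_id[of p' "\<lambda>k. f (s k)" k] *(2,3)[OF that(1)] that(2,3)
    by (auto simp: mono_upto_def)
  show "\<sigma> = \<sigma>'" if "p' = p"
    using *(1)[OF s] pull_id[OF \<sigma>, of "\<lambda>k. f (s k)"] id[OF s] that by simp
  show "f i = f' i" if p: "p' = p" and i: "i \<le> m"
  proof -
    obtain s where s: "\<And>k. k \<le> p' \<Longrightarrow> s k \<le> m \<and> f' (s k) = k" "s (f' i) = i"
      using section_exists[OF f'(2) i] by blast
    have "f' i \<le> p'" using f'(1) i by (simp add: mono_upto_def)
    then show ?thesis using id[OF s(1) _ p, of "f' i"] s(2) by simp
  qed
qed

end

section \<open>The normalized complex\<close>

text \<open>Assigning zero to degenerate simplices lets face formulas be written without case
  distinctions.\<close>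

definition gen :: "'a sset \<Rightarrow> nat \<Rightarrow> 'a \<Rightarrow> ('a \<Rightarrow>\<^sub>0 int)" where
  "gen X n x = (if x \<in> nondeg X n then frag_of x else 0)"

lemma gen_in [simp]: "gen X n x \<in> free_span (nondeg X n)"
  by (simp add: gen_def)

lemma cells_normalized [simp]: "cells (normalized_complex X) = nondeg X"
  by (simp add: normalized_complex_def)

definition bdry_gen :: "'a sset \<Rightarrow> nat \<Rightarrow> 'a \<Rightarrow> ('a \<Rightarrow>\<^sub>0 int)" where
  "bdry_gen X n x = (case n of 0 \<Rightarrow> 0
    | Suc m \<Rightarrow> \<Sum>i\<le>n. frag_cmul ((-1) ^ i) (gen X m (pull X m n (skip i) x)))"

lemma bdry_normalized: "bdry (normalized_complex X) n = frag_extend (bdry_gen X n)"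
  by (auto simp: normalized_complex_def bdry_gen_def Let_def coface_eq pull_def gen_def fun_eq_iff
      frag_extend_eq_0 intro!: frag_extend_eq sum.cong split: nat.splits)

lemma bdry_gen_in: "bdry_gen X n x \<in> free_span (nondeg X (n - 1))"
  by (auto simp: bdry_gen_def simp del: sum.atMost_Suc intro!: free_span_sum free_span_cmul
      split: nat.splits)

context simplicial_set
begin

text \<open>The boundary formula also holds for degenerate simplices, where the two faces at a repeated
  vertex cancel and all other faces are degenerate.\<close>

lemma bdry_of_gen:
  assumes x: "x \<in> simps X n"
  shows "bdry (normalized_complex X) n (gen X n x) = bdry_gen X n x"
proof (cases "x \<in> nondeg X n")
  case False
  then obtain j where j: "j < n" "pull X n n (stutter j) x = x"
    using degenerate_iff_stutter[OF x] by blast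
  then obtain m where n: "n = Suc m" by (cases n) auto
  let ?F = "\<lambda>i. frag_cmul ((-1) ^ i) (gen X m (pull X m n (skip i) x))"
  have face: "pull X m n (skip i) x = pull X m n (\<lambda>k. stutter j (skip i k)) x" if "i \<le> n" for i
    using pull_pull[OF mono_upto_skip[of i m] mono_upto_stutter[of _ j], of x] j x that by (simp add: n)
  have zero: "?F i = 0" if i: "i \<le> n" "i \<noteq> j" "i \<noteq> Suc j" for i
  proof -
    \<comment> \<open>The place where \<open>stutter j\<close> after \<open>skip i\<close> repeats a
      value: omitting a vertex before \<open>j\<close> shifts the repetition down by one, omitting
      one after \<open>Suc j\<close> leaves it at \<open>j\<close>.\<close>
    let ?k = "if i < j then j - 1 else j"
    have "?k < m" "stutter j (skip i ?k) = stutter j (skip i (Suc ?k))"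
      using i j(1) by (auto simp: stutter_def skip_def n)
    then have "pull X m n (skip i) x \<notin> nondeg X m"
      unfolding face[OF i(1)] using i x
      by (intro pull_not_nondeg[of m n _ x ?k] mono_upto_compose[OF mono_upto_stutter])
        (auto simp: n mono_upto_skip)
    then show ?thesis by (simp add: gen_def)
  qed
  have "pull X m n (skip j) x = pull X m n (skip (Suc j)) x"
    using j(1) by (subst (1 2) face) (auto simp: stutter_def skip_def intro!: pull_cong)
  then have "?F j + ?F (Suc j) = 0"
    by (simp flip: frag_cmul_distrib)
  have "bdry_gen X n x = sum ?F {..n}" by (simp add: bdry_gen_def n)
  also have "\<dots> = sum ?F {j, Suc j}"
    using j(1) zero by (intro sum.mono_neutral_right) auto
  also have "\<dots> = 0" using \<open>?F j + ?F (Suc j) = 0\<close> by simp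
  finally show ?thesis using False by (simp add: gen_def bdry_normalized)
qed (simp add: gen_def bdry_normalized)

text \<open>\<open>bdry_of_gen\<close> expands the boundary of every face, degenerate or not, so the
  usual cancellation applies: the pair \<open>(i, j)\<close> with \<open>j < i\<close> meets
  \<open>(j, i - 1)\<close> with opposite sign by the cosimplicial identity.\<close>

lemma bdry_bdry_gen:
  assumes x: "x \<in> simps X (Suc n)"
  shows "bdry (normalized_complex X) n (bdry_gen X (Suc n) x) = 0"
proof (cases n)
  case 0
  then show ?thesis by (simp add: bdry_normalized bdry_gen_def frag_extend_eq_0)
next
  case (Suc m)
  let ?G = "\<lambda>(i, j). frag_cmul ((-1) ^ (i + j)) (gen X m (pull X m (Suc n) (\<lambda>k. skip i (skip j k)) x))"
  let ?A = "{(i, j). i \<le> Suc n \<and> j \<le> n \<and> j < i}" and ?B = "{(i, j). i \<le> Suc n \<and> j \<le> n \<and> i \<le> j}"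
  have face: "bdry (normalized_complex X) n (gen X n (pull X n (Suc n) (skip i) x))
      = (\<Sum>j\<le>n. frag_cmul ((-1) ^ j) (gen X m (pull X m (Suc n) (\<lambda>k. skip i (skip j k)) x)))"
    if "i \<le> Suc n" for i
    using that x pull_pull[OF mono_upto_skip mono_upto_skip]
    by (subst bdry_of_gen) (auto simp: bdry_gen_def Suc intro!: pull_in mono_upto_skip sum.cong)
  have "bdry (normalized_complex X) n (bdry_gen X (Suc n) x)
      = (\<Sum>i\<le>Suc n. frag_cmul ((-1) ^ i) (bdry (normalized_complex X) n (gen X n (pull X n (Suc n) (skip i) x))))"
    by (simp add: bdry_gen_def bdry_normalized frag_extend_sum frag_extend_cmul o_def frag_extend_add del: sum.atMost_Suc)
  also have "\<dots> = (\<Sum>i\<le>Suc n. \<Sum>j\<le>n. ?G (i, j))"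
    using face by (intro sum.cong refl) (simp add: frag_cmul_sum power_add)
  also have "\<dots> = sum ?G ({..Suc n} \<times> {..n})"
    by (simp add: sum.cartesian_product)
  also have "{..Suc n} \<times> {..n} = ?A \<union> ?B" by auto
  also have "sum ?G (?A \<union> ?B) = sum ?G ?A + sum ?G ?B"
    by (intro sum.union_disjoint) (auto intro: finite_subset[of _ "{..Suc n} \<times> {..n}"])
  also have "sum ?G ?A = sum (\<lambda>ij. - ?G ij) ?B"
  proof (rule sum.reindex_bij_witness[of _ "\<lambda>(i, j). (Suc j, i)" "\<lambda>(i, j). (j, i - 1)"])
    fix a assume "a \<in> ?A"
    then obtain i j where a: "a = (i, j)" "i \<le> Suc n" "j < i" by auto
    have "skip i (skip j k) = skip j (skip (i - 1) k)" for k using a(3) by (auto simp: skip_def)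
    moreover have "(-1::int) ^ (i + j) = - ((-1) ^ (j + (i - 1)))"
      using a(3) by (cases i) (auto simp: add.commute)
    ultimately show "- ?G (case a of (i, j) \<Rightarrow> (j, i - 1)) = ?G a" by (simp add: a)
  qed auto
  also have "\<dots> + sum ?G ?B = 0" by (simp add: sum_negf)
  finally show ?thesis .
qed

lemma chain_complex_normalized: "chain_complex (normalized_complex X)"
proof -
  let ?N = "normalized_complex X"
  have "bdry ?N p (bdry ?N (Suc p) c) = 0" if "c \<in> free_span (nondeg X (Suc p))" for p c
    using that
    by (induction rule: free_span_induct)
      (simp_all add: bdry_normalized frag_extend_diff bdry_bdry_gen[unfolded bdry_normalized] nondegD)
  moreover have "bdry ?N 0 c = 0" for c
    by (simp add: bdry_normalized bdry_gen_def frag_extend_eq_0)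
  moreover have "additive_map (chain_group ?N p) (chain_group ?N (p - 1)) (bdry ?N p)" for p
    by (simp add: bdry_normalized additive_map_extend bdry_gen_in del: One_nat_def)
  ultimately show ?thesis by (simp add: chain_complex_def)
qed

end

section \<open>Lattice paths\<close>

definition lattice_path :: "nat \<Rightarrow> nat \<Rightarrow> (nat \<times> nat) list \<Rightarrow> bool" where
  "lattice_path p q \<pi> \<longleftrightarrow> \<pi> \<noteq> [] \<and> \<pi> ! 0 = (0, 0) \<and> \<pi> ! (length \<pi> - 1) = (p, q) \<and>
    (\<forall>i. Suc i < length \<pi> \<longrightarrow> \<pi> ! Suc i \<in>
      {(Suc (fst (\<pi> ! i)), snd (\<pi> ! i)), (fst (\<pi> ! i), Suc (snd (\<pi> ! i))),
       (Suc (fst (\<pi> ! i)), Suc (snd (\<pi> ! i)))})"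

text \<open>The effect of a face map on paths: by \<open>nth_delete_nth\<close> its reindexing is
  the coface \<open>skip k\<close>.\<close>

definition delete_nth :: "nat \<Rightarrow> 'a list \<Rightarrow> 'a list" where
  "delete_nth k xs = take k xs @ drop (Suc k) xs"

lemma length_delete_nth [simp]: "k < length xs \<Longrightarrow> length (delete_nth k xs) = length xs - 1"
  by (auto simp: delete_nth_def)

lemma nth_delete_nth:
  "k < length xs \<Longrightarrow> i < length xs - 1 \<Longrightarrow> delete_nth k xs ! i = xs ! skip k i"
  by (auto simp: delete_nth_def nth_append skip_def)

lemma sum_list_delete_nth:
  fixes f :: "'a \<Rightarrow> nat"
  assumes "k < length xs"
  shows "sum_list (map f xs) = sum_list (map f (delete_nth k xs)) + f (xs ! k)"
proof -
  have "sum_list (map f xs) = sum_list (map f (take k xs @ xs ! k # drop (Suc k) xs))"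
    using assms by (simp flip: id_take_nth_drop)
  then show ?thesis by (simp add: delete_nth_def)
qed

lemma first_event_unique: "first_event \<pi> j \<Longrightarrow> first_event \<pi> k \<Longrightarrow> j = k"
  unfolding first_event_def by (metis linorder_neqE_nat)

lemma not_diag_step_bend: "diag_step \<pi> k \<Longrightarrow> \<not> bend \<pi> k"
  by (auto simp: diag_step_def bend_def)

lemma first_event_cases:
  obtains (diag) k where "first_event \<pi> k" "diag_step \<pi> k"
  | (bend) k where "first_event \<pi> k" "bend \<pi> k"
  | (none) "\<And>k. \<not> diag_step \<pi> k" "\<And>k. \<not> bend \<pi> k"
proof (cases "\<exists>k. diag_step \<pi> k \<or> bend \<pi> k")
  case True
  let ?P = "\<lambda>k. diag_step \<pi> k \<or> bend \<pi> k"
  have bound: "k \<le> length \<pi>" if "?P k" for k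
    using that by (auto simp: diag_step_def bend_def)
  have "?P (Greatest ?P)" "\<And>k. ?P k \<Longrightarrow> k \<le> Greatest ?P"
    using GreatestI_ex_nat[OF True bound] Greatest_le_nat[of ?P, OF _ bound] by auto
  then have "first_event \<pi> (Greatest ?P)" unfolding first_event_def by (meson not_le)
  with \<open>?P (Greatest ?P)\<close> diag bend show thesis by blast
qed (use none in blast)

context
  fixes p q :: nat and \<pi> :: "(nat \<times> nat) list"
  assumes path: "lattice_path p q \<pi>"
begin

lemma path_step:
  assumes "Suc i < length \<pi>"
  obtains (horizontal) "\<pi> ! Suc i = (Suc (fst (\<pi> ! i)), snd (\<pi> ! i))"
  | (vertical) "\<pi> ! Suc i = (fst (\<pi> ! i), Suc (snd (\<pi> ! i)))"
  | (diagonal) "\<pi> ! Suc i = (Suc (fst (\<pi> ! i)), Suc (snd (\<pi> ! i)))"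
  using path assms by (auto simp: lattice_path_def)

lemma path_mono:
  assumes "i \<le> j" "j < length \<pi>"
  shows "fst (\<pi> ! i) \<le> fst (\<pi> ! j)" "snd (\<pi> ! i) \<le> snd (\<pi> ! j)"
    "i < j \<Longrightarrow> fst (\<pi> ! i) + snd (\<pi> ! i) < fst (\<pi> ! j) + snd (\<pi> ! j)"
proof -
  have "fst (\<pi> ! i) \<le> fst (\<pi> ! j) \<and> snd (\<pi> ! i) \<le> snd (\<pi> ! j) \<and>
    j - i \<le> fst (\<pi> ! j) - fst (\<pi> ! i) + (snd (\<pi> ! j) - snd (\<pi> ! i))"
    using assms
  proof (induction j rule: dec_induct)
    case (step n)
    from step.prems show ?case by (cases rule: path_step) (use step in auto)
  qed simp
  then show "fst (\<pi> ! i) \<le> fst (\<pi> ! j)" "snd (\<pi> ! i) \<le> snd (\<pi> ! j)"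
    "i < j \<Longrightarrow> fst (\<pi> ! i) + snd (\<pi> ! i) < fst (\<pi> ! j) + snd (\<pi> ! j)"
    by auto
qed

lemma path_bounds: "i < length \<pi> \<Longrightarrow> fst (\<pi> ! i) \<le> p \<and> snd (\<pi> ! i) \<le> q"
  using path_mono[of i "length \<pi> - 1"] path by (auto simp: lattice_path_def)

lemma path_distinct: "i < length \<pi> \<Longrightarrow> j < length \<pi> \<Longrightarrow> i \<noteq> j \<Longrightarrow> \<pi> ! i \<noteq> \<pi> ! j"
  using path_mono(3)[of i j] path_mono(3)[of j i] by (cases i j rule: linorder_cases) auto

text \<open>Points of a path are pairwise distinct, so different deletions give different paths.
  This keeps the incidence number of a pair of the field a single sign.\<close>

lemma delete_nth_inject:
  assumes "i < length \<pi>" "k < length \<pi>" "delete_nth i \<pi> = delete_nth k \<pi>"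
  shows "i = k"
proof -
  have False if ik: "i < k" "k < length \<pi>" "delete_nth i \<pi> = delete_nth k \<pi>" for i k
  proof -
    have "delete_nth i \<pi> ! i = delete_nth k \<pi> ! i" using ik(3) by simp
    then have "\<pi> ! Suc i = \<pi> ! i" using ik(1,2) by (simp add: nth_delete_nth skip_def)
    then show False using path_distinct[of "Suc i" i] ik by simp
  qed
  then show ?thesis using assms by (metis linorder_neqE_nat)
qed

text \<open>The passage from target to source. Beyond the gap indices shift by one, so an event
  after the new diagonal step would come from an event of \<open>\<pi>\<close> after the
  bend.\<close>

lemma delete_bend:
  assumes k: "first_event \<pi> k" "bend \<pi> k"
  shows "lattice_path p q (delete_nth k \<pi>)" "first_event (delete_nth k \<pi>) (k - 1)"
    "diag_step (delete_nth k \<pi>) (k - 1)"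
proof -
  obtain j where j: "k = Suc j" using k(2) by (cases k) (auto simp: bend_def)
  have len: "Suc k < length \<pi>" using k(2) by (simp add: bend_def)
  have step: "\<pi> ! Suc k = (Suc (fst (\<pi> ! j)), Suc (snd (\<pi> ! j)))"
    using k(2) by (simp add: bend_def j)
  note nth = nth_delete_nth
  show diag: "diag_step (delete_nth k \<pi>) (k - 1)"
    using len step by (simp add: diag_step_def nth j skip_def)
  show "lattice_path p q (delete_nth k \<pi>)"
    unfolding lattice_path_def
  proof (intro conjI allI impI)
    show "delete_nth k \<pi> \<noteq> []" using len by (simp add: delete_nth_def)
    show "delete_nth k \<pi> ! 0 = (0, 0)" using len path by (simp add: nth skip_def j lattice_path_def)
    have "skip k (length \<pi> - 2) = length \<pi> - 1" using len by (auto simp: skip_def)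
    then show "delete_nth k \<pi> ! (length (delete_nth k \<pi>) - 1) = (p, q)"
      using len path by (simp add: nth lattice_path_def numeral_2_eq_2)
    fix i assume i: "Suc i < length (delete_nth k \<pi>)"
    consider "i < j" | "i = j" | "i > j" by linarith
    then show "delete_nth k \<pi> ! Suc i \<in> {(Suc (fst (delete_nth k \<pi> ! i)), snd (delete_nth k \<pi> ! i)),
      (fst (delete_nth k \<pi> ! i), Suc (snd (delete_nth k \<pi> ! i))),
      (Suc (fst (delete_nth k \<pi> ! i)), Suc (snd (delete_nth k \<pi> ! i)))}"
    proof cases
      case 1
      then show ?thesis using i len path by (simp add: nth skip_def j lattice_path_def)
    next
      case 2
      then show ?thesis using diag by (simp add: j diag_step_def)
    next
      case 3
      then show ?thesis using i len path by (simp add: nth skip_def j lattice_path_def)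
    qed
  qed
  have "\<not> diag_step (delete_nth k \<pi>) i" if "k - 1 < i" for i
  proof
    assume "diag_step (delete_nth k \<pi>) i"
    then have "diag_step \<pi> (Suc i)" using that len by (auto simp: diag_step_def nth skip_def j)
    then show False using k(1) that by (auto simp: first_event_def)
  qed
  moreover have "\<not> bend (delete_nth k \<pi>) i" if "k - 1 < i" for i
  proof
    assume b: "bend (delete_nth k \<pi>) i"
    show False
    \<comment> \<open>Index \<open>k\<close> is the end of the new diagonal step, so it is not
      entered vertically.\<close>
    proof (cases "i = k")
      case True
      then show False using b diag j by (auto simp: bend_def diag_step_def)
    next
      case False
      then have "bend \<pi> (Suc i)" using that b len by (auto simp: bend_def nth skip_def j)
      then show False using k(1) that by (auto simp: first_event_def)
    qed
  qed
  ultimately show "first_event (delete_nth k \<pi>) (k - 1)" using diag by (simp add: first_event_def)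
qed

lemma insert_bend:
  assumes j: "first_event \<pi> j" "diag_step \<pi> j"
  obtains \<pi>' where "lattice_path p q \<pi>'" "first_event \<pi>' (Suc j)" "bend \<pi>' (Suc j)"
    "delete_nth (Suc j) \<pi>' = \<pi>" "length \<pi>' = Suc (length \<pi>)"
proof
  let ?\<pi> = "take (Suc j) \<pi> @ (fst (\<pi> ! j), Suc (snd (\<pi> ! j))) # drop (Suc j) \<pi>"
  have len: "Suc j < length \<pi>" and step: "\<pi> ! Suc j = (Suc (fst (\<pi> ! j)), Suc (snd (\<pi> ! j)))"
    using j(2) by (auto simp: diag_step_def)
  show length: "length ?\<pi> = Suc (length \<pi>)" using len by simp
  have lo: "?\<pi> ! i = \<pi> ! i" if "i \<le> j" for i using that len by (simp add: nth_append)
  have mid: "?\<pi> ! Suc j = (fst (\<pi> ! j), Suc (snd (\<pi> ! j)))" using len by (simp add: nth_append)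
  have hi: "?\<pi> ! Suc i = \<pi> ! i" if "j < i" "i < length \<pi>" for i
  proof -
    have "i - j = Suc (i - Suc j)" using that by simp
    then show ?thesis using that len by (simp add: nth_append)
  qed
  show bend: "bend ?\<pi> (Suc j)" unfolding bend_def length
    using len step lo[of j] mid hi[of "Suc j"] by simp
  show "delete_nth (Suc j) ?\<pi> = \<pi>" using len by (simp add: delete_nth_def)
  show "lattice_path p q ?\<pi>"
    unfolding lattice_path_def length
  proof (intro conjI allI impI)
    show "?\<pi> ! 0 = (0, 0)" using lo[of 0] path by (simp add: lattice_path_def)
    show "?\<pi> ! (Suc (length \<pi>) - 1) = (p, q)"
      using hi[of "length \<pi> - 1"] len path by (simp add: lattice_path_def)
    fix i assume i: "Suc i < Suc (length \<pi>)"
    consider "i < j" | "i = j" | "i = Suc j" | "Suc j < i" by linarith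
    then show "?\<pi> ! Suc i \<in> {(Suc (fst (?\<pi> ! i)), snd (?\<pi> ! i)),
      (fst (?\<pi> ! i), Suc (snd (?\<pi> ! i))), (Suc (fst (?\<pi> ! i)), Suc (snd (?\<pi> ! i)))}"
    proof cases
      case 1
      then show ?thesis using lo[of i] lo[of "Suc i"] len path by (simp add: lattice_path_def)
    next
      case 2
      then show ?thesis using lo[of j] mid by simp
    next
      case 3
      then show ?thesis using mid hi[of "Suc j"] step len by simp
    next
      case 4
      then obtain l where "i = Suc l" "j < l" by (cases i) auto
      then show ?thesis using hi[of l] hi[of "Suc l"] i path by (simp add: lattice_path_def)
    qed
  qed simp
  have "\<not> diag_step ?\<pi> i" if i: "Suc j < i" for i
  proof
    assume d: "diag_step ?\<pi> i"
    obtain l where l: "i = Suc l" "j < l" using i by (cases i) auto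
    then have "diag_step \<pi> l" using d hi[of l] hi[of "Suc l"] unfolding diag_step_def length by auto
    then show False using j(1) l(2) by (auto simp: first_event_def)
  qed
  moreover have "\<not> bend ?\<pi> i" if i: "Suc j < i" for i
  proof
    assume b: "bend ?\<pi> i"
    obtain l where l: "i = Suc l" "j < l" using i by (cases i) auto
    show False
    \<comment> \<open>The point right after the inserted one is entered by a horizontal step, so it
      is no bend; all later bends are bends of \<open>\<pi>\<close>.\<close>
    proof (cases "l = Suc j")
      case True
      then show False using b bend l unfolding bend_def by auto
    next
      case False
      then obtain r where r: "l = Suc r" "j < r" using l(2) by (cases l) auto
      then have "bend \<pi> l" using b l hi[of r] hi[of l] hi[of "Suc l"] unfolding bend_def length by auto
      then show False using j(1) l(2) by (auto simp: first_event_def)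
    qed
  qed
  ultimately show "first_event ?\<pi> (Suc j)" using bend by (simp add: first_event_def)
qed

text \<open>Without diagonal steps the index of a point is the sum of its coordinates. Without bends
  a vertical step is followed only by vertical ones, so a point of positive height has already
  reached the abscissa \<open>p\<close>.\<close>

lemma path_without_events:
  assumes diag: "\<And>k. \<not> diag_step \<pi> k" and bend: "\<And>k. \<not> bend \<pi> k"
  shows "length \<pi> = Suc (p + q)" "i < length \<pi> \<Longrightarrow> \<pi> ! i = (min i p, i - p)"
proof -
  let ?n = "length \<pi> - 1"
  have len: "?n < length \<pi>" and last: "\<pi> ! ?n = (p, q)"
    using path by (auto simp: lattice_path_def)
  have sum: "fst (\<pi> ! i) + snd (\<pi> ! i) = i" if "i < length \<pi>" for i
    using that
  proof (induction i)
    case 0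
    show ?case using path by (simp add: lattice_path_def)
  next
    case (Suc i)
    from Suc.prems show ?case
      by (cases rule: path_step[of i]) (use Suc diag[of i] in \<open>auto simp: diag_step_def\<close>)
  qed
  have vert: "\<pi> ! Suc i = (fst (\<pi> ! i), Suc (snd (\<pi> ! i)))"
    if "\<pi> ! i = (fst (\<pi> ! (i - 1)), Suc (snd (\<pi> ! (i - 1))))" "0 < i" "Suc i < length \<pi>" for i
    using that(3)
    by (cases rule: path_step) (use that bend[of i] diag[of i] in \<open>auto simp: bend_def diag_step_def\<close>)
  have pos: "\<pi> ! i = (fst (\<pi> ! (i - 1)), Suc (snd (\<pi> ! (i - 1))))"
    if "0 < snd (\<pi> ! i)" "i < length \<pi>" for i
    using that
  proof (induction i)
    case 0
    then show ?case using path by (simp add: lattice_path_def)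
  next
    case (Suc i)
    have i: "Suc i < length \<pi>" by (rule Suc.prems)
    show ?case
    proof (cases "snd (\<pi> ! i) = 0")
      case True
      from i show ?thesis
        by (cases rule: path_step) (use Suc.prems True diag[of i] in \<open>auto simp: diag_step_def\<close>)
    next
      case False
      then have "i \<noteq> 0" using path by (cases i) (auto simp: lattice_path_def)
      then show ?thesis using vert[OF Suc.IH _ i] False i by simp
    qed
  qed
  have const: "fst (\<pi> ! i) = p" if "0 < snd (\<pi> ! i)" "i < length \<pi>" for i
  proof -
    have "i \<le> j \<Longrightarrow> j < length \<pi> \<Longrightarrow> fst (\<pi> ! j) = fst (\<pi> ! i)" for j
    proof (induction j rule: dec_induct)
      case (step n)
      have "0 < snd (\<pi> ! Suc n)" using path_mono(2)[of i "Suc n"] step that by simp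
      then show ?case using pos[of "Suc n"] step by simp
    qed simp
    from this[of ?n] show ?thesis using that last len by simp
  qed
  show "length \<pi> = Suc (p + q)" using sum[OF len] last len by simp
  show "\<pi> ! i = (min i p, i - p)" if i: "i < length \<pi>"
  proof (cases "snd (\<pi> ! i) = 0")
    case True
    then show ?thesis using sum[OF i] path_bounds[OF i] by (auto simp: prod_eq_iff)
  next
    case False
    then show ?thesis using sum[OF i] const[OF _ i] by (auto simp: prod_eq_iff)
  qed
qed

end

section \<open>Weights of lattice paths\<close>

text \<open>The secondary part of the measure behind admissibility: replacing a diagonal step by a bend and
  then deleting another point moves the path towards its upper left.\<close>

definition path_weight :: "nat \<Rightarrow> (nat \<times> nat) list \<Rightarrow> nat" where
  "path_weight q \<pi> = sum_list (map (\<lambda>(x, y). x + (q - y)) \<pi>)"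

text \<open>It suffices that the bend weighs less than point \<open>i\<close>. If
  \<open>Suc i < k\<close>, the bend survives as first event, contradicting \<open>j\<close>. The
  two neighbours of the bend lie directly below it and directly to its right. If \<open>i\<close> is
  beyond them, the path must run horizontally from the bend to point \<open>i\<close>.\<close>

lemma path_weight_decrease:
  assumes path: "lattice_path p q \<pi>" and k: "first_event \<pi> k" "bend \<pi> k"
    and i: "i < length \<pi>" "i \<noteq> k"
    and j: "first_event (delete_nth i \<pi>) j" "diag_step (delete_nth i \<pi>) j"
  shows "path_weight q (delete_nth i \<pi>) < path_weight q (delete_nth k \<pi>)"
proof -
  let ?w = "\<lambda>(x, y). x + (q - y)"
  have len: "Suc k < length \<pi>" "0 < k"
    and up: "\<pi> ! k = (fst (\<pi> ! (k - 1)), Suc (snd (\<pi> ! (k - 1))))"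
    and right: "\<pi> ! Suc k = (Suc (fst (\<pi> ! k)), snd (\<pi> ! k))"
    using k(2) by (auto simp: bend_def)
  note nth = nth_delete_nth[OF i(1)]
  consider "Suc i < k" | "Suc i = k" | "i = Suc k" | "Suc k < i" using i(2) by linarith
  then have "?w (\<pi> ! k) < ?w (\<pi> ! i)"
  proof cases
    case 1
    then obtain r where r: "k = Suc (Suc r)" by (cases k; cases "k - 1") auto
    have "bend (delete_nth i \<pi>) (Suc r)"
      using 1 len up right i(1) unfolding bend_def by (auto simp: nth skip_def r)
    moreover have "\<not> bend (delete_nth i \<pi>) l" if "Suc r < l" for l
    proof
      assume "bend (delete_nth i \<pi>) l"
      then have "bend \<pi> (Suc l)" using that 1 i(1) r by (auto simp: bend_def nth skip_def)
      then show False using k(1) that by (auto simp: first_event_def r)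
    qed
    moreover have "\<not> diag_step (delete_nth i \<pi>) l" if "Suc r < l" for l
    proof
      assume "diag_step (delete_nth i \<pi>) l"
      then have "diag_step \<pi> (Suc l)" using that 1 i(1) r by (auto simp: diag_step_def nth skip_def)
      then show False using k(1) that by (auto simp: first_event_def r)
    qed
    ultimately have "first_event (delete_nth i \<pi>) (Suc r)" by (simp add: first_event_def)
    then show ?thesis
      using first_event_unique[OF j(1)] j(2) not_diag_step_bend \<open>bend (delete_nth i \<pi>) (Suc r)\<close> by blast
  next
    case 2
    \<comment> \<open>The bound on the height by \<open>q\<close> makes the truncated subtraction in
      the weight strict.\<close>
    then show ?thesis using up path_bounds[OF path, of k] len by (auto split: prod.split)
  next
    case 3
    then show ?thesis using right by (auto split: prod.split)
  next
    case 4
    then have "bend (delete_nth i \<pi>) k"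
      using len up right i(1) unfolding bend_def by (auto simp: nth skip_def)
    then have "k < j" using j not_diag_step_bend unfolding first_event_def by (metis linorder_neqE_nat)
    \<comment> \<open>A diagonal step of the shortened path that does not cross the gap would be one
      of \<open>\<pi>\<close> after its first event.\<close>
    have "j = i - 1"
    proof (rule ccontr)
      assume "j \<noteq> i - 1"
      then have "diag_step \<pi> (if j < i then j else Suc j)"
        using j(2) i(1) by (auto simp: diag_step_def nth skip_def split: if_splits)
      then show False using k(1) \<open>k < j\<close> by (auto simp: first_event_def split: if_splits)
    qed
    then have i': "Suc i < length \<pi>" and diag: "\<pi> ! Suc i = (Suc (fst (\<pi> ! (i - 1))), Suc (snd (\<pi> ! (i - 1))))"
      using j(2) i(1) \<open>k < j\<close> by (auto simp: diag_step_def nth skip_def)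
    have no: "\<not> diag_step \<pi> l" "\<not> bend \<pi> l" if "k < l" for l
      using k(1) that by (auto simp: first_event_def)
    obtain r where r: "i = Suc r" "k < r" using 4 by (cases i) auto
    \<comment> \<open>The points \<open>i - 1\<close> and \<open>i + 1\<close> differ by
      \<open>(1, 1)\<close>. Going up before going right would be a bend at \<open>i\<close>, after
      the first event.\<close>
    have horiz_r: "\<pi> ! Suc r = (Suc (fst (\<pi> ! r)), snd (\<pi> ! r))"
    proof -
      have "Suc r < length \<pi>" using i(1) r by simp
      then show ?thesis
      proof (cases rule: path_step[OF path, consumes 1, case_names horizontal vertical diagonal])
        case vertical
        from i' have "bend \<pi> i"
          using vertical diag r unfolding bend_def by auto
        then show ?thesis using no(2)[of i] r by simp
      next
        case diagonal
        then show ?thesis using no(1)[OF r(2)] i(1) r by (auto simp: diag_step_def)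
      qed
    qed
    \<comment> \<open>Induction backward from \<open>r\<close>: a vertical step before a horizontal
      one would again be a bend after \<open>k\<close>.\<close>
    have horiz: "\<pi> ! Suc l = (Suc (fst (\<pi> ! l)), snd (\<pi> ! l))" if "k < l" "l \<le> r" for l
      using that(2,1)
    proof (induction l rule: inc_induct)
      case base
      show ?case by (rule horiz_r)
    next
      case (step l)
      have "Suc l < length \<pi>" using step.hyps i(1) r by simp
      then show ?case
      proof (cases rule: path_step[OF path, consumes 1, case_names horizontal vertical diagonal])
        case vertical
        have "bend \<pi> (Suc l)"
          using vertical step i(1) r unfolding bend_def by auto
        then show ?thesis using no(2)[of "Suc l"] step by simp
      next
        case diagonal
        then show ?thesis using no(1)[OF step.prems] \<open>Suc l < length \<pi>\<close> by (auto simp: diag_step_def)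
      qed
    qed
    have "snd (\<pi> ! l) = snd (\<pi> ! k) \<and> fst (\<pi> ! k) < fst (\<pi> ! l)" if "Suc k \<le> l" "l \<le> i" for l
      using that
    proof (induction l rule: dec_induct)
      case base
      then show ?case using right by simp
    next
      case (step l)
      then show ?case using r horiz[of l] by auto
    qed
    from this[of i] 4 show ?thesis by (auto split: prod.split)
  qed
  then show ?thesis
    using sum_list_delete_nth[OF i(1), of ?w] sum_list_delete_nth[of k \<pi> ?w] len
    by (simp add: path_weight_def)
qed

lemma path_weight_bound:
  assumes "lattice_path p q \<pi>"
  shows "path_weight q \<pi> \<le> length \<pi> * (p + q)"
proof -
  have "(\<lambda>(x, y). x + (q - y)) z \<le> p + q" if "z \<in> set \<pi>" for z
    using that path_bounds[OF assms] by (force simp: in_set_conv_nth split: prod.split)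
  then have "path_weight q \<pi> \<le> sum_list (map (\<lambda>_. p + q) \<pi>)"
    unfolding path_weight_def by (rule sum_list_mono)
  then show ?thesis by (simp add: sum_list_triv)
qed

section \<open>The Eilenberg-Zilber vector field\<close>

lemma pull_sset_prod:
  "pull (sset_prod X Y) m n f (x, y) = (pull X m n f x, pull Y m n f y)"
  by (simp add: pull_def sset_prod_def)

lemma simps_sset_prod: "simps (sset_prod X Y) n = simps X n \<times> simps Y n"
  by (simp add: sset_prod_def)

lemma simplicial_set_prod:
  assumes "simplicial_set X" "simplicial_set Y"
  shows "simplicial_set (sset_prod X Y)"
proof -
  interpret X: simplicial_set X by fact
  interpret Y: simplicial_set Y by fact
  show ?thesis
    by unfold_locales
      (auto simp: sset_prod_def X.act_closed Y.act_closed X.act_id Y.act_id X.act_compose Y.act_compose)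
qed

lemma image_eq_atLeastAtMost_imp_step:
  fixes f :: "nat \<Rightarrow> nat"
  assumes "mono_upto n p f" "f ` {0..n} = {0..p}"
  shows "f 0 = 0" "f n = p" "i < n \<Longrightarrow> f (Suc i) = f i \<or> f (Suc i) = Suc (f i)"
proof -
  have mono: "\<And>i j. i \<le> j \<Longrightarrow> j \<le> n \<Longrightarrow> f i \<le> f j" using assms(1) by (simp add: mono_upto_def)
  have hit: "\<exists>i\<le>n. f i = k" if "k \<le> p" for k
  proof -
    have "k \<in> f ` {0..n}" unfolding assms(2) using that by simp
    then show ?thesis by auto
  qed
  show "f 0 = 0" using hit[of 0] mono[of 0] by (metis le_0_eq le0)
  have "f n \<le> p" using assms(1) by (simp add: mono_upto_def)
  then show "f n = p" using hit[of p] mono[of _ n] by (metis le_antisym order_refl)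
  show "f (Suc i) = f i \<or> f (Suc i) = Suc (f i)" if "i < n"
  proof (rule ccontr)
    assume no: "\<not> ?thesis"
    have le: "f i \<le> f (Suc i)" using mono[of i "Suc i"] that by simp
    have "f (Suc i) \<le> p" using assms(1) that by (simp add: mono_upto_def)
    then obtain l where l: "l \<le> n" "f l = Suc (f i)" using hit[of "Suc (f i)"] no le by auto
    show False
    proof (cases "l \<le> i")
      case True
      then show False using mono[of l i] l that by simp
    next
      case False
      then show False using mono[of "Suc i" l] l le no by simp
    qed
  qed
qed

lemma step_imp_image_eq_atLeastAtMost:
  fixes f :: "nat \<Rightarrow> nat"
  assumes "f 0 = 0" "f n = p" "\<And>i. i < n \<Longrightarrow> f (Suc i) = f i \<or> f (Suc i) = Suc (f i)"
  shows "mono_upto n p f" "f ` {0..n} = {0..p}"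
proof -
  have mono: "f i \<le> f j" if "i \<le> j" "j \<le> n" for i j
    using that
  proof (induction j rule: dec_induct)
    case (step j)
    then show ?case using assms(3)[of j] by auto
  qed simp
  then show "mono_upto n p f" using assms(2) by (auto simp: mono_upto_def)
  have "{0..f m} \<subseteq> f ` {0..m}" if "m \<le> n" for m
    using that
  proof (induction m)
    case (Suc m)
    then have "{0..f m} \<subseteq> f ` {0..Suc m}" "f (Suc m) \<in> f ` {0..Suc m}" by force+
    moreover have "f (Suc m) = f m \<or> f (Suc m) = Suc (f m)" using assms(3) Suc.prems by simp
    then have "{0..f (Suc m)} \<subseteq> insert (f (Suc m)) {0..f m}" by auto
    ultimately show ?case by (meson insert_subset order_trans)
  qed (use assms in auto)
  then have "{0..p} \<subseteq> f ` {0..n}" using assms(2) by blast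
  then show "f ` {0..n} = {0..p}" using mono[of _ n] assms(2) by auto
qed

section \<open>Non-degenerate simplices of the product as lattice paths\<close>

definition path_simplex ::
    "'a sset \<Rightarrow> 'b sset \<Rightarrow> nat \<Rightarrow> nat \<Rightarrow> 'a \<Rightarrow> nat \<Rightarrow> 'b \<Rightarrow> (nat \<times> nat) list \<Rightarrow> 'a \<times> 'b" where
  "path_simplex X Y n p \<sigma> q \<tau> \<pi> = (pull X n p (\<lambda>i. fst (\<pi> ! i)) \<sigma>, pull Y n q (\<lambda>i. snd (\<pi> ! i)) \<tau>)"

lemma lattice_path_surj:
  assumes "lattice_path p q \<pi>" "length \<pi> = Suc n"
  shows "mono_upto n p (\<lambda>i. fst (\<pi> ! i))" "(\<lambda>i. fst (\<pi> ! i)) ` {0..n} = {0..p}"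
    "mono_upto n q (\<lambda>i. snd (\<pi> ! i))" "(\<lambda>i. snd (\<pi> ! i)) ` {0..n} = {0..q}"
proof -
  have ends: "\<pi> ! 0 = (0, 0)" "\<pi> ! n = (p, q)" using assms by (auto simp: lattice_path_def)
  have "fst (\<pi> ! Suc i) = fst (\<pi> ! i) \<or> fst (\<pi> ! Suc i) = Suc (fst (\<pi> ! i))"
    "snd (\<pi> ! Suc i) = snd (\<pi> ! i) \<or> snd (\<pi> ! Suc i) = Suc (snd (\<pi> ! i))" if "i < n" for i
    using assms that by (auto simp: lattice_path_def)
  then show "mono_upto n p (\<lambda>i. fst (\<pi> ! i))" "(\<lambda>i. fst (\<pi> ! i)) ` {0..n} = {0..p}"
    "mono_upto n q (\<lambda>i. snd (\<pi> ! i))" "(\<lambda>i. snd (\<pi> ! i)) ` {0..n} = {0..q}"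
    using ends
      step_imp_image_eq_atLeastAtMost[of "\<lambda>i. fst (\<pi> ! i)" n p]
      step_imp_image_eq_atLeastAtMost[of "\<lambda>i. snd (\<pi> ! i)" n q]
    by auto
qed

locale sset_pair =
  X: simplicial_set X + Y: simplicial_set Y for X :: "'a sset" and Y :: "'b sset"
begin

sublocale P: simplicial_set "sset_prod X Y"
  by (rule simplicial_set_prod) unfold_locales

abbreviation "C \<equiv> normalized_complex (sset_prod X Y)"
abbreviation "V \<equiv> EZ_field X Y"

text \<open>If the pair were degenerate, one \<open>stutter i\<close> would fix both components, and
  uniqueness of the decompositions would make \<open>f\<close> and \<open>g\<close> repeat at the
  same \<open>i\<close>.\<close>

lemma nondeg_prodI:
  assumes \<sigma>: "\<sigma> \<in> nondeg X p" and \<tau>: "\<tau> \<in> nondeg Y q"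
    and f: "mono_upto n p f" "f ` {0..n} = {0..p}" and g: "mono_upto n q g" "g ` {0..n} = {0..q}"
    and ne: "\<And>i. i < n \<Longrightarrow> f i \<noteq> f (Suc i) \<or> g i \<noteq> g (Suc i)"
  shows "(pull X n p f \<sigma>, pull Y n q g \<tau>) \<in> nondeg (sset_prod X Y) n"
proof (rule ccontr)
  let ?x = "(pull X n p f \<sigma>, pull Y n q g \<tau>)"
  have x: "?x \<in> simps (sset_prod X Y) n"
    using \<sigma> \<tau> f g by (simp add: simps_sset_prod X.pull_in Y.pull_in X.nondegD Y.nondegD)
  assume "?x \<notin> nondeg (sset_prod X Y) n"
  then obtain i where i: "i < n" "pull (sset_prod X Y) n n (stutter i) ?x = ?x"
    using P.degenerate_iff_stutter[OF x] by blast
  then have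
    "pull X n p (\<lambda>k. f (stutter i k)) \<sigma> = pull X n p f \<sigma>"
    "pull Y n q (\<lambda>k. g (stutter i k)) \<tau> = pull Y n q g \<tau>"
    using X.pull_pull[OF mono_upto_stutter f(1) X.nondegD[OF \<sigma>], of i]
      Y.pull_pull[OF mono_upto_stutter g(1) Y.nondegD[OF \<tau>], of i]
    by (auto simp: pull_sset_prod)
  then have "f (stutter i (Suc i)) = f (Suc i)" "g (stutter i (Suc i)) = g (Suc i)"
    using i(1) X.pull_eq_nondeg(3)[OF mono_upto_compose[OF f(1) mono_upto_stutter] X.nondegD[OF \<sigma>] f \<sigma>, of i "Suc i"]
      Y.pull_eq_nondeg(3)[OF mono_upto_compose[OF g(1) mono_upto_stutter] Y.nondegD[OF \<tau>] g \<tau>, of i "Suc i"]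
    by auto
  then show False using ne[OF i(1)] by (simp add: stutter_def)
qed

lemma nondeg_prodD:
  assumes \<rho>: "(pull X n p f x, pull Y n q g y) \<in> nondeg (sset_prod X Y) n"
    and x: "x \<in> simps X p" and y: "y \<in> simps Y q"
    and f: "mono_upto n p f" and g: "mono_upto n q g" and i: "i < n"
  shows "f i \<noteq> f (Suc i) \<or> g i \<noteq> g (Suc i)"
proof (rule ccontr)
  assume "\<not> ?thesis"
  then have eq: "f (stutter i k) = f k" "g (stutter i k) = g k" for k by (auto simp: stutter_def)
  let ?\<rho> = "(pull X n p f x, pull Y n q g y)"
  have "pull (sset_prod X Y) n n (stutter i) ?\<rho> = ?\<rho>"
    using X.pull_pull[OF mono_upto_stutter f x] Y.pull_pull[OF mono_upto_stutter g y]
    by (simp add: pull_sset_prod eq)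
  then show False using P.degenerate_iff_stutter[OF P.nondegD[OF \<rho>]] \<rho> i by blast
qed

text \<open>Replaces simplices by combinatorics: non-degeneracy of the pair amounts to consecutive
  points of the path being different, which the step condition of \<open>lattice_path\<close>
  already contains.\<close>

lemma has_path_iff:
  "has_path X Y n \<rho> p \<sigma> q \<tau> \<pi> \<longleftrightarrow> \<sigma> \<in> nondeg X p \<and> \<tau> \<in> nondeg Y q \<and>
    lattice_path p q \<pi> \<and> length \<pi> = Suc n \<and> \<rho> = path_simplex X Y n p \<sigma> q \<tau> \<pi>" (is "?L \<longleftrightarrow> ?R")
proof
  assume ?L
  then obtain \<alpha> \<beta> where \<rho>: "\<rho> \<in> nondeg (sset_prod X Y) n" and \<sigma>: "\<sigma> \<in> nondeg X p" and \<tau>: "\<tau> \<in> nondeg Y q"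
    and \<alpha>: "\<alpha> \<in> ord_surjs n p" and \<beta>: "\<beta> \<in> ord_surjs n q"
    and \<rho>_eq: "\<rho> = (act X n p \<alpha> \<sigma>, act Y n q \<beta> \<tau>)" and \<pi>: "\<pi> = map (\<lambda>i. (\<alpha> i, \<beta> i)) [0..<Suc n]"
    by (auto simp: has_path_def)
  have \<alpha>m: "\<alpha> \<in> ord_maps n p" and \<beta>m: "\<beta> \<in> ord_maps n q" using \<alpha> \<beta> by (auto simp: ord_surjs_def)
  have nth: "\<pi> ! i = (\<alpha> i, \<beta> i)" if "i \<le> n" for i
    using that by (simp add: \<pi> del: upt_Suc)
  have len: "length \<pi> = Suc n" by (simp add: \<pi>)
  have \<rho>_pull: "\<rho> = (pull X n p \<alpha> \<sigma>, pull Y n q \<beta> \<tau>)"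
    by (simp add: \<rho>_eq act_eq_pull \<alpha>m \<beta>m)
  have ne: "\<alpha> i \<noteq> \<alpha> (Suc i) \<or> \<beta> i \<noteq> \<beta> (Suc i)" if "i < n" for i
    using nondeg_prodD[OF _ _ _ _ _ that] \<rho> \<sigma> \<tau> \<alpha>m \<beta>m ord_mapsE(1) X.nondegD Y.nondegD
    unfolding \<rho>_pull by blast
  have a: "mono_upto n p \<alpha>" "\<alpha> ` {0..n} = {0..p}" and b: "mono_upto n q \<beta>" "\<beta> ` {0..n} = {0..q}"
    using \<alpha> \<beta> \<alpha>m \<beta>m ord_mapsE(1) by (auto simp: ord_surjs_def)
  have "lattice_path p q \<pi>"
    unfolding lattice_path_def len
  proof (intro conjI allI impI)
    show "\<pi> \<noteq> []" using len by auto
    show "\<pi> ! 0 = (0, 0)" "\<pi> ! (Suc n - 1) = (p, q)"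
      using image_eq_atLeastAtMost_imp_step[OF a] image_eq_atLeastAtMost_imp_step[OF b] by (auto simp: nth)
    show "\<pi> ! Suc i \<in> {(Suc (fst (\<pi> ! i)), snd (\<pi> ! i)), (fst (\<pi> ! i), Suc (snd (\<pi> ! i))),
        (Suc (fst (\<pi> ! i)), Suc (snd (\<pi> ! i)))}" if "Suc i < Suc n" for i
      using image_eq_atLeastAtMost_imp_step(3)[OF a, of i] image_eq_atLeastAtMost_imp_step(3)[OF b, of i]
        ne[of i] that by (auto simp: nth)
  qed
  moreover have "\<rho> = path_simplex X Y n p \<sigma> q \<tau> \<pi>"
    unfolding \<rho>_pull path_simplex_def by (auto intro!: pull_cong simp: nth)
  ultimately show ?R using \<sigma> \<tau> len by simp
next
  assume R: ?R
  let ?f = "\<lambda>i. fst (\<pi> ! i)" and ?g = "\<lambda>i. snd (\<pi> ! i)"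
  have path: "lattice_path p q \<pi>" and len: "length \<pi> = Suc n" using R by auto
  note surj = lattice_path_surj[OF path len]
  have "?f i \<noteq> ?f (Suc i) \<or> ?g i \<noteq> ?g (Suc i)" if "i < n" for i
    using path_distinct[OF path, of i "Suc i"] that len by (auto simp: prod_eq_iff)
  then have "\<rho> \<in> nondeg (sset_prod X Y) n"
    using nondeg_prodI surj R unfolding path_simplex_def by blast
  moreover have "\<pi> = map (\<lambda>i. ((\<lambda>i\<in>{0..n}. ?f i) i, (\<lambda>i\<in>{0..n}. ?g i) i)) [0..<Suc n]"
    using len by (intro nth_equalityI) (auto simp del: upt_Suc)
  ultimately show ?L
    using R surj unfolding has_path_def path_simplex_def pull_def
    by (intro conjI bexI[of _ "\<lambda>i\<in>{0..n}. ?f i"] bexI[of _ "\<lambda>i\<in>{0..n}. ?g i"]) auto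
qed

lemma has_path_ex:
  assumes "\<rho> \<in> nondeg (sset_prod X Y) n"
  obtains p \<sigma> q \<tau> \<pi> where "has_path X Y n \<rho> p \<sigma> q \<tau> \<pi>"
proof -
  obtain x y where \<rho>: "\<rho> = (x, y)" "x \<in> simps X n" "y \<in> simps Y n"
    using P.nondegD[OF assms] by (auto simp: simps_sset_prod)
  obtain p f \<sigma> where 1: "\<sigma> \<in> nondeg X p" "mono_upto n p f" "f ` {0..n} = {0..p}" "x = pull X n p f \<sigma>"
    using X.nondeg_decomposition[OF \<rho>(2)] .
  obtain q g \<tau> where 2: "\<tau> \<in> nondeg Y q" "mono_upto n q g" "g ` {0..n} = {0..q}" "y = pull Y n q g \<tau>"
    using Y.nondeg_decomposition[OF \<rho>(3)] .
  have "has_path X Y n \<rho> p \<sigma> q \<tau> (map (\<lambda>i. ((\<lambda>i\<in>{0..n}. f i) i, (\<lambda>i\<in>{0..n}. g i) i)) [0..<Suc n])"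
    unfolding has_path_def using assms 1 2 \<rho>(1)
    by (intro conjI bexI[of _ "\<lambda>i\<in>{0..n}. f i"] bexI[of _ "\<lambda>i\<in>{0..n}. g i"]) (auto simp: pull_def)
  then show thesis by (rule that)
qed

text \<open>The source of both levels of the lexicographic measure. After omitting a vertex the
  coordinate maps may fail to be surjective, so the asymmetric \<open>pull_eq_nondeg\<close> is
  applied to them; if no dimension drops, the face merely deletes a point of the path.\<close>

lemma has_path_face:
  assumes \<rho>: "has_path X Y (Suc n) \<rho> p \<sigma> q \<tau> \<pi>" and i: "i \<le> Suc n"
    and \<rho>': "has_path X Y n (pull (sset_prod X Y) n (Suc n) (skip i) \<rho>) p' \<sigma>' q' \<tau>' \<pi>'"
  shows "p' \<le> p" "q' \<le> q" "p' + q' = p + q \<Longrightarrow> p' = p \<and> \<sigma>' = \<sigma> \<and> q' = q \<and> \<tau>' = \<tau> \<and> \<pi>' = delete_nth i \<pi>"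
proof -
  let ?f = "\<lambda>k. fst (\<pi> ! skip i k)" and ?g = "\<lambda>k. snd (\<pi> ! skip i k)"
  have \<sigma>: "\<sigma> \<in> nondeg X p" and \<tau>: "\<tau> \<in> nondeg Y q" and path: "lattice_path p q \<pi>"
    and len: "length \<pi> = Suc (Suc n)" and \<rho>_eq: "\<rho> = path_simplex X Y (Suc n) p \<sigma> q \<tau> \<pi>"
    using \<rho> by (auto simp: has_path_iff)
  have \<sigma>': "\<sigma>' \<in> nondeg X p'" and \<tau>': "\<tau>' \<in> nondeg Y q'" and path': "lattice_path p' q' \<pi>'"
    and len': "length \<pi>' = Suc n"
    and \<rho>'_eq: "pull (sset_prod X Y) n (Suc n) (skip i) \<rho> = path_simplex X Y n p' \<sigma>' q' \<tau>' \<pi>'"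
    using \<rho>' by (auto simp: has_path_iff)
  note surj = lattice_path_surj[OF path len] and surj' = lattice_path_surj[OF path' len']
  have sk: "mono_upto n (Suc n) (skip i)" using i by (rule mono_upto_skip)
  have fg: "mono_upto n p ?f" "mono_upto n q ?g"
    by (rule mono_upto_compose[OF surj(1) sk], rule mono_upto_compose[OF surj(3) sk])
  have eq: "pull X n p ?f \<sigma> = pull X n p' (\<lambda>k. fst (\<pi>' ! k)) \<sigma>'"
    "pull Y n q ?g \<tau> = pull Y n q' (\<lambda>k. snd (\<pi>' ! k)) \<tau>'"
    using \<rho>'_eq X.pull_pull[OF sk surj(1) X.nondegD[OF \<sigma>]] Y.pull_pull[OF sk surj(3) Y.nondegD[OF \<tau>]]
    by (auto simp: \<rho>_eq path_simplex_def pull_sset_prod)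
  note X = X.pull_eq_nondeg[OF fg(1) X.nondegD[OF \<sigma>] surj'(1,2) \<sigma>' eq(1)]
  note Y = Y.pull_eq_nondeg[OF fg(2) Y.nondegD[OF \<tau>] surj'(3,4) \<tau>' eq(2)]
  show "p' \<le> p" "q' \<le> q" by (rule X(1), rule Y(1))
  assume "p' + q' = p + q"
  then have pq: "p' = p" "q' = q" using X(1) Y(1) by auto
  have "\<pi>' = delete_nth i \<pi>"
    using X(3)[OF pq(1)] Y(3)[OF pq(2)] i
    by (intro nth_equalityI) (auto simp: len len' nth_delete_nth prod_eq_iff)
  then show "p' = p \<and> \<sigma>' = \<sigma> \<and> q' = q \<and> \<tau>' = \<tau> \<and> \<pi>' = delete_nth i \<pi>"
    using X(2) Y(2) pq by simp
qed

lemma has_path_unique: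
  assumes "has_path X Y n \<rho> p \<sigma> q \<tau> \<pi>" "has_path X Y n \<rho> p' \<sigma>' q' \<tau>' \<pi>'"
  shows "p' = p" "\<sigma>' = \<sigma>" "q' = q" "\<tau>' = \<tau>" "\<pi>' = \<pi>"
proof -
  have *: "\<sigma> \<in> nondeg X p" "\<tau> \<in> nondeg Y q" "lattice_path p q \<pi>" "length \<pi> = Suc n"
    "\<sigma>' \<in> nondeg X p'" "\<tau>' \<in> nondeg Y q'" "lattice_path p' q' \<pi>'" "length \<pi>' = Suc n"
    "path_simplex X Y n p \<sigma> q \<tau> \<pi> = path_simplex X Y n p' \<sigma>' q' \<tau>' \<pi>'"
    using assms by (auto simp: has_path_iff)
  note surj = lattice_path_surj[OF *(3,4)] and surj' = lattice_path_surj[OF *(7,8)]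
  have eq: "pull X n p (\<lambda>k. fst (\<pi> ! k)) \<sigma> = pull X n p' (\<lambda>k. fst (\<pi>' ! k)) \<sigma>'"
    "pull Y n q (\<lambda>k. snd (\<pi> ! k)) \<tau> = pull Y n q' (\<lambda>k. snd (\<pi>' ! k)) \<tau>'"
    using *(9) by (auto simp: path_simplex_def)
  note X = X.pull_eq_nondeg[OF surj(1) X.nondegD[OF *(1)] surj'(1,2) *(5) eq(1)]
    X.pull_eq_nondeg(1)[OF surj'(1) X.nondegD[OF *(5)] surj(1,2) *(1) eq(1)[symmetric]]
  note Y = Y.pull_eq_nondeg[OF surj(3) Y.nondegD[OF *(2)] surj'(3,4) *(6) eq(2)]
    Y.pull_eq_nondeg(1)[OF surj'(3) Y.nondegD[OF *(6)] surj(3,4) *(2) eq(2)[symmetric]]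
  show p: "p' = p" and q: "q' = q" using X(1,4) Y(1,4) by auto
  show "\<sigma>' = \<sigma>" "\<tau>' = \<tau>" using X(2) Y(2) p q by auto
  show "\<pi>' = \<pi>"
    using X(3)[OF p] Y(3)[OF q] by (intro nth_equalityI) (auto simp: *(4,8) prod_eq_iff)
qed

section \<open>The vector field on paths, regularity and the decreasing measure\<close>

lemma EZ_field_iff:
  "(\<rho>\<^sub>1, \<rho>\<^sub>2) \<in> V n \<longleftrightarrow> (\<exists>p \<sigma> q \<tau> \<pi> k. has_path X Y (Suc n) \<rho>\<^sub>2 p \<sigma> q \<tau> \<pi> \<and>
    first_event \<pi> k \<and> bend \<pi> k \<and> has_path X Y n \<rho>\<^sub>1 p \<sigma> q \<tau> (delete_nth k \<pi>))" (is "_ \<longleftrightarrow> ?R")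
proof
  assume "(\<rho>\<^sub>1, \<rho>\<^sub>2) \<in> V n"
  then show ?R unfolding EZ_field_def delete_nth_def by blast
next
  assume ?R
  then obtain p \<sigma> q \<tau> \<pi> k where *: "has_path X Y (Suc n) \<rho>\<^sub>2 p \<sigma> q \<tau> \<pi>" "first_event \<pi> k" "bend \<pi> k"
    "has_path X Y n \<rho>\<^sub>1 p \<sigma> q \<tau> (delete_nth k \<pi>)" by blast
  have "lattice_path p q \<pi>" using *(1) by (simp add: has_path_iff)
  then have "first_event (delete_nth k \<pi>) (k - 1) \<and> diag_step (delete_nth k \<pi>) (k - 1)"
    using *(2,3) delete_bend by blast
  with * show "(\<rho>\<^sub>1, \<rho>\<^sub>2) \<in> V n" unfolding EZ_field_def delete_nth_def by blast
qed

text \<open>\<open>insert_bend\<close> supplies the partner of a simplex of source type; in the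
  other direction \<open>has_path_unique\<close> identifies the path given by the pair with
  \<open>\<pi>\<close>.\<close>

lemma source_iff:
  assumes "has_path X Y n \<rho> p \<sigma> q \<tau> \<pi>"
  shows "\<rho> \<in> source_cells V n \<longleftrightarrow> (\<exists>k. first_event \<pi> k \<and> diag_step \<pi> k)"
proof
  assume "\<rho> \<in> source_cells V n"
  then obtain \<rho>\<^sub>2 where "(\<rho>, \<rho>\<^sub>2) \<in> V n" by (auto simp: source_cells_def)
  then obtain p' \<sigma>' q' \<tau>' \<pi>' k where *: "has_path X Y (Suc n) \<rho>\<^sub>2 p' \<sigma>' q' \<tau>' \<pi>'" "first_event \<pi>' k"
    "bend \<pi>' k" "has_path X Y n \<rho> p' \<sigma>' q' \<tau>' (delete_nth k \<pi>')"
    unfolding EZ_field_iff by blast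
  then have "lattice_path p' q' \<pi>'" by (simp add: has_path_iff)
  moreover have "delete_nth k \<pi>' = \<pi>" using has_path_unique(5)[OF assms *(4)] .
  ultimately show "\<exists>k. first_event \<pi> k \<and> diag_step \<pi> k" using *(2,3) delete_bend by blast
next
  assume "\<exists>k. first_event \<pi> k \<and> diag_step \<pi> k"
  then obtain j where j: "first_event \<pi> j" "diag_step \<pi> j" by blast
  have path: "lattice_path p q \<pi>" using assms by (simp add: has_path_iff)
  obtain \<pi>' where \<pi>': "lattice_path p q \<pi>'" "first_event \<pi>' (Suc j)" "bend \<pi>' (Suc j)"
    "delete_nth (Suc j) \<pi>' = \<pi>" "length \<pi>' = Suc (length \<pi>)"
    using insert_bend[OF path j] .
  have "has_path X Y (Suc n) (path_simplex X Y (Suc n) p \<sigma> q \<tau> \<pi>') p \<sigma> q \<tau> \<pi>'"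
    using assms \<pi>' by (simp add: has_path_iff)
  then have "(\<rho>, path_simplex X Y (Suc n) p \<sigma> q \<tau> \<pi>') \<in> V n"
    using \<pi>' assms unfolding EZ_field_iff by metis
  then show "\<rho> \<in> source_cells V n" by (force simp: source_cells_def)
qed

lemma target_iff:
  assumes "has_path X Y n \<rho> p \<sigma> q \<tau> \<pi>"
  shows "\<rho> \<in> target_cells V n \<longleftrightarrow> (\<exists>k. first_event \<pi> k \<and> bend \<pi> k)"
proof
  assume "\<rho> \<in> target_cells V n"
  then obtain m \<rho>\<^sub>1 where m: "n = Suc m" and "(\<rho>\<^sub>1, \<rho>) \<in> V m"
    by (auto simp: target_cells_def split: nat.splits)
  then show "\<exists>k. first_event \<pi> k \<and> bend \<pi> k"
    unfolding EZ_field_iff using has_path_unique(5)[OF assms] by blast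
next
  assume "\<exists>k. first_event \<pi> k \<and> bend \<pi> k"
  then obtain k where k: "first_event \<pi> k" "bend \<pi> k" by blast
  have path: "lattice_path p q \<pi>" and len: "length \<pi> = Suc n" using assms by (auto simp: has_path_iff)
  then obtain m where m: "n = Suc m" using k(2) by (cases n) (auto simp: bend_def)
  have "has_path X Y m (path_simplex X Y m p \<sigma> q \<tau> (delete_nth k \<pi>)) p \<sigma> q \<tau> (delete_nth k \<pi>)"
    using assms delete_bend(1)[OF path k] k(2) len by (simp add: has_path_iff m bend_def)
  then have "(path_simplex X Y m p \<sigma> q \<tau> (delete_nth k \<pi>), \<rho>) \<in> V m"
    using assms k unfolding EZ_field_iff m by blast
  then show "\<rho> \<in> target_cells V n" by (force simp: target_cells_def m)
qed

lemma lookup_bdry: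
  assumes "\<rho> \<in> nondeg (sset_prod X Y) (Suc n)" "\<rho>' \<in> nondeg (sset_prod X Y) n"
  shows "Poly_Mapping.lookup (bdry C (Suc n) (frag_of \<rho>)) \<rho>'
    = (\<Sum>i\<le>Suc n. if pull (sset_prod X Y) n (Suc n) (skip i) \<rho> = \<rho>' then (-1) ^ i else 0)"
  using assms
  by (auto simp: bdry_normalized bdry_gen_def lookup_sum gen_def simp del: sum.atMost_Suc
      intro!: sum.cong)

text \<open>Only the \<open>k\<close>-th face equals the source: any other face equal to it would
  lie over the same simplices and delete a different point with the same result. The incidence
  number is thus \<open>(-1) ^ k\<close>.\<close>

lemma EZ_pair_face:
  assumes "(\<rho>\<^sub>1, \<rho>\<^sub>2) \<in> V n"
  shows "regular_face C n \<rho>\<^sub>1 \<rho>\<^sub>2"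
proof -
  obtain p \<sigma> q \<tau> \<pi> k where *: "has_path X Y (Suc n) \<rho>\<^sub>2 p \<sigma> q \<tau> \<pi>" "first_event \<pi> k" "bend \<pi> k"
    "has_path X Y n \<rho>\<^sub>1 p \<sigma> q \<tau> (delete_nth k \<pi>)"
    using assms unfolding EZ_field_iff by blast
  have cells: "\<rho>\<^sub>1 \<in> nondeg (sset_prod X Y) n" "\<rho>\<^sub>2 \<in> nondeg (sset_prod X Y) (Suc n)"
    using * by (auto simp: has_path_def)
  have path: "lattice_path p q \<pi>" and len: "length \<pi> = Suc (Suc n)" using *(1) by (auto simp: has_path_iff)
  have k: "k \<le> Suc n" using *(3) len by (simp add: bend_def)
  let ?face = "\<lambda>i. pull (sset_prod X Y) n (Suc n) (skip i) \<rho>\<^sub>2"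
  have sk: "mono_upto n (Suc n) (skip k)" using k by (rule mono_upto_skip)
  have "?face k = \<rho>\<^sub>1"
    using *(1,4) X.pull_pull[OF sk lattice_path_surj(1)[OF path len]]
      Y.pull_pull[OF sk lattice_path_surj(3)[OF path len]] k X.nondegD Y.nondegD
    by (auto simp: has_path_iff path_simplex_def pull_sset_prod len nth_delete_nth intro!: pull_cong)
  moreover have "?face i \<noteq> \<rho>\<^sub>1" if "i \<le> Suc n" "i \<noteq> k" for i
  proof
    assume "?face i = \<rho>\<^sub>1"
    then have "delete_nth k \<pi> = delete_nth i \<pi>"
      using has_path_face(3)[OF *(1) that(1)] *(4) by simp
    then show False using delete_nth_inject[OF path] that k len by simp
  qed
  ultimately have "Poly_Mapping.lookup (bdry C (Suc n) (frag_of \<rho>\<^sub>2)) \<rho>\<^sub>1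
    = (\<Sum>i\<le>Suc n. if i = k then (-1) ^ i else 0)"
    unfolding lookup_bdry[OF cells(2,1)] by (intro sum.cong) auto
  also have "\<dots> = (-1) ^ k" using k by (subst sum.delta) auto
  finally show ?thesis using cells by (auto simp: regular_face_def) (metis neg_one_even_power neg_one_odd_power)
qed

lemma EZ_discrete_vector_field: "discrete_vector_field C V"
  unfolding discrete_vector_field_def
proof (intro conjI allI impI ballI)
  show "case z of (\<sigma>, \<tau>) \<Rightarrow> regular_face C n \<sigma> \<tau>" if "z \<in> V n" for n z
    using that EZ_pair_face by (cases z) auto
  show "\<tau> = \<tau>'" if a: "(\<rho>, \<tau>) \<in> V n \<and> (\<rho>, \<tau>') \<in> V n" for n \<rho> \<tau> \<tau>'
  proof -
    obtain p \<sigma> q t \<pi> k where *: "has_path X Y (Suc n) \<tau> p \<sigma> q t \<pi>" "first_event \<pi> k" "bend \<pi> k"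
      "has_path X Y n \<rho> p \<sigma> q t (delete_nth k \<pi>)"
      using a unfolding EZ_field_iff by blast
    obtain p' \<sigma>' q' t' \<pi>' k' where **: "has_path X Y (Suc n) \<tau>' p' \<sigma>' q' t' \<pi>'" "first_event \<pi>' k'" "bend \<pi>' k'"
      "has_path X Y n \<rho> p' \<sigma>' q' t' (delete_nth k' \<pi>')"
      using a unfolding EZ_field_iff by blast
    note u = has_path_unique[OF *(4) **(4)]
    have paths: "lattice_path p q \<pi>" "lattice_path p q \<pi>'" and len: "length \<pi> = Suc (Suc n)" "length \<pi>' = Suc (Suc n)"
      using *(1) **(1) u by (auto simp: has_path_iff)
    \<comment> \<open>The first event of the common source path locates both bends. The two target
      paths then agree away from \<open>k\<close>, and the bend point is determined by its
      predecessor.\<close>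
    have "k - 1 = k' - 1"
      using delete_bend(2)[OF paths(1) *(2,3)] delete_bend(2)[OF paths(2) **(2,3)] first_event_unique
      unfolding u(5) by blast
    then have k: "k' = k" using *(3) **(3) by (auto simp: bend_def)
    have bounds: "k < length \<pi>" "k < length \<pi>'" "0 < k" "k \<le> n"
      using *(3) len by (auto simp: bend_def)
    have away: "\<pi> ! skip k i = \<pi>' ! skip k i" if "i \<le> n" for i
      using nth_delete_nth[of k \<pi> i] nth_delete_nth[of k \<pi>' i] that bounds u(5) len by (simp add: k)
    have "\<pi> ! (k - 1) = \<pi>' ! (k - 1)" using away[of "k - 1"] bounds by (simp add: skip_def)
    then have at: "\<pi> ! k = \<pi>' ! k" using *(3) **(3) k by (simp add: bend_def)
    have "\<pi> ! i = \<pi>' ! i" if "i \<le> Suc n" for i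
    proof (cases i k rule: linorder_cases)
      case less
      then show ?thesis using away[of i] bounds by (simp add: skip_def)
    next
      case greater
      then show ?thesis using away[of "i - 1"] that by (cases i) (auto simp: skip_def)
    qed (use at in simp)
    then have "\<pi> = \<pi>'" using len by (intro nth_equalityI) auto
    then show "\<tau> = \<tau>'" using *(1) **(1) u by (simp add: has_path_iff)
  qed
  show "\<rho> = \<rho>'" if a: "(\<rho>, \<tau>) \<in> V n \<and> (\<rho>', \<tau>) \<in> V n" for n \<rho> \<rho>' \<tau>
  proof -
    obtain p \<sigma> q t \<pi> k where *: "has_path X Y (Suc n) \<tau> p \<sigma> q t \<pi>" "first_event \<pi> k" "bend \<pi> k"
      "has_path X Y n \<rho> p \<sigma> q t (delete_nth k \<pi>)"
      using a unfolding EZ_field_iff by blast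
    obtain p' \<sigma>' q' t' \<pi>' k' where **: "has_path X Y (Suc n) \<tau> p' \<sigma>' q' t' \<pi>'" "first_event \<pi>' k'" "bend \<pi>' k'"
      "has_path X Y n \<rho>' p' \<sigma>' q' t' (delete_nth k' \<pi>')"
      using a unfolding EZ_field_iff by blast
    note u = has_path_unique[OF *(1) **(1)]
    have "k' = k" using first_event_unique *(2) **(2) u by blast
    then show "\<rho> = \<rho>'" using *(4) **(4) u by (simp add: has_path_iff)
  qed
  show "\<not> ((\<rho>, x) \<in> V n \<and> (x, \<tau>) \<in> V (Suc n))" for n \<rho> x \<tau>
  proof
    assume a: "(\<rho>, x) \<in> V n \<and> (x, \<tau>) \<in> V (Suc n)"
    then have "x \<in> target_cells V (Suc n)" "x \<in> source_cells V (Suc n)"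
      by (force simp: target_cells_def source_cells_def)+
    moreover obtain p \<sigma> q t \<pi> where "has_path X Y (Suc n) x p \<sigma> q t \<pi>"
      using a unfolding EZ_field_iff by blast
    ultimately show False
      using source_iff target_iff first_event_unique not_diag_step_bend by metis
  qed
qed

text \<open>The factor of \<open>p + q\<close> exceeds the weight of every path of length \<open>n\<close>, so the order is lexicographic.\<close>

definition EZ_measure :: "nat \<Rightarrow> 'a \<times> 'b \<Rightarrow> nat" where
  "EZ_measure n \<rho> = (THE m. \<exists>p \<sigma> q \<tau> \<pi>. has_path X Y n \<rho> p \<sigma> q \<tau> \<pi> \<and>
    m = (p + q) * Suc (Suc n * (2 * n)) + path_weight q \<pi>)"

lemma EZ_measure_eq:
  assumes "has_path X Y n \<rho> p \<sigma> q \<tau> \<pi>"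
  shows "EZ_measure n \<rho> = (p + q) * Suc (Suc n * (2 * n)) + path_weight q \<pi>"
  unfolding EZ_measure_def
proof (rule the_equality)
  fix m assume "\<exists>p \<sigma> q \<tau> \<pi>. has_path X Y n \<rho> p \<sigma> q \<tau> \<pi> \<and>
    m = (p + q) * Suc (Suc n * (2 * n)) + path_weight q \<pi>"
  then obtain p' \<sigma>' q' \<tau>' \<pi>' where *: "has_path X Y n \<rho> p' \<sigma>' q' \<tau>' \<pi>'"
    and m: "m = (p' + q') * Suc (Suc n * (2 * n)) + path_weight q' \<pi>'" by blast
  show "m = (p + q) * Suc (Suc n * (2 * n)) + path_weight q \<pi>"
    unfolding m using has_path_unique[OF assms *] by simp
qed (use assms in blast)

text \<open>Counting the values of each coordinate gives \<open>p \<le> n\<close> and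
  \<open>q \<le> n\<close>, whence the constant \<open>2 * n\<close> in the measure.\<close>

lemma path_weight_le:
  assumes "has_path X Y n \<rho> p \<sigma> q \<tau> \<pi>"
  shows "path_weight q \<pi> \<le> Suc n * (2 * n)"
proof -
  have path: "lattice_path p q \<pi>" and len: "length \<pi> = Suc n" using assms by (auto simp: has_path_iff)
  have "p \<le> n" "q \<le> n"
    using card_image_le[of "{0..n}" "\<lambda>i. fst (\<pi> ! i)"] card_image_le[of "{0..n}" "\<lambda>i. snd (\<pi> ! i)"]
    by (simp_all add: lattice_path_surj[OF path len])
  have "path_weight q \<pi> \<le> Suc n * (p + q)" using path_weight_bound[OF path] len by simp
  also have "\<dots> \<le> Suc n * (2 * n)" using \<open>p \<le> n\<close> \<open>q \<le> n\<close> by (intro mult_le_mono) auto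
  finally show ?thesis .
qed

lemma EZ_measure_decrease:
  assumes pair: "(\<rho>\<^sub>1, \<rho>\<^sub>2) \<in> V n" and pair': "(\<rho>, \<rho>') \<in> V n"
    and face: "face C n \<rho> \<rho>\<^sub>2" and ne: "\<rho> \<noteq> \<rho>\<^sub>1"
  shows "EZ_measure n \<rho> < EZ_measure n \<rho>\<^sub>1"
proof -
  obtain p \<sigma> q \<tau> \<pi> k where *: "has_path X Y (Suc n) \<rho>\<^sub>2 p \<sigma> q \<tau> \<pi>" "first_event \<pi> k" "bend \<pi> k"
    "has_path X Y n \<rho>\<^sub>1 p \<sigma> q \<tau> (delete_nth k \<pi>)"
    using pair unfolding EZ_field_iff by blast
  have path: "lattice_path p q \<pi>" and len: "length \<pi> = Suc (Suc n)" using *(1) by (auto simp: has_path_iff)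
  obtain p' \<sigma>' q' \<tau>' \<pi>' where **: "has_path X Y n \<rho> p' \<sigma>' q' \<tau>' \<pi>'"
    using pair' unfolding EZ_field_iff by blast
  have cells: "\<rho>\<^sub>2 \<in> nondeg (sset_prod X Y) (Suc n)" "\<rho> \<in> nondeg (sset_prod X Y) n"
    using *(1) ** by (auto simp: has_path_def)
  have "\<exists>i\<le>Suc n. pull (sset_prod X Y) n (Suc n) (skip i) \<rho>\<^sub>2 = \<rho>"
  proof (rule ccontr)
    assume no: "\<not> ?thesis"
    have "Poly_Mapping.lookup (bdry C (Suc n) (frag_of \<rho>\<^sub>2)) \<rho> = 0"
      unfolding lookup_bdry[OF cells] using no by (intro sum.neutral) auto
    then show False using face by (simp add: face_def)
  qed
  then obtain i where i: "i \<le> Suc n" "pull (sset_prod X Y) n (Suc n) (skip i) \<rho>\<^sub>2 = \<rho>" by blast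
  note f = has_path_face[OF *(1) i(1), of p' \<sigma>' q' \<tau>' \<pi>', unfolded i(2), OF **]
  let ?B = "Suc (Suc n * (2 * n))"
  show ?thesis
  proof (cases "p' + q' = p + q")
    case True
    note f = f(3)[OF True]
    have "i \<noteq> k" using ne f *(4) ** by (auto simp: has_path_iff)
    \<comment> \<open>The weight comparison concerns deletions that leave a source path; that \<rho>
      is the source of a pair guarantees this.\<close>
    have "\<rho> \<in> source_cells V n" using pair' by (force simp: source_cells_def)
    then obtain j where "first_event \<pi>' j" "diag_step \<pi>' j" using source_iff[OF **] by blast
    then have "path_weight q \<pi>' < path_weight q (delete_nth k \<pi>)"
      using path_weight_decrease[OF path *(2,3), of i j] f i(1) len \<open>i \<noteq> k\<close> by auto
    then show ?thesis using EZ_measure_eq[OF **] EZ_measure_eq[OF *(4)] f by simp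
  next
    case False
    then have "Suc (p' + q') \<le> p + q" using f(1,2) by simp
    then have "Suc (p' + q') * ?B \<le> (p + q) * ?B" by (rule mult_le_mono1)
    moreover have "path_weight q' \<pi>' < ?B" using path_weight_le[OF **] by simp
    ultimately show ?thesis using EZ_measure_eq[OF **] EZ_measure_eq[OF *(4)] by simp
  qed
qed

sublocale M: measured_field C V EZ_measure
  by unfold_locales
    (use P.chain_complex_normalized EZ_discrete_vector_field EZ_measure_decrease in auto)

sublocale W: invertible_field C V
  by unfold_locales (rule P.chain_complex_normalized EZ_discrete_vector_field M.d21_invertible)+

section \<open>Critical simplices and generators of the tensor product\<close>

lemma EZ_critical_eq_path_simplex:
  assumes "lattice_path p q \<pi>" "\<And>k. \<not> diag_step \<pi> k" "\<And>k. \<not> bend \<pi> k"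
  shows "path_simplex X Y (p + q) p \<sigma> q \<tau> \<pi> = EZ_critical X Y ((p, \<sigma>), (q, \<tau>))"
  using path_without_events[OF assms]
  by (auto simp: path_simplex_def EZ_critical.simps pull_def[symmetric] intro!: pull_cong)

lemma critical_path:
  fixes p q :: nat
  defines "\<pi> \<equiv> map (\<lambda>i. (min i p, i - p)) [0..<Suc (p + q)]"
  shows "lattice_path p q \<pi>" "\<not> diag_step \<pi> k" "\<not> bend \<pi> k" "length \<pi> = Suc (p + q)"
proof -
  have nth: "\<pi> ! i = (min i p, i - p)" if "i \<le> p + q" for i
    using that by (simp add: \<pi>_def del: upt_Suc)
  show len: "length \<pi> = Suc (p + q)" by (simp add: \<pi>_def)
  then have "\<pi> \<noteq> []" by auto
  then show "lattice_path p q \<pi>" unfolding lattice_path_def len by (auto simp: nth)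
  show "\<not> diag_step \<pi> k" unfolding diag_step_def len by (auto simp: nth)
  show "\<not> bend \<pi> k" unfolding bend_def len by (auto simp: nth)
qed

lemma has_path_critical:
  assumes "\<sigma> \<in> nondeg X p" "\<tau> \<in> nondeg Y q"
  obtains \<pi> where "has_path X Y (p + q) (EZ_critical X Y ((p, \<sigma>), (q, \<tau>))) p \<sigma> q \<tau> \<pi>"
    "\<And>k. \<not> diag_step \<pi> k" "\<And>k. \<not> bend \<pi> k"
  using that assms critical_path[where p = p and q = q]
    EZ_critical_eq_path_simplex[OF critical_path(1), of p q, OF critical_path(2,3)]
  unfolding has_path_iff by metis

abbreviation "T \<equiv> tensor_complex (normalized_complex X) (normalized_complex Y)"

lemma cells_T: "cells T n = {((p, \<sigma>), (q, \<tau>)) | p \<sigma> q \<tau>. p + q = n \<and> \<sigma> \<in> nondeg X p \<and> \<tau> \<in> nondeg Y q}"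
  by (simp add: tensor_complex_def)

text \<open>Injectivity is uniqueness of the path data; surjectivity holds because a path without
  events has only one shape.\<close>

lemma EZ_critical_bij: "bij_betw (EZ_critical X Y) (cells T n) (critical_cells C V n)"
  unfolding bij_betw_def
proof
  show "inj_on (EZ_critical X Y) (cells T n)"
  proof (rule inj_onI)
    fix a b assume ab: "a \<in> cells T n" "b \<in> cells T n" "EZ_critical X Y a = EZ_critical X Y b"
    obtain p \<sigma> q \<tau> where a: "a = ((p, \<sigma>), (q, \<tau>))" "p + q = n" "\<sigma> \<in> nondeg X p" "\<tau> \<in> nondeg Y q"
      using ab(1) by (auto simp: cells_T)
    obtain p' \<sigma>' q' \<tau>' where b: "b = ((p', \<sigma>'), (q', \<tau>'))" "p' + q' = n" "\<sigma>' \<in> nondeg X p'" "\<tau>' \<in> nondeg Y q'"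
      using ab(2) by (auto simp: cells_T)
    show "a = b"
      using has_path_critical[OF a(3,4)] has_path_critical[OF b(3,4)] ab(3) has_path_unique
      unfolding a b by (metis a(2) b(1,2))
  qed
  show "EZ_critical X Y ` cells T n = critical_cells C V n"
  proof
    show "EZ_critical X Y ` cells T n \<subseteq> critical_cells C V n"
    proof
      fix \<rho> assume "\<rho> \<in> EZ_critical X Y ` cells T n"
      then obtain p \<sigma> q \<tau> where a: "\<rho> = EZ_critical X Y ((p, \<sigma>), (q, \<tau>))" "p + q = n" "\<sigma> \<in> nondeg X p" "\<tau> \<in> nondeg Y q"
        by (auto simp: cells_T simp del: EZ_critical.simps)
      obtain \<pi> where \<pi>: "has_path X Y n \<rho> p \<sigma> q \<tau> \<pi>" "\<And>k. \<not> diag_step \<pi> k" "\<And>k. \<not> bend \<pi> k"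
        using has_path_critical[OF a(3,4)] a(1,2) by metis
      then show "\<rho> \<in> critical_cells C V n"
        using source_iff[OF \<pi>(1)] target_iff[OF \<pi>(1)] by (auto simp: critical_cells_def has_path_def)
    qed
    show "critical_cells C V n \<subseteq> EZ_critical X Y ` cells T n"
    proof
      fix \<rho> assume \<rho>: "\<rho> \<in> critical_cells C V n"
      then have "\<rho> \<in> nondeg (sset_prod X Y) n" by (simp add: critical_cells_def)
      then obtain p \<sigma> q \<tau> \<pi> where \<pi>: "has_path X Y n \<rho> p \<sigma> q \<tau> \<pi>" by (rule has_path_ex)
      then have path: "lattice_path p q \<pi>" "length \<pi> = Suc n" by (auto simp: has_path_iff)
      have none: "\<not> diag_step \<pi> k" "\<not> bend \<pi> k" for k
        using \<rho> source_iff[OF \<pi>] target_iff[OF \<pi>] first_event_cases[of \<pi>]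
        by (auto simp: critical_cells_def)
      have "p + q = n" using path_without_events(1)[OF path(1) none] path(2) by simp
      moreover from this have "\<rho> = EZ_critical X Y ((p, \<sigma>), (q, \<tau>))"
        using \<pi> EZ_critical_eq_path_simplex[OF path(1) none] by (simp add: has_path_iff)
      ultimately show "\<rho> \<in> EZ_critical X Y ` cells T n"
        using \<pi> unfolding cells_T has_path_iff by blast
    qed
  qed
qed

end

section \<open>The Alexander-Whitney map\<close>

lemma frag_extend_0_fun: "frag_extend (\<lambda>x. 0) a = 0"
  by (simp add: frag_extend_eq_0)

lemma frag_cmul_diff: "frag_cmul k (a - b) = frag_cmul k a - frag_cmul k b"
  by (rule poly_mapping_eqI) (simp add: lookup_minus right_diff_distrib)

lemma frag_extend_add_fun:
  "frag_extend (\<lambda>x. f x + g x) a = frag_extend f a + frag_extend g a"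
  by (simp add: frag_extend_def sum.distrib frag_cmul_distrib2)

lemma frag_extend_cmul_fun:
  "frag_extend (\<lambda>x. frag_cmul k (f x)) a = frag_cmul k (frag_extend f a)"
  by (simp add: frag_extend_def frag_cmul_sum mult.commute)

lemma tensor_chain_of: "tensor_chain p q (frag_of \<sigma>) (frag_of \<tau>) = frag_of ((p, \<sigma>), (q, \<tau>))"
  by (simp add: tensor_chain_def)

lemma tensor_chain_0 [simp]: "tensor_chain p q 0 b = 0" "tensor_chain p q a 0 = 0"
  by (simp_all add: tensor_chain_def frag_extend_0_fun)

lemma tensor_chain_add:
  "tensor_chain p q (a + a') b = tensor_chain p q a b + tensor_chain p q a' b"
  "tensor_chain p q a (b + b') = tensor_chain p q a b + tensor_chain p q a b'"
  by (simp_all add: tensor_chain_def frag_extend_add frag_extend_add_fun)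

lemma tensor_chain_cmul:
  "tensor_chain p q (frag_cmul k a) b = frag_cmul k (tensor_chain p q a b)"
  "tensor_chain p q a (frag_cmul k b) = frag_cmul k (tensor_chain p q a b)"
  by (simp_all add: tensor_chain_def frag_extend_cmul frag_extend_cmul_fun)

lemma tensor_chain_diff:
  "tensor_chain p q (a - a') b = tensor_chain p q a b - tensor_chain p q a' b"
  "tensor_chain p q a (b - b') = tensor_chain p q a b - tensor_chain p q a b'"
  by (metis tensor_chain_add(1) add_diff_cancel_right' diff_add_cancel,
      metis tensor_chain_add(2) add_diff_cancel_right' diff_add_cancel)

lemma tensor_chain_sum:
  "tensor_chain p q (sum f I) b = (\<Sum>i\<in>I. tensor_chain p q (f i) b)"
  "tensor_chain p q a (sum g I) = (\<Sum>i\<in>I. tensor_chain p q a (g i))"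
  by (induction I rule: infinite_finite_induct) (simp_all add: tensor_chain_add)

lemma tensor_chain_in:
  assumes "a \<in> free_span A" "b \<in> free_span B"
  shows "tensor_chain p q a b \<in> free_span {((p, \<sigma>), (q, \<tau>)) | \<sigma> \<tau>. \<sigma> \<in> A \<and> \<tau> \<in> B}"
  unfolding tensor_chain_def using assms by (intro free_span_extend[of _ A] free_span_extend[of _ B]) auto

lemma sum_atMost_split:
  "sum f {..i + Suc r} = sum f {..i} + (\<Sum>l\<le>r. f (Suc (i + l)))" for f :: "nat \<Rightarrow> 'a::comm_monoid_add"
  by (induction r) (simp_all add: add.assoc)

lemma bdry_normalized_0: "bdry (normalized_complex X) 0 c = 0"
  by (simp add: normalized_complex_def)

text \<open>Front face on the vertices \<open>0\<close> to \<open>i\<close> of the first component,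
  tensored with the back face on the vertices \<open>i\<close> to \<open>n\<close> of the second;
  \<open>gen\<close> discards degenerate faces.\<close>

definition AW_term :: "'a sset \<Rightarrow> 'b sset \<Rightarrow> nat \<Rightarrow> 'a \<times> 'b \<Rightarrow> nat \<Rightarrow> ((nat \<times> 'a) \<times> nat \<times> 'b) \<Rightarrow>\<^sub>0 int" where
  "AW_term X Y n \<rho> i = tensor_chain i (n - i)
    (gen X i (pull X i n (\<lambda>k. k) (fst \<rho>))) (gen Y (n - i) (pull Y (n - i) n (\<lambda>k. i + k) (snd \<rho>)))"

definition AW :: "'a sset \<Rightarrow> 'b sset \<Rightarrow> nat \<Rightarrow> ('a \<times> 'b \<Rightarrow>\<^sub>0 int) \<Rightarrow> ((nat \<times> 'a) \<times> nat \<times> 'b) \<Rightarrow>\<^sub>0 int" where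
  "AW X Y n = frag_extend (\<lambda>\<rho>. sum (AW_term X Y n \<rho>) {..n})"

context sset_pair
begin

text \<open>The Leibniz rule, checked on generators and extended bilinearly. The degree
  \<open>n\<close> is free because the boundary reads \<open>p\<close> and \<open>q\<close> from the
  generators.\<close>

lemma bdry_tensor:
  "bdry T n (tensor_chain p q a b) =
    tensor_chain (p - 1) q (bdry (normalized_complex X) p a) b +
    frag_cmul ((-1) ^ p) (tensor_chain p (q - 1) a (bdry (normalized_complex Y) q b))"
proof -
  have a: "a \<in> free_span UNIV" and b: "b \<in> free_span UNIV" by (auto simp: free_span_def)
  from a show ?thesis
  proof (induction rule: free_span_induct)
    case zero
    then show ?case by (simp add: tensor_complex_def bdry_normalized)
  next
    case (one \<sigma>)
    from b show ?case
    proof (induction rule: free_span_induct)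
      case zero
      then show ?case by (simp add: tensor_complex_def bdry_normalized)
    next
      case (one \<tau>)
      then show ?case by (simp add: tensor_chain_of) (simp add: tensor_complex_def)
    next
      case (diff b b')
      then show ?case
        by (simp add: tensor_complex_def tensor_chain_diff bdry_normalized frag_extend_diff
            frag_cmul_diff)
    qed
  next
    case (diff a a')
    from diff.IH show ?case
      by (simp add: tensor_complex_def tensor_chain_diff bdry_normalized frag_extend_diff
          frag_cmul_diff)
  qed
qed

lemma bdry_T_extend: "bdry T n (sum f I) = (\<Sum>i\<in>I. bdry T n (f i))"
  by (induction I rule: infinite_finite_induct) (simp_all add: tensor_complex_def frag_extend_add)

lemma mono_front: "i \<le> n \<Longrightarrow> mono_upto i n (\<lambda>k. k)"
  by (simp add: mono_upto_def)

lemma mono_back: "i \<le> n \<Longrightarrow> mono_upto (n - i) n (\<lambda>k. i + k)"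
  by (auto simp: mono_upto_def)

text \<open>A repetition before \<open>i\<close> makes the front face degenerate, one from
  \<open>i\<close> on the back face. This single criterion handles degenerate simplices, targets,
  and the wrong splittings of a critical simplex.\<close>

lemma AW_term_pull_eq_0:
  assumes x: "x \<in> simps X p" and y: "y \<in> simps Y q"
    and f: "mono_upto n p f" and g: "mono_upto n q g" and i: "i \<le> n"
    and ex: "(\<exists>k<i. f k = f (Suc k)) \<or> (\<exists>k<n. i \<le> k \<and> g k = g (Suc k))"
  shows "AW_term X Y n (pull X n p f x, pull Y n q g y) i = 0"
  using ex
proof (elim disjE exE conjE)
  fix k assume "k < i" "f k = f (Suc k)"
  then show ?thesis
    using X.pull_not_nondeg[OF mono_upto_compose[OF f mono_front[OF i]] x]
    by (simp add: AW_term_def X.pull_pull[OF mono_front[OF i] f x] gen_def)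
next
  fix k assume k: "k < n" "i \<le> k" "g k = g (Suc k)"
  then show ?thesis
    using Y.pull_not_nondeg[OF mono_upto_compose[OF g mono_back[OF i]] y, of "k - i"]
    by (simp add: AW_term_def Y.pull_pull[OF mono_back[OF i] g y] gen_def)
qed

text \<open>Makes the formula available for the faces in a boundary, which may be degenerate. Both
  components then repeat at a common \<open>j\<close>, and for each \<open>i\<close> this repetition
  falls into the front or into the back face.\<close>

lemma AW_gen:
  assumes \<rho>: "\<rho> \<in> simps (sset_prod X Y) n"
  shows "AW X Y n (gen (sset_prod X Y) n \<rho>) = sum (AW_term X Y n \<rho>) {..n}"
proof (cases "\<rho> \<in> nondeg (sset_prod X Y) n")
  case False
  obtain x y where xy: "\<rho> = (x, y)" "x \<in> simps X n" "y \<in> simps Y n"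
    using \<rho> by (auto simp: simps_sset_prod)
  obtain j where j: "j < n" "pull X n n (stutter j) x = x" "pull Y n n (stutter j) y = y"
    using False P.degenerate_iff_stutter[OF \<rho>] by (auto simp: xy(1) pull_sset_prod)
  have "AW_term X Y n \<rho> i = 0" if i: "i \<le> n" for i
  proof -
    have "AW_term X Y n (pull X n n (stutter j) x, pull Y n n (stutter j) y) i = 0"
      using j(1) by (intro AW_term_pull_eq_0 xy mono_upto_stutter i)
        (auto simp: stutter_def intro!: exI[of _ j])
    then show ?thesis by (simp add: j(2,3) xy(1))
  qed
  then show ?thesis using False by (simp add: gen_def AW_def)
qed (simp add: gen_def AW_def)

text \<open>Terms are collected by bidegree \<open>(i, m - i)\<close>, to which the front boundary
  of the splitting at \<open>Suc i\<close> (\<open>L (Suc i)\<close>) and the back boundary of the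
  splitting at \<open>i\<close> (\<open>R i\<close>) contribute. The last front face and the first
  back face both give \<open>F i\<close> tensor \<open>B (Suc i)\<close>, with opposite signs. The
  others are the terms \<open>a i j\<close>: those with \<open>j \<le> i\<close> come from the
  front, those with \<open>j > i\<close> from the back.\<close>

lemma bdry_AW_terms:
  assumes x: "x \<in> simps X (Suc m)" and y: "y \<in> simps Y (Suc m)"
  shows "bdry T (Suc m) (sum (AW_term X Y (Suc m) (x, y)) {..Suc m})
    = (\<Sum>j\<le>Suc m. frag_cmul ((-1) ^ j)
        (sum (AW_term X Y m (pull (sset_prod X Y) m (Suc m) (skip j) (x, y))) {..m}))"
proof -
  let ?NX = "normalized_complex X" and ?NY = "normalized_complex Y"
  let ?n = "Suc m"
  define F where "F i = gen X i (pull X i ?n (\<lambda>k. k) x)" for i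
  define B where "B i = gen Y (?n - i) (pull Y (?n - i) ?n (\<lambda>k. i + k) y)" for i
  define G where "G i j = gen X i (pull X i ?n (skip j) x)" for i j
  define H where "H i j = gen Y (m - i) (pull Y (m - i) ?n (\<lambda>k. skip j (i + k)) y)" for i j
  define a where "a i j = frag_cmul ((-1) ^ j) (tensor_chain i (m - i) (G i j) (H i j))" for i j
  define L where "L i = tensor_chain (i - 1) (?n - i) (bdry ?NX i (F i)) (B i)" for i
  define R where "R i = frag_cmul ((-1) ^ i) (tensor_chain i (?n - i - 1) (F i) (bdry ?NY (?n - i) (B i)))" for i
  have G_gt: "G i j = F i" if "i < j" for i j
    using that unfolding G_def F_def by (intro arg_cong[of _ _ "gen X i"] pull_cong) (auto simp: skip_def)
  have H_le: "H i j = B (Suc i)" if "j \<le> i" for i j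
    using that unfolding H_def B_def diff_Suc_Suc
    by (intro arg_cong[of _ _ "gen Y (m - i)"] pull_cong) (auto simp: skip_def)
  have dF: "bdry ?NX (Suc i) (F (Suc i)) = (\<Sum>j\<le>Suc i. frag_cmul ((-1) ^ j) (G i j))" if "i \<le> m" for i
    using that x X.pull_pull[OF mono_upto_skip mono_front[of "Suc i" ?n] x]
    unfolding F_def G_def
    by (subst X.bdry_of_gen) (auto simp: bdry_gen_def simp del: sum.atMost_Suc
        intro!: X.pull_in mono_front sum.cong)
  have dB: "bdry ?NY (Suc (m - i)) (B i) = (\<Sum>l\<le>Suc (m - i). frag_cmul ((-1) ^ l) (H i (i + l)))" if i: "i \<le> m" for i
  proof -
    have eq: "?n - i = Suc (m - i)" using i by simp
    have "pull Y (m - i) (Suc (m - i)) (skip l) (pull Y (Suc (m - i)) ?n (\<lambda>k. i + k) y)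
      = pull Y (m - i) ?n (\<lambda>k. skip (i + l) (i + k)) y" if "l \<le> Suc (m - i)" for l
      using Y.pull_pull[OF mono_upto_skip[OF that] mono_back[of i ?n, unfolded eq] y] i
      by (simp add: skip_def if_distrib[of "(+) i"] cong: if_cong)
    moreover have "mono_upto (Suc (m - i)) ?n (\<lambda>k. i + k)" using mono_back[of i ?n] i by (simp add: eq)
    ultimately show ?thesis
      unfolding B_def H_def eq
      by (subst Y.bdry_of_gen) (auto simp: bdry_gen_def y simp del: sum.atMost_Suc
          intro!: Y.pull_in sum.cong)
  qed
  have column: "L (Suc i) + R i = (\<Sum>j\<le>?n. a i j)" if i: "i \<le> m" for i
  proof -
    let ?t = "tensor_chain i (m - i)" and ?c = "\<lambda>k. frag_cmul ((-1) ^ k)"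
    have "L (Suc i) = (\<Sum>j\<le>i. a i j) + ?c (Suc i) (?t (F i) (B (Suc i)))"
      using i by (simp add: L_def dF tensor_chain_sum tensor_chain_cmul tensor_chain_add G_gt a_def H_le
          del: power_Suc)
    moreover have "R i = ?c i (?t (F i) (B (Suc i))) + (\<Sum>l\<le>m - i. a i (Suc (i + l)))"
    proof -
      have n: "?n - i = Suc (m - i)" using i by simp
      have "R i = (\<Sum>l\<le>Suc (m - i). ?c (i + l) (?t (F i) (H i (i + l))))"
        unfolding R_def n
        by (simp add: dB[OF i] tensor_chain_sum tensor_chain_cmul frag_cmul_sum power_add
            del: sum.atMost_Suc)
      then show ?thesis
        by (subst (asm) sum.atMost_Suc_shift) (simp add: H_le a_def G_gt del: power_Suc)
    qed
    moreover have "?c (Suc i) z + ?c i z = 0" for z :: "((nat \<times> 'a) \<times> nat \<times> 'b) \<Rightarrow>\<^sub>0 int"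
      by (simp flip: frag_cmul_distrib)
    then have "?c (Suc i) z + (?c i z + w) = w" for z w :: "((nat \<times> 'a) \<times> nat \<times> 'b) \<Rightarrow>\<^sub>0 int"
      by (simp only: add.assoc[symmetric] add_0_left)
    moreover have "(\<Sum>j\<le>?n. a i j) = (\<Sum>j\<le>i. a i j) + (\<Sum>l\<le>m - i. a i (Suc (i + l)))"
      using sum_atMost_split[of "a i" i "m - i"] i by (simp del: sum.atMost_Suc)
    ultimately show ?thesis by (simp only: add.assoc)
  qed
  have "bdry T ?n (sum (AW_term X Y ?n (x, y)) {..?n}) = (\<Sum>i\<le>?n. L i + R i)"
    unfolding bdry_T_extend by (intro sum.cong refl) (simp add: AW_term_def bdry_tensor L_def R_def F_def B_def)
  also have "\<dots> = (\<Sum>i\<le>?n. L i) + (\<Sum>i\<le>?n. R i)" by (rule sum.distrib)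
  \<comment> \<open>The end terms \<open>L 0\<close> and \<open>R (Suc m)\<close> contain boundaries
    taken in degree 0 and drop out.\<close>
  also have "(\<Sum>i\<le>?n. L i) = (\<Sum>i\<le>m. L (Suc i))"
    by (subst sum.atMost_Suc_shift) (simp add: L_def bdry_normalized_0)
  also have "(\<Sum>i\<le>?n. R i) = (\<Sum>i\<le>m. R i)"
    by (simp add: R_def bdry_normalized_0)
  also have "(\<Sum>i\<le>m. L (Suc i)) + (\<Sum>i\<le>m. R i) = (\<Sum>i\<le>m. \<Sum>j\<le>?n. a i j)"
    by (simp only: sum.distrib[symmetric]) (intro sum.cong refl, simp add: column del: sum.atMost_Suc)
  also have "\<dots> = (\<Sum>j\<le>?n. \<Sum>i\<le>m. a i j)" by (rule sum.swap)
  also have "\<dots> = (\<Sum>j\<le>?n. frag_cmul ((-1) ^ j)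
        (sum (AW_term X Y m (pull (sset_prod X Y) m ?n (skip j) (x, y))) {..m}))"
  proof (intro sum.cong refl)
    fix j assume j: "j \<in> {..?n}"
    have "a i j = frag_cmul ((-1) ^ j) (AW_term X Y m (pull (sset_prod X Y) m ?n (skip j) (x, y)) i)"
      if "i \<le> m" for i
      using j X.pull_pull[OF mono_front[OF that] mono_upto_skip x] Y.pull_pull[OF mono_back[OF that] mono_upto_skip y]
      by (simp add: a_def AW_term_def pull_sset_prod G_def H_def)
    then show "(\<Sum>i\<le>m. a i j) = frag_cmul ((-1) ^ j)
        (sum (AW_term X Y m (pull (sset_prod X Y) m ?n (skip j) (x, y))) {..m})"
      by (simp add: frag_cmul_sum)
  qed
  finally show ?thesis .
qed

lemma AW_chain_map:
  assumes "c \<in> chain_group C (Suc m)"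
  shows "bdry T (Suc m) (AW X Y (Suc m) c) = AW X Y m (bdry C (Suc m) c)"
  using assms
proof (induction rule: free_span_induct)
  case (one \<rho>)
  let ?P = "sset_prod X Y" and ?c = "\<lambda>j. frag_cmul ((-1) ^ j)"
  have \<rho>: "\<rho> \<in> nondeg ?P (Suc m)" using one by simp
  have simps: "\<rho> \<in> simps ?P (Suc m)" using P.nondegD[OF \<rho>] .
  have "AW X Y m (bdry C (Suc m) (frag_of \<rho>))
    = (\<Sum>j\<le>Suc m. ?c j (AW X Y m (gen ?P m (pull ?P m (Suc m) (skip j) \<rho>))))"
    by (simp add: bdry_normalized bdry_gen_def AW_def frag_extend_sum frag_extend_cmul o_def
        frag_extend_add del: sum.atMost_Suc)
  also have "\<dots> = (\<Sum>j\<le>Suc m. ?c j (sum (AW_term X Y m (pull ?P m (Suc m) (skip j) \<rho>)) {..m}))"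
    using simps by (intro sum.cong refl arg_cong[of _ _ "?c _"] AW_gen P.pull_in mono_upto_skip) auto
  also have "\<dots> = bdry T (Suc m) (AW X Y (Suc m) (frag_of \<rho>))"
    using simps bdry_AW_terms[of "fst \<rho>" m "snd \<rho>"]
    by (auto simp: simps_sset_prod AW_def simp del: sum.atMost_Suc)
  finally show ?case by simp
qed (simp_all add: AW_def tensor_complex_def bdry_normalized frag_extend_diff)

text \<open>In a path with a bend a vertical step precedes a horizontal one, so for every \<open>i\<close> either the front
  or the back face is degenerate.\<close>

lemma AW_target:
  assumes "c \<in> free_span (target_cells V n)"
  shows "AW X Y n c = 0"
  using assms
proof (induction rule: free_span_induct)
  case (one \<rho>)
  then obtain p \<sigma> q \<tau> \<pi> where \<pi>: "has_path X Y n \<rho> p \<sigma> q \<tau> \<pi>"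
    using W.tgt_cells has_path_ex by (metis cells_normalized subsetD)
  then obtain k where k: "bend \<pi> k" using target_iff one by blast
  have path: "lattice_path p q \<pi>" and len: "length \<pi> = Suc n" and \<sigma>: "\<sigma> \<in> simps X p" "\<tau> \<in> simps Y q"
    and \<rho>: "\<rho> = path_simplex X Y n p \<sigma> q \<tau> \<pi>"
    using \<pi> X.nondegD Y.nondegD by (auto simp: has_path_iff)
  obtain r where r: "k = Suc r" using k by (cases k) (auto simp: bend_def)
  have "AW_term X Y n \<rho> i = 0" if i: "i \<le> n" for i
    unfolding \<rho> path_simplex_def
  proof (rule AW_term_pull_eq_0[OF \<sigma> lattice_path_surj(1,3)[OF path len] i])
    show "(\<exists>k<i. fst (\<pi> ! k) = fst (\<pi> ! Suc k)) \<or> (\<exists>k<n. i \<le> k \<and> snd (\<pi> ! k) = snd (\<pi> ! Suc k))"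
    proof (cases "k \<le> i")
      case True
      then have "r < i" "fst (\<pi> ! r) = fst (\<pi> ! Suc r)" using k by (auto simp: bend_def r)
      then show ?thesis by blast
    next
      case False
      then have "k < n" "i \<le> k" "snd (\<pi> ! k) = snd (\<pi> ! Suc k)" using k len by (auto simp: bend_def)
      then show ?thesis by blast
    qed
  qed
  then show ?case by (simp add: AW_def)
qed (simp_all add: AW_def frag_extend_diff)

text \<open>The critical path turns only at index \<open>p\<close>. Splitting at
  \<open>i > p\<close> leaves a vertical step in the front, splitting at \<open>i < p\<close> a
  horizontal step in the back, so only the splitting at \<open>p\<close> survives.\<close>

lemma AW_critical:
  assumes "\<sigma> \<in> nondeg X p" "\<tau> \<in> nondeg Y q"
  shows "AW X Y (p + q) (frag_of (EZ_critical X Y ((p, \<sigma>), (q, \<tau>)))) = frag_of ((p, \<sigma>), (q, \<tau>))"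
proof -
  let ?n = "p + q" and ?f = "\<lambda>i. min i p" and ?g = "\<lambda>i. i - p"
  let ?\<rho> = "(pull X ?n p ?f \<sigma>, pull Y ?n q ?g \<tau>)"
  have \<sigma>: "\<sigma> \<in> simps X p" and \<tau>: "\<tau> \<in> simps Y q" using assms X.nondegD Y.nondegD by auto
  have f: "mono_upto ?n p ?f" and g: "mono_upto ?n q ?g" by (auto simp: mono_upto_def)
  have zero: "AW_term X Y ?n ?\<rho> i = 0" if "i \<le> ?n" "i \<noteq> p" for i
  proof (rule AW_term_pull_eq_0[OF \<sigma> \<tau> f g that(1)])
    show "(\<exists>k<i. ?f k = ?f (Suc k)) \<or> (\<exists>k<?n. i \<le> k \<and> ?g k = ?g (Suc k))"
    proof (cases "p < i")
      case True
      then show ?thesis by (intro disjI1 exI[of _ p]) auto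
    next
      case False
      then show ?thesis using that by (intro disjI2 exI[of _ i]) auto
    qed
  qed
  have "AW_term X Y ?n ?\<rho> p = frag_of ((p, \<sigma>), (q, \<tau>))"
    using X.pull_pull[OF mono_front[of p ?n] f \<sigma>] Y.pull_pull[OF mono_back[of p ?n] g \<tau>]
      X.pull_id[OF \<sigma>, of "\<lambda>k. min k p"] Y.pull_id[OF \<tau>, of "\<lambda>k. k"] assms
    by (simp add: AW_term_def gen_def tensor_chain_of)
  moreover have "sum (AW_term X Y ?n ?\<rho>) {..?n} = sum (AW_term X Y ?n ?\<rho>) {p}"
    using zero by (intro sum.mono_neutral_right) auto
  ultimately show ?thesis by (simp add: AW_def pull_def)
qed

section \<open>The critical complex as the tensor product\<close>

lemma additive_EZ_identify: "additive_map (chain_group T n) (chain_group W.K n) (EZ_identify X Y)"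
  unfolding EZ_identify_def using EZ_critical_bij[of n]
  by (intro additive_map_extend) (auto simp: bij_betw_def)

lemma additive_EZ_unidentify: "additive_map (chain_group W.K n) (chain_group T n) (EZ_unidentify X Y n)"
  unfolding EZ_unidentify_def using EZ_critical_bij[of n]
  by (intro additive_map_extend) (auto simp: bij_betw_def intro: inv_into_into)

lemma EZ_unidentify_identify: "c \<in> chain_group T n \<Longrightarrow> EZ_unidentify X Y n (EZ_identify X Y c) = c"
  by (induction rule: free_span_induct)
    (simp_all add: EZ_unidentify_def EZ_identify_def frag_extend_diff
      bij_betw_inv_into_left[OF EZ_critical_bij])

lemma EZ_identify_unidentify: "c \<in> chain_group W.K n \<Longrightarrow> EZ_identify X Y (EZ_unidentify X Y n c) = c"
  by (induction rule: free_span_induct)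
    (simp_all add: EZ_unidentify_def EZ_identify_def frag_extend_diff
      bij_betw_inv_into_right[OF EZ_critical_bij])

lemma AW_EZ_identify:
  assumes "c \<in> chain_group T n"
  shows "AW X Y n (EZ_identify X Y c) = c"
  using assms
proof (induction rule: free_span_induct)
  case (one z)
  then show ?case using AW_critical
    by (auto simp: cells_T EZ_identify_def simp del: EZ_critical.simps)
qed (simp_all add: AW_def EZ_identify_def frag_extend_diff)

lemma AW_wred_g:
  assumes "k \<in> free_span (critical_cells C V n)"
  shows "AW X Y n (wred_g C V n k) = AW X Y n k"
proof -
  have "AW X Y n (W.h (n - 1) (bdry C n k)) = 0"
    using W.h_pred_tgt[OF W.span_subs(3)[OF assms]] by (rule AW_target)
  then show ?thesis using W.wred_g_eq[OF assms] by (simp add: AW_def frag_extend_diff)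
qed

lemma bdry_T_0: "bdry T 0 c = 0" if "c \<in> chain_group T 0"
  using that
proof (induction rule: free_span_induct)
  case (one z)
  then show ?case
    by (auto simp: cells_T) (simp add: tensor_complex_def bdry_normalized bdry_gen_def)
qed (simp_all add: tensor_complex_def frag_extend_diff)

text \<open>Let \<open>k\<close> be the image of \<open>c\<close> and apply \<open>AW\<close> to
  \<open>d g k = g d' k\<close>, where \<open>d'\<close> is the critical differential. As
  \<open>AW\<close> is a chain map and \<open>AW g k = c\<close>, the left side becomes the tensor
  boundary of \<open>c\<close>; the right side becomes \<open>AW d' k\<close>, that is
  \<open>d' k\<close> read as a tensor chain.\<close>

lemma bdry_critical:
  assumes "c \<in> chain_group T n"
  shows "bdry W.K n (EZ_identify X Y c) = EZ_identify X Y (bdry T n c)"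
proof (cases n)
  case 0
  then show ?thesis
    using assms W.chain_complex_K additive_map_in[OF additive_EZ_identify assms] bdry_T_0
    by (simp add: chain_complex_def EZ_identify_def)
next
  case (Suc m)
  let ?k = "EZ_identify X Y c" and ?k' = "bdry W.K n (EZ_identify X Y c)"
  have k: "?k \<in> free_span (critical_cells C V n)"
    using additive_map_in[OF additive_EZ_identify assms] by simp
  have k': "?k' \<in> chain_group W.K m"
    using additive_map_in[OF chain_complex_additive[OF W.chain_complex_K], of ?k n] k by (simp add: Suc)
  have "bdry T n c = bdry T n (AW X Y n (wred_g C V n ?k))"
    by (simp add: AW_wred_g[OF k] AW_EZ_identify[OF assms])
  also have "\<dots> = AW X Y m (wred_g C V m ?k')"
    using AW_chain_map[of "wred_g C V n ?k" m] W.g_in[OF k] W.bdry_g[of ?k m] k by (simp add: Suc)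
  also have "\<dots> = AW X Y m (EZ_identify X Y (EZ_unidentify X Y m ?k'))"
    using k' by (simp add: AW_wred_g EZ_identify_unidentify)
  also have "\<dots> = EZ_unidentify X Y m ?k'"
    using additive_map_in[OF additive_EZ_unidentify k'] by (rule AW_EZ_identify)
  finally show ?thesis using EZ_identify_unidentify[OF k'] by simp
qed

lemma additive_bdry_T: "additive_map (chain_group T n) (chain_group T (n - 1)) (bdry T n)"
proof -
  let ?G = "\<lambda>((p, \<sigma>), (q, \<tau>)).
    tensor_chain (p - 1) q (bdry (normalized_complex X) p (frag_of \<sigma>)) (frag_of \<tau>) +
    frag_cmul ((-1) ^ p) (tensor_chain p (q - 1) (frag_of \<sigma>) (bdry (normalized_complex Y) q (frag_of \<tau>)))"
  have "?G z \<in> chain_group T (n - 1)" if z: "z \<in> cells T n" for z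
  proof -
    obtain p \<sigma> q \<tau> where pq: "z = ((p, \<sigma>), (q, \<tau>))" "p + q = n" "\<sigma> \<in> nondeg X p" "\<tau> \<in> nondeg Y q"
      using z by (auto simp: cells_T)
    have "tensor_chain (p - 1) q (bdry (normalized_complex X) p (frag_of \<sigma>)) (frag_of \<tau>) \<in> chain_group T (n - 1)"
    \<comment> \<open>For \<open>p = 0\<close> the truncated index \<open>p - 1\<close> does no
      harm, since the boundary in degree 0 is zero; likewise for \<open>q\<close> below.\<close>
    proof (cases p)
      case (Suc r)
      have "tensor_chain r q (bdry_gen X p \<sigma>) (frag_of \<tau>)
          \<in> free_span {((r, s), (q, t)) | s t. s \<in> nondeg X r \<and> t \<in> nondeg Y q}"
        using bdry_gen_in[of X p \<sigma>] pq(4) by (intro tensor_chain_in) (simp_all add: Suc)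
      also have "\<dots> \<subseteq> chain_group T (n - 1)"
        by (rule free_span_mono) (use pq(2) Suc in \<open>auto simp: cells_T\<close>)
      finally show ?thesis by (simp add: bdry_normalized Suc)
    qed (simp add: bdry_normalized bdry_gen_def)
    moreover have "tensor_chain p (q - 1) (frag_of \<sigma>) (bdry (normalized_complex Y) q (frag_of \<tau>)) \<in> chain_group T (n - 1)"
    proof (cases q)
      case (Suc r)
      have "tensor_chain p r (frag_of \<sigma>) (bdry_gen Y q \<tau>)
          \<in> free_span {((p, s), (r, t)) | s t. s \<in> nondeg X p \<and> t \<in> nondeg Y r}"
        using bdry_gen_in[of Y q \<tau>] pq(3) by (intro tensor_chain_in) (simp_all add: Suc)
      also have "\<dots> \<subseteq> chain_group T (n - 1)"
        by (rule free_span_mono) (use pq(2) Suc in \<open>auto simp: cells_T\<close>)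
      finally show ?thesis by (simp add: bdry_normalized Suc)
    qed (simp add: bdry_normalized bdry_gen_def)
    ultimately show ?thesis by (simp add: pq(1) free_span_add free_span_cmul)
  qed
  then have "additive_map (chain_group T n) (chain_group T (n - 1)) (frag_extend ?G)"
    by (rule additive_map_extend)
  then show ?thesis by (simp add: tensor_complex_def)
qed

end

theorem theorem44:
  fixes X :: "'a sset" and Y :: "'b sset"
  assumes "simplicial_set X" and "simplicial_set Y"
  shows "let C = normalized_complex (sset_prod X Y);
             V = EZ_field X Y;
             K = critical_complex C V;
             T = tensor_complex (normalized_complex X) (normalized_complex Y)
         in admissible_vector_field C V \<and>
            d21_invertible C V \<and>
            reduction C K (wred_f C V) (wred_g C V) (wred_h C V) \<and>
            (\<forall>n. bij_betw (EZ_critical X Y) (cells T n) (cells K n)) \<and>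
            (\<forall>n. \<forall>c\<in>chain_group T n. bdry K n (EZ_identify X Y c) = EZ_identify X Y (bdry T n c)) \<and>
            reduction C T
              (\<lambda>n c. EZ_unidentify X Y n (wred_f C V n c))
              (\<lambda>n c. wred_g C V n (EZ_identify X Y c))
              (wred_h C V)"
proof -
  interpret sset_pair X Y by (rule sset_pair.intro[OF assms])
  have "reduction C T (\<lambda>n c. EZ_unidentify X Y n (wred_f C V n c))
      (\<lambda>n c. wred_g C V n (EZ_identify X Y c)) (wred_h C V)"
    by (rule reduction_transport[OF W.W_reduction additive_EZ_identify additive_EZ_unidentify
          EZ_unidentify_identify EZ_identify_unidentify additive_bdry_T bdry_critical])
  then show ?thesis
    unfolding Let_def
    using M.admissible M.d21_invertible W.W_reduction EZ_critical_bij bdry_critical by simp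
qed

end
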